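(* For any instance $(G,\mathcal{L},x)$ of the laminar thin tree problem and any $\eta>2$, one can find in polynomial time a laminar family $\mathcal{L}'\subseteq 2^V$ and a point $x'\in P_{\mathrm{st}}(G)$ such that: (i) $x'$ is $\mathcal{L}'$-aligned; (ii) $x'$ is dominated by $\eta x$, i.e. $\eta x - x' \ge 0$ componentwise; (iii) if $T$ is a spanning tree of $G$ and $\alpha,\beta\ge 0$ are such that $|T\cap\delta(S)|\le \alpha\, x'(\delta(S))+\beta$ for all $S\in\mathcal{L}'$, then $|T\cap\delta(S)|\le \frac{1}{1-\frac{2}{\eta}}(\eta\alpha+\beta)\,x(\delta(S))$ for all $S\in\mathcal{L}$.
   Context: Let $G=(V,E)$ be a connected undirected graph with edge costs $c:E\to\mathbb{R}_{\ge0}$. For $S\subseteq V$, $\delta(S)$ is the set of edges with exactly one endpoint in $S$, $E(S)$ is the set of edges with both endpoints in $S$, $G[S]$ is the induced subgraph, and $x(F)=\sum_{e\in F}x_e$. A family $\mathcal{L}\subseteq 2^V$ is laminar if for all $S,T\in\mathcal{L}$, $S\cap T\in\{\emptyset,S,T\}$; it is assumed $V\in\mathcal{L}$. Each $S\in\mathcal{L}$ has a degree bound $b_S\in\mathbb{Z}_{\ge 0}$. The spanning tree polytope of a graph $H=(W,F)$ is $P_{\mathrm{st}}(H)=\{y\in\mathbb{R}^F_{\ge0}: y(F)=|W|-1,\ y(F(U))\le |U|-1\ \forall U\subseteq W\}$. An instance $(G,\mathcal{L},x)$ consists of $G$, $\mathcal{L}$, and a point $x$ feasible for the LP $\min\sum_e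 c_ex_e$ subject to $x(\delta(S))\le b_S$ for all $S\in\mathcal{L}$ and $x\in P_{\mathrm{st}}(G)$. For a laminar family $\mathcal{L}'$, a point $x'\in P_{\mathrm{st}}(G)$ is $\mathcal{L}'$-aligned if $x'_{\mid E(S)}\in P_{\mathrm{st}}(G[S])$ for every $S\in\mathcal{L}'$. *)

theory Defs
  imports Complex_Main "HOL-Computational_Algebra.Polynomial"
begin

section \<open>Graphs, laminar families, spanning tree polytope\<close>

text \<open>Edges are abstract names with an unordered pair of endpoints, so parallel edges are allowed;
  a simple graph is the case where \<open>ends\<close> is the identity on a set of two-element sets.\<close>

record ('v, 'e) ugraph =
  verts :: "'v set"
  edges :: "'e set"
  ends :: "'e \<Rightarrow> 'v set"

definition undirected_graph :: "('v, 'e) ugraph \<Rightarrow> bool" where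
  "undirected_graph G \<longleftrightarrow> finite (verts G) \<and> finite (edges G) \<and>
     (\<forall>e\<in>edges G. ends G e \<subseteq> verts G \<and> card (ends G e) = 2)"

definition connected_graph :: "('v, 'e) ugraph \<Rightarrow> bool" where
  "connected_graph G \<longleftrightarrow> verts G \<noteq> {} \<and>
     (\<forall>u\<in>verts G. \<forall>v\<in>verts G. (u, v) \<in> {(a, b). \<exists>e\<in>edges G. ends G e = {a, b}}\<^sup>*)"

definition cut_edges :: "('v, 'e) ugraph \<Rightarrow> 'v set \<Rightarrow> 'e set" where
  "cut_edges G S = {e \<in> edges G. card (ends G e \<inter> S) = 1}"

definition inner_edges :: "('v, 'e) ugraph \<Rightarrow> 'v set \<Rightarrow> 'e set" where
  "inner_edges G S = {e \<in> edges G. ends G e \<subseteq> S}"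

definition induced :: "('v, 'e) ugraph \<Rightarrow> 'v set \<Rightarrow> ('v, 'e) ugraph" where
  "induced G S = G\<lparr>verts := S, edges := inner_edges G S\<rparr>"

text \<open>A cycle of length \<open>k \<ge> 2\<close>; for \<open>k = 2\<close> it consists of two parallel edges.\<close>

definition is_cycle :: "('v, 'e) ugraph \<Rightarrow> 'v list \<Rightarrow> 'e list \<Rightarrow> bool" where
  "is_cycle G us fs \<longleftrightarrow> 2 \<le> length us \<and> length fs = length us \<and> distinct us \<and> distinct fs \<and>
     set fs \<subseteq> edges G \<and>
     (\<forall>i<length us. ends G (fs ! i) = {us ! i, us ! (Suc i mod length us)})"

definition spanning_tree :: "('v, 'e) ugraph \<Rightarrow> 'e set \<Rightarrow> bool" where
  "spanning_tree G T \<longleftrightarrow> T \<subseteq> edges G \<and> connected_graph (G\<lparr>edges := T\<rparr>) \<and>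
     \<not> (\<exists>us fs. is_cycle (G\<lparr>edges := T\<rparr>) us fs)"

text \<open>The sets \<open>U\<close> range over nonempty sets: for \<open>U = {}\<close> the inequality would read \<open>0 \<le> -1\<close>.
  Points are total functions whose values outside the edge set are irrelevant, so
  \<open>y \<in> spanning_tree_polytope (induced G S)\<close> speaks about the restriction of \<open>y\<close> to the edges
  inside \<open>S\<close>.\<close>

definition spanning_tree_polytope :: "('v, 'e) ugraph \<Rightarrow> ('e \<Rightarrow> real) set" where
  "spanning_tree_polytope H = {y.
     (\<forall>e\<in>edges H. 0 \<le> y e) \<and>
     sum y (edges H) = real (card (verts H)) - 1 \<and>
     (\<forall>U. U \<subseteq> verts H \<and> U \<noteq> {} \<longrightarrow> sum y (inner_edges H U) \<le> real (card U) - 1)}"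

definition laminar :: "'v set set \<Rightarrow> bool" where
  "laminar L \<longleftrightarrow> (\<forall>S\<in>L. \<forall>T\<in>L. S \<inter> T \<in> {{}, S, T})"

definition aligned :: "('v, 'e) ugraph \<Rightarrow> 'v set set \<Rightarrow> ('e \<Rightarrow> real) \<Rightarrow> bool" where
  "aligned G L x \<longleftrightarrow> (\<forall>S\<in>L. x \<in> spanning_tree_polytope (induced G S))"

definition laminar_instance ::
  "('v, 'e) ugraph \<Rightarrow> ('e \<Rightarrow> real) \<Rightarrow> 'v set set \<Rightarrow> ('v set \<Rightarrow> nat) \<Rightarrow> ('e \<Rightarrow> real) \<Rightarrow> bool" where
  "laminar_instance G c L b x \<longleftrightarrow>
     undirected_graph G \<and> connected_graph G \<and> (\<forall>e\<in>edges G. 0 \<le> c e) \<and>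
     L \<subseteq> Pow (verts G) \<and> laminar L \<and> verts G \<in> L \<and>
     (\<forall>S\<in>L. sum x (cut_edges G S) \<le> real (b S)) \<and> x \<in> spanning_tree_polytope G"

section \<open>Running time\<close>

text \<open>
  Programs are while-programs over arrays of natural numbers and arrays of reals; an array is a
  name together with a tuple of indices. A read-only real store holds the numerical input data.
  Every assignment and every test costs one step.

  The arithmetic is deliberately restricted: on natural numbers only addition and truncated
  subtraction, on reals only addition, subtraction and multiplication of a computed value by an
  \<^emph>\<open>input\<close> value (and no rounding of reals to integers). Hence a run of \<open>t\<close> steps on rational input
  of total encoding length \<open>s\<close> only produces numbers whose encoding length is polynomial in \<open>t\<close>
  and \<open>s\<close>. A polynomial bound on the number of steps in terms of the number of data items is thus
  a strongly polynomial running time, and on rational data it gives polynomial time in the Turing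
  machine sense. At the same time the model makes sense for arbitrary real data.
\<close>

type_synonym 'a store = "string \<Rightarrow> nat list \<Rightarrow> 'a"

datatype nexp =
    NConst nat
  | NRead string "nexp list"
  | NAdd nexp nexp
  | NSub nexp nexp

datatype rexp =
    RNat nexp
  | RRead string "nexp list"
  | RInput string "nexp list"
  | RAdd rexp rexp
  | RSub rexp rexp
  | RScale string "nexp list" rexp

datatype bexp =
    NLess nexp nexp
  | RLess rexp rexp
  | Neg bexp
  | Conj bexp bexp

datatype com =
    NWrite string "nexp list" nexp
  | RWrite string "nexp list" rexp
  | Seq com com
  | Cond bexp com com
  | While bexp com

fun nval :: "nat store \<Rightarrow> nexp \<Rightarrow> nat" where
  "nval N (NConst k) = k"
| "nval N (NRead a is) = N a (map (nval N) is)"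
| "nval N (NAdd e f) = nval N e + nval N f"
| "nval N (NSub e f) = nval N e - nval N f"

fun rval :: "real store \<Rightarrow> nat store \<Rightarrow> real store \<Rightarrow> rexp \<Rightarrow> real" where
  "rval inp N R (RNat e) = real (nval N e)"
| "rval inp N R (RRead a is) = R a (map (nval N) is)"
| "rval inp N R (RInput a is) = inp a (map (nval N) is)"
| "rval inp N R (RAdd e f) = rval inp N R e + rval inp N R f"
| "rval inp N R (RSub e f) = rval inp N R e - rval inp N R f"
| "rval inp N R (RScale a is e) = inp a (map (nval N) is) * rval inp N R e"

fun bval :: "real store \<Rightarrow> nat store \<Rightarrow> real store \<Rightarrow> bexp \<Rightarrow> bool" where
  "bval inp N R (NLess e f) \<longleftrightarrow> nval N e < nval N f"
| "bval inp N R (RLess e f) \<longleftrightarrow> rval inp N R e < rval inp N R f"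
| "bval inp N R (Neg b) \<longleftrightarrow> \<not> bval inp N R b"
| "bval inp N R (Conj b d) \<longleftrightarrow> bval inp N R b \<and> bval inp N R d"

definition upd_cell :: "'a store \<Rightarrow> string \<Rightarrow> nat list \<Rightarrow> 'a \<Rightarrow> 'a store" where
  "upd_cell M a is v = M(a := (M a)(is := v))"

text \<open>\<open>exec inp C (N, R) t (N', R')\<close>: started in memory \<open>(N, R)\<close>, the program \<open>C\<close> halts after
  exactly \<open>t\<close> steps in memory \<open>(N', R')\<close>.\<close>

inductive exec ::
  "real store \<Rightarrow> com \<Rightarrow> nat store \<times> real store \<Rightarrow> nat \<Rightarrow> nat store \<times> real store \<Rightarrow> bool"
  for inp :: "real store" where
  NWrite: "exec inp (NWrite a is e) (N, R) 1 (upd_cell N a (map (nval N) is) (nval N e), R)"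
| RWrite: "exec inp (RWrite a is e) (N, R) 1 (N, upd_cell R a (map (nval N) is) (rval inp N R e))"
| Seq: "exec inp C s t1 s1 \<Longrightarrow> exec inp D s1 t2 s2 \<Longrightarrow> exec inp (Seq C D) s (t1 + t2) s2"
| CondTrue: "bval inp N R b \<Longrightarrow> exec inp C (N, R) t s \<Longrightarrow> exec inp (Cond b C D) (N, R) (Suc t) s"
| CondFalse: "\<not> bval inp N R b \<Longrightarrow> exec inp D (N, R) t s \<Longrightarrow> exec inp (Cond b C D) (N, R) (Suc t) s"
| WhileFalse: "\<not> bval inp N R b \<Longrightarrow> exec inp (While b C) (N, R) 1 (N, R)"
| WhileTrue: "bval inp N R b \<Longrightarrow> exec inp C (N, R) t1 s1 \<Longrightarrow> exec inp (While b C) s1 t2 s2 \<Longrightarrow>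
     exec inp (While b C) (N, R) (Suc (t1 + t2)) s2"

inductive_cases exec_NWriteE: "exec inp (NWrite a is e) s t s'"
inductive_cases exec_RWriteE: "exec inp (RWrite a is e) s t s'"
inductive_cases exec_SeqE: "exec inp (Seq C D) s t s'"
inductive_cases exec_CondE: "exec inp (Cond b C D) s t s'"
inductive_cases exec_WhileE: "exec inp (While b C) s t s'"

lemma exec_deterministic:
  "exec inp C s t s' \<Longrightarrow> exec inp C s u s'' \<Longrightarrow> t = u \<and> s' = s''"
proof (induction arbitrary: u s'' rule: exec.induct)
  case (NWrite a "is" e N R)
  from NWrite.prems show ?case by (rule exec_NWriteE) simp
next
  case (RWrite a "is" e N R)
  from RWrite.prems show ?case by (rule exec_RWriteE) simp
next
  case (Seq C s t1 s1 D t2 s2)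
  from Seq.prems obtain u1 r1 u2 where r: "u = u1 + u2" "exec inp C s u1 r1" "exec inp D r1 u2 s''"
    by (rule exec_SeqE)
  from Seq.IH(1)[OF r(2)] have 1: "t1 = u1" "s1 = r1" by simp_all
  from Seq.IH(2)[of u2 s''] r(3) 1 have "t2 = u2" "s2 = s''" by simp_all
  with 1 r(1) show ?case by simp
next
  case (CondTrue N R b C t s D)
  from CondTrue.prems obtain u' where "u = Suc u'" "exec inp C (N, R) u' s''"
    by (rule exec_CondE) (use CondTrue.hyps in simp_all)
  with CondTrue.IH show ?case by simp
next
  case (CondFalse N R b D t s C)
  from CondFalse.prems obtain u' where "u = Suc u'" "exec inp D (N, R) u' s''"
    by (rule exec_CondE) (use CondFalse.hyps in simp_all)
  with CondFalse.IH show ?case by simp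
next
  case (WhileFalse N R b C)
  from WhileFalse.prems show ?case by (rule exec_WhileE) (use WhileFalse.hyps in simp_all)
next
  case (WhileTrue N R b C t1 s1 t2 s2)
  from WhileTrue.prems obtain u1 r1 u2 where
    r: "u = Suc (u1 + u2)" "exec inp C (N, R) u1 r1" "exec inp (While b C) r1 u2 s''"
    by (rule exec_WhileE) (use WhileTrue.hyps in simp_all)
  from WhileTrue.IH(1)[OF r(2)] have 1: "t1 = u1" "s1 = r1" by simp_all
  from WhileTrue.IH(2)[of u2 s''] r(3) 1 have "t2 = u2" "s2 = s''" by simp_all
  with 1 r(1) show ?case by simp
qed

text \<open>The lists \<open>vs\<close>, \<open>es\<close>, \<open>Ls\<close> enumerate vertices, edges and the laminar family, which the program
  addresses by position. The two endpoints of an edge are given in arbitrary order. Nothing is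
  assumed about cells that hold no input.\<close>

definition encodes_input ::
  "('v, 'e) ugraph \<Rightarrow> 'v set set \<Rightarrow> ('e \<Rightarrow> real) \<Rightarrow> real \<Rightarrow>
   'v list \<Rightarrow> 'e list \<Rightarrow> 'v set list \<Rightarrow> real store \<Rightarrow> nat store \<Rightarrow> bool" where
  "encodes_input G L x \<eta> vs es Ls inp N \<longleftrightarrow>
     distinct vs \<and> set vs = verts G \<and> distinct es \<and> set es = edges G \<and> distinct Ls \<and> set Ls = L \<and>
     N ''n'' [] = length vs \<and> N ''m'' [] = length es \<and> N ''k'' [] = length Ls \<and>
     (\<forall>j<length es. N ''tail'' [j] < length vs \<and> N ''head'' [j] < length vs \<and>
        ends G (es ! j) = {vs ! N ''tail'' [j], vs ! N ''head'' [j]}) \<and>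
     (\<forall>i<length Ls. \<forall>v<length vs. N ''member'' [i, v] = (if vs ! v \<in> Ls ! i then 1 else 0)) \<and>
     (\<forall>j<length es. inp ''x'' [j] = x (es ! j)) \<and> inp ''eta'' [] = \<eta>"

definition encodes_output ::
  "'v list \<Rightarrow> 'e list \<Rightarrow> nat store \<Rightarrow> real store \<Rightarrow> 'v set set \<Rightarrow> ('e \<Rightarrow> real) \<Rightarrow> bool" where
  "encodes_output vs es N R L' x' \<longleftrightarrow>
     L' = {{vs ! v |v. v < length vs \<and> N ''out_member'' [i, v] = 1} |i. i < N ''out_k'' []} \<and>
     (\<forall>j<length es. x' (es ! j) = R ''out_x'' [j])"

end

theory Submission
  imports Defs
begin

text \<open>
  Put \<open>w = \<eta> x\<close> and grow a vector \<open>y \<le> w\<close> in the forest polytope greedily, starting from \<open>0\<close>: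
  go through the sets of the laminar family by increasing size and raise every edge inside the
  current set as far as possible. An edge that does not reach \<open>w\<close> lies in a tight set, that
  is, a set \<open>U\<close> with \<open>y(E(U)) = |U| - 1\<close>. Intersecting tight sets have a tight union and tight
  sets stay tight, so a partition of the vertices into tight sets can be maintained that only
  becomes coarser. The classes of these partitions form the new family; tightness means that
  \<open>y\<close> is aligned with it.

  When all edges inside \<open>S\<close> have been treated, no edge leaving \<open>S\<close> carries weight yet, so the
  classes that meet \<open>S\<close> form a partition \<open>S\<^sub>1, \<dots>, S\<^sub>p\<close> of \<open>S\<close>, and the edges between them
  satisfy \<open>y = \<eta> x\<close>. Comparing \<open>y(E(S)) \<le> |S| - 1\<close> with tightness of the classes, their total
  \<open>x\<close>-weight is at most \<open>(p - 1) / \<eta>\<close>. Since \<open>x(\<delta>(S\<^sub>i)) \<ge> 1\<close>, this bounds both \<open>p\<close> and \<open>\<Sum>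
  x(\<delta>(S\<^sub>i))\<close> by \<open>x(\<delta>(S)) / (1 - 2 / \<eta>)\<close>. For \<open>S = V\<close> it forces \<open>y\<close> into the spanning tree
  polytope.

  By Hakimi's orientation theorem, the largest admissible value of an edge with tail \<open>r\<close> is a
  flow value: distribute the weight of every edge over its two endpoints such that \<open>r\<close>
  receives nothing and every other vertex at most \<open>1\<close>. A push-relabel method that discharges
  the vertices level by level, from the highest level down, relabels a vertex in every pass
  until no active vertex is left. Hence a fixed number of passes suffices, and the whole
  algorithm consists of counting loops.
\<close>

section \<open>Counting-loop programs\<close>

datatype loop_com =
    Skip
  | AssignN string "nexp list" nexp
  | AssignR string "nexp list" rexp
  | Then loop_com loop_com (infixr \<open>;;\<close> 60)
  | IfElse bexp loop_com loop_com
  | For string string nat loop_com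

text \<open>The target language has no empty statement; a loop whose test \<open>0 < 0\<close> fails
  at once takes its place. A compiled loop reads its bound again at every test, whereas
  \<open>sem\<close> reads it once; \<open>well_formed\<close> makes the two agree.\<close>

fun compile :: "loop_com \<Rightarrow> com" where
  "compile Skip = While (NLess (NConst 0) (NConst 0)) (NWrite [] [] (NConst 0))"
| "compile (AssignN a is e) = NWrite a is e"
| "compile (AssignR a is e) = RWrite a is e"
| "compile (C ;; D) = Seq (compile C) (compile D)"
| "compile (IfElse b C D) = Cond b (compile C) (compile D)"
| "compile (For v a c C) = Seq (NWrite v [] (NConst 0))
     (While (NLess (NRead v []) (NAdd (NRead a []) (NConst c)))
       (Seq (compile C) (NWrite v [] (NAdd (NRead v []) (NConst 1)))))"

type_synonym state = "nat store \<times> real store"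

definition set_counter :: "string \<Rightarrow> nat \<Rightarrow> state \<Rightarrow> state" where
  "set_counter v i s = (upd_cell (fst s) v [] i, snd s)"

fun sem :: "real store \<Rightarrow> loop_com \<Rightarrow> state \<Rightarrow> state" where
  "sem inp Skip s = s"
| "sem inp (AssignN a is e) s = (upd_cell (fst s) a (map (nval (fst s)) is) (nval (fst s) e), snd s)"
| "sem inp (AssignR a is e) s =
     (fst s, upd_cell (snd s) a (map (nval (fst s)) is) (rval inp (fst s) (snd s) e))"
| "sem inp (C ;; D) s = sem inp D (sem inp C s)"
| "sem inp (IfElse b C D) s = (if bval inp (fst s) (snd s) b then sem inp C s else sem inp D s)"
| "sem inp (For v a c C) s =
     (let k = fst s a [] + c
      in set_counter v k (fold (\<lambda>i s. sem inp C (set_counter v i s)) [0..<k] s))"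

fun nat_writes :: "loop_com \<Rightarrow> string set" where
  "nat_writes Skip = {}"
| "nat_writes (AssignN a is e) = {a}"
| "nat_writes (AssignR a is e) = {}"
| "nat_writes (C ;; D) = nat_writes C \<union> nat_writes D"
| "nat_writes (IfElse b C D) = nat_writes C \<union> nat_writes D"
| "nat_writes (For v a c C) = insert v (nat_writes C)"

fun real_writes :: "loop_com \<Rightarrow> string set" where
  "real_writes Skip = {}"
| "real_writes (AssignN a is e) = {}"
| "real_writes (AssignR a is e) = {a}"
| "real_writes (C ;; D) = real_writes C \<union> real_writes D"
| "real_writes (IfElse b C D) = real_writes C \<union> real_writes D"
| "real_writes (For v a c C) = real_writes C"

fun well_formed :: "loop_com \<Rightarrow> bool" where
  "well_formed (C ;; D) \<longleftrightarrow> well_formed C \<and> well_formed D"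
| "well_formed (IfElse b C D) \<longleftrightarrow> well_formed C \<and> well_formed D"
| "well_formed (For v a c C) \<longleftrightarrow> well_formed C \<and> a \<in> {''n'', ''m'', ''k''}
    \<and> v \<notin> nat_writes C \<and> nat_writes C \<inter> {''n'', ''m'', ''k''} = {} \<and>
     v \<notin> {''n'', ''m'', ''k''}"
| "well_formed (AssignN a is e) \<longleftrightarrow> a \<notin> {''n'', ''m'', ''k''}"
| "well_formed _ \<longleftrightarrow> True"

text \<open>The variable of the polynomial stands for a common bound on the three sizes. Adding the
  costs of both branches avoids a maximum of polynomials. A loop pays 2 for setting its counter and
  for the last, failing test, and 2 more per round for the test and the increment.\<close>

fun cost :: "loop_com \<Rightarrow> nat poly" where
  "cost Skip = 1"
| "cost (AssignN a is e) = 1"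
| "cost (AssignR a is e) = 1"
| "cost (C ;; D) = cost C + cost D"
| "cost (IfElse b C D) = 1 + (cost C + cost D)"
| "cost (For v a c C) = [:2:] + [:c, 1:] * (cost C + [:2:])"

section \<open>Frame rules, loop rule and running time of compiled programs\<close>

lemma upd_cell_apply:
  "upd_cell M a is v b js = (if b = a \<and> js = is then v else M b js)"
  by (simp add: upd_cell_def)

lemma upd_cell_other: "b \<noteq> a \<Longrightarrow> upd_cell M a is v b = M b"
  by (simp add: upd_cell_def)

lemma fst_set_counter: "fst (set_counter v i s) = upd_cell (fst s) v [] i"
  and snd_set_counter [simp]: "snd (set_counter v i s) = snd s"
  by (simp_all add: set_counter_def)

lemma sem_frame_nat: "a \<notin> nat_writes C \<Longrightarrow> fst (sem inp C s) a = fst s a"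
proof (induction C arbitrary: s)
  case (For v b c C)
  have "fst (fold (\<lambda>i s. sem inp C (set_counter v i s)) xs s) a = fst s a" for xs s
    using For by (induction xs arbitrary: s) (auto simp: fst_set_counter upd_cell_other)
  with For.prems show ?case by (auto simp: Let_def fst_set_counter upd_cell_other)
qed (auto simp: upd_cell_other)

lemma sem_frame_real: "a \<notin> real_writes C \<Longrightarrow> snd (sem inp C s) a = snd s a"
proof (induction C arbitrary: s)
  case (For v b c C)
  have "snd (fold (\<lambda>i s. sem inp C (set_counter v i s)) xs s) a = snd s a" for xs s
    using For by (induction xs arbitrary: s) auto
  then show ?case by (auto simp: Let_def)
qed (auto simp: upd_cell_other)

text \<open>The frame is built into the step premise: names that the loop does not write still hold
  their initial values, so an invariant has to mention only what changes. The last premise reflects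
  that the counter ends at \<open>k\<close>.\<close>

lemma sem_For_invariant:
  assumes k: "fst s a [] + c = k"
    and init: "I 0 s"
    and step: "\<And>i s'. i < k \<Longrightarrow> I i s' \<Longrightarrow> (\<And>a. a \<notin> insert v
        (nat_writes C) \<Longrightarrow> fst s' a = fst s a) \<Longrightarrow>
      (\<And>a. a \<notin> real_writes C \<Longrightarrow> snd s' a = snd s a) \<Longrightarrow> I (Suc i)
          (sem inp C (set_counter v i s'))"
    and final: "\<And>s'. I k s' \<Longrightarrow> Q (set_counter v k s')"
  shows "Q (sem inp (For v a c C) s)"
proof -
  let ?f = "\<lambda>i s. sem inp C (set_counter v i s)"
  have frame: "(\<forall>a. a \<notin> insert v (nat_writes C) \<longrightarrow> fst (fold ?f xs s') a =
      fst s' a) \<and>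
    (\<forall>a. a \<notin> real_writes C \<longrightarrow> snd (fold ?f xs s') a = snd s' a)" for xs s'
    by (induction xs arbitrary: s')
      (auto simp: sem_frame_nat sem_frame_real fst_set_counter upd_cell_other)
  have "j \<le> k \<Longrightarrow> I j (fold ?f [0..<j] s)" for j
  proof (induction j)
    case (Suc j)
    then show ?case
      using step[of j "fold ?f [0..<j] s"] frame[of "[0..<j]" s] by simp
  qed (simp add: init)
  then show ?thesis using k final[of "fold ?f [0..<k] s"] by (simp add: Let_def)
qed

text \<open>Induction on the program; a loop needs an inner induction on the number
  \<open>k - i\<close> of remaining rounds, carrying along that the sizes are unchanged.\<close>

lemma exec_compile:
  assumes "well_formed C" "\<And>a. a \<in> {''n'', ''m'', ''k''} \<Longrightarrow> fst s a [] \<le> M"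
  shows "\<exists>t. exec inp (compile C) s t (sem inp C s) \<and> t \<le> poly (cost C) M"
  using assms
proof (induction C arbitrary: s)
  case Skip
  have "exec inp (compile Skip) (fst s, snd s) 1 (fst s, snd s)"
    unfolding compile.simps by (rule exec.WhileFalse) simp
  then show ?case by auto
next
  case (AssignN a "is" e)
  show ?case using exec.NWrite[of inp a "is" e "fst s" "snd s"] by auto
next
  case (AssignR a "is" e)
  show ?case using exec.RWrite[of inp a "is" e "fst s" "snd s"] by auto
next
  case (Then C D)
  \<comment> \<open>Well-formed programs never write the sizes, so these are still bounded by
    \<open>M\<close> when the second program starts.\<close>
  have wf: "nat_writes C \<inter> {''n'', ''m'', ''k''} = {}" if "well_formed C" for C
    using that by (induction C) auto
  obtain t where t: "exec inp (compile C) s t (sem inp C s)" "t \<le> poly (cost C) M"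
    using Then.IH(1)[of s] Then.prems by auto
  have "fst (sem inp C s) a [] \<le> M" if "a \<in> {''n'', ''m'', ''k''}" for a
    using Then.prems(2)[OF that] sem_frame_nat[of a C inp s] wf[of C] Then.prems(1) that by auto
  then obtain u where u: "exec inp (compile D) (sem inp C s) u (sem inp D (sem inp C s))"
    "u \<le> poly (cost D) M"
    using Then.IH(2)[of "sem inp C s"] Then.prems(1) by auto
  show ?case using exec.Seq[OF t(1) u(1)] t(2) u(2) by (auto intro!: exI[of _ "t + u"])
next
  case (IfElse b C D)
  show ?case
  proof (cases "bval inp (fst s) (snd s) b")
    case True
    obtain t where t: "exec inp (compile C) s t (sem inp C s)" "t \<le> poly (cost C) M"
      using IfElse.IH(1)[of s] IfElse.prems by auto
    have "exec inp (compile (IfElse b C D)) s (Suc t) (sem inp C s)"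
      using exec.CondTrue[OF True, of "compile C" t] t(1) by simp
    with True t(2) show ?thesis by (auto intro!: exI[of _ "Suc t"])
  next
    case False
    obtain t where t: "exec inp (compile D) s t (sem inp D s)" "t \<le> poly (cost D) M"
      using IfElse.IH(2)[of s] IfElse.prems by auto
    have "exec inp (compile (IfElse b C D)) s (Suc t) (sem inp D s)"
      using exec.CondFalse[OF False, of "compile D" t] t(1) by simp
    with False t(2) show ?thesis by (auto intro!: exI[of _ "Suc t"])
  qed
next
  case (For v a c C)
  let ?f = "\<lambda>i s. sem inp C (set_counter v i s)"
  let ?b = "NLess (NRead v []) (NAdd (NRead a []) (NConst c))"
  let ?W = "While ?b (Seq (compile C) (NWrite v [] (NAdd (NRead v []) (NConst 1))))"
  define k where "k = fst s a [] + c"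
  have wf: "well_formed C" "v \<notin> nat_writes C" "nat_writes C \<inter> {''n'', ''m'', ''k''} = {}"
    "v \<notin> {''n'', ''m'', ''k''}" "a \<in> {''n'', ''m'', ''k''}" using For.prems(1) by auto
  have loop: "\<exists>t. exec inp ?W (set_counter v i s') t
      (set_counter v k (fold ?f [i..<k] s')) \<and> t \<le> 1 + (k - i) * (poly (cost C) M + 2)"
    if "i \<le> k" "\<And>b. b \<in> {''n'', ''m'', ''k''} \<Longrightarrow> fst s' b = fst s b" for i s'
    using that
  proof (induction "k - i" arbitrary: i s')
    case 0
    then have ik: "i = k" by simp
    have "\<not> bval inp (fst (set_counter v k s')) (snd (set_counter v k s')) ?b"
      using 0(3)[OF wf(5)] wf(4,5) by (auto simp: fst_set_counter upd_cell_apply k_def)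
    from exec.WhileFalse[OF this] show ?case using ik by (auto simp: set_counter_def)
  next
    case (Suc j)
    define s1 where "s1 = ?f i s'"
    have fr: "fst s1 b = fst s b" if "b \<in> {''n'', ''m'', ''k''}" for b
      using that Suc.prems(2)[OF that] wf(3,4)
      by (auto simp: s1_def sem_frame_nat fst_set_counter upd_cell_other)
    have v1: "fst s1 v [] = i"
      using wf(2) by (simp add: s1_def sem_frame_nat fst_set_counter upd_cell_apply)
    have "fst (set_counter v i s') b [] \<le> M" if "b \<in> {''n'', ''m'', ''k''}" for b
      using that Suc.prems(2)[OF that] For.prems(2)[OF that] wf(4)
      by (auto simp: fst_set_counter upd_cell_other)
    then obtain t where t: "exec inp (compile C) (set_counter v i s') t s1" "t \<le> poly (cost C) M"
      using For.IH[of "set_counter v i s'"] wf(1) unfolding s1_def by blast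
    have inc: "exec inp (NWrite v [] (NAdd (NRead v []) (NConst 1))) s1 1 (set_counter v (Suc i) s1)"
      using exec.NWrite[of inp v "[]" "NAdd (NRead v []) (NConst 1)" "fst s1" "snd s1"] v1
      by (simp add: set_counter_def)
    have j: "j = k - Suc i" "Suc i \<le> k" using Suc.hyps(2) by auto
    obtain u where u: "exec inp ?W (set_counter v (Suc i) s1) u
        (set_counter v k (fold ?f [Suc i..<k] s1))" "u \<le> 1 + (k - Suc i) * (poly (cost C) M + 2)"
      using Suc.hyps(1)[OF j fr] by blast
    have b: "bval inp (fst (set_counter v i s')) (snd (set_counter v i s')) ?b"
      using Suc.hyps(2) Suc.prems(2)[OF wf(5)] wf(4,5)
      by (auto simp: fst_set_counter upd_cell_apply k_def)
    have "exec inp ?W (set_counter v i s') (Suc ((t + 1) + u))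
        (set_counter v k (fold ?f [Suc i..<k] s1))"
      using exec.WhileTrue[OF b, of _ "t + 1"] exec.Seq[OF t(1) inc] u(1) by (simp add: set_counter_def)
    moreover have "fold ?f [i..<k] s' = fold ?f [Suc i..<k] s1"
      using Suc.hyps(2) by (simp add: upt_conv_Cons s1_def)
    moreover have "k - i = Suc (k - Suc i)" using Suc.hyps(2) by simp
    ultimately show ?case using t(2) u(2) by (auto intro!: exI[of _ "Suc ((t + 1) + u)"])
  qed
  obtain t where t: "exec inp ?W (set_counter v 0 s) t (set_counter v k (fold ?f [0..<k] s))"
    "t \<le> 1 + k * (poly (cost C) M + 2)" using loop[of 0 s] by auto
  have init: "exec inp (NWrite v [] (NConst 0)) s 1 (set_counter v 0 s)"
    using exec.NWrite[of inp v "[]" "NConst 0" "fst s" "snd s"] by (simp add: set_counter_def)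
  have "k \<le> M + c" using For.prems(2)[OF wf(5)] by (simp add: k_def)
  then have "k * (poly (cost C) M + 2) \<le> (M + c) * (poly (cost C) M + 2)" by (rule mult_right_mono) simp
  then have "1 + t \<le> poly (cost (For v a c C)) M" using t(2) by (simp add: algebra_simps)
  then show ?case using exec.Seq[OF init t(1)] by (auto simp: k_def Let_def intro!: exI[of _ "1 + t"])
qed

section \<open>Push-relabel on vertex pairs\<close>

definition excess :: "nat \<Rightarrow> (nat \<Rightarrow> real) \<Rightarrow> (nat \<Rightarrow> nat
    \<Rightarrow> real) \<Rightarrow> nat \<Rightarrow> real" where
  "excess n cap z v = (\<Sum>u<n. z v u) - cap v"

text \<open>The weight of the pair \<open>{v, u}\<close> is split into the shares \<open>z v u\<close> of \<open>v\<close> and \<open>z u v\<close> of \<open>u\<close>.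
  A vertex of positive height never falls below its capacity again.\<close>

definition preflow ::
  "nat \<Rightarrow> (nat \<Rightarrow> real) \<Rightarrow> (nat \<Rightarrow> nat \<Rightarrow> real)
      \<Rightarrow> (nat \<Rightarrow> nat \<Rightarrow> real) \<Rightarrow> (nat \<Rightarrow> nat)
          \<Rightarrow> bool" where
  "preflow n cap z0 z d \<longleftrightarrow>
     (\<forall>v<n. \<forall>w<n. 0 \<le> z v w \<and> z v w + z w v = z0 v w + z0 w v \<and> (0 < z v w
         \<longrightarrow> d v \<le> Suc (d w))) \<and>
     (\<forall>v<n. d v \<le> n \<and> (0 < d v \<longrightarrow> 0 \<le> excess n cap z v))"

definition push :: "nat \<Rightarrow> nat \<Rightarrow> real \<Rightarrow> (nat \<Rightarrow> nat
    \<Rightarrow> real) \<Rightarrow> nat \<Rightarrow> nat \<Rightarrow> real" where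
  "push v w r z = (\<lambda>a b. if a = v \<and> b = w then z a b - r else if a = w \<and> b = v then z a b
      + r else z a b)"

text \<open>Vertices of height \<open>n\<close> are not discharged any more, so their excess does
  not count as active.\<close>

definition no_active :: "nat \<Rightarrow> (nat \<Rightarrow> real) \<Rightarrow> (nat \<Rightarrow> nat
    \<Rightarrow> real) \<Rightarrow> (nat \<Rightarrow> nat) \<Rightarrow> bool" where
  "no_active n cap z d \<longleftrightarrow> (\<forall>v<n. 0 < excess n cap z v \<longrightarrow> n \<le> d v)"

section \<open>Duality between excess and overfull vertex sets\<close>

lemma excess_push:
  assumes "v \<noteq> w" "v < n" "w < n"
  shows "excess n cap (push v w r z) a =
    excess n cap z a - (if a = v then r else 0) + (if a = w then r else 0)"
proof -
  have "(\<Sum>u<n. push v w r z a u) =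
    (\<Sum>u<n. z a u + (if u = w then (if a = v then - r else 0) else 0)
                  + (if u = v then (if a = w then r else 0) else 0))"
    by (rule sum.cong) (use assms in \<open>auto simp: push_def\<close>)
  also have "\<dots> = (\<Sum>u<n. z a u) + (if a = v then - r else 0) + (if a = w then r else 0)"
    using assms by (simp add: sum.distrib sum.delta)
  finally show ?thesis by (auto simp: excess_def)
qed

text \<open>Summing over all ordered pairs from \<open>U\<close> counts each pair in both orders, so
  the result depends only on \<open>z v w + z w v\<close>, which a preflow shares with
  \<open>z0\<close>.\<close>

lemma preflow_sum:
  assumes "preflow n cap z0 z d" "U \<subseteq> {..<n}"
  shows "(\<Sum>v\<in>U. \<Sum>w\<in>U. z v w) = (\<Sum>v\<in>U. \<Sum>w\<in>U. z0 v w)"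
proof -
  have sym: "2 * (\<Sum>v\<in>U. \<Sum>w\<in>U. f v w) = (\<Sum>v\<in>U. \<Sum>w\<in>U. f v w + f w v)" for
      f :: "nat \<Rightarrow> nat \<Rightarrow> real"
    using sum.swap[of "\<lambda>v w. f v w" U U] by (simp add: sum.distrib)
  have "(\<Sum>v\<in>U. \<Sum>w\<in>U. z v w + z w v) = (\<Sum>v\<in>U. \<Sum>w\<in>U. z0 v w + z0 w v)"
    by (intro sum.cong refl) (use assms in \<open>auto simp: preflow_def\<close>)
  then show ?thesis using sym[of z] sym[of z0] by simp
qed

text \<open>Weak duality: the weight of pairs inside \<open>U\<close> is received by vertices of
  \<open>U\<close>, so whatever exceeds their capacity shows up as positive excess.\<close>

lemma preflow_upper_bound:
  assumes pf: "preflow n cap z0 z d" and U: "U \<subseteq> {..<n}"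
  shows "(\<Sum>v\<in>U. \<Sum>w\<in>U. z0 v w) - (\<Sum>v\<in>U. cap v) \<le> (\<Sum>v<n. max 0 (excess n
      cap z v))"
proof -
  have fin: "finite U" using U finite_subset by blast
  have "(\<Sum>v\<in>U. \<Sum>w\<in>U. z0 v w) - (\<Sum>v\<in>U. cap v) = (\<Sum>v\<in>U. (\<Sum>w\<in>U. z
      v w) - cap v)"
    using preflow_sum[OF assms] by (simp add: sum_subtractf)
  also have "\<dots> \<le> (\<Sum>v\<in>U. max 0 (excess n cap z v))"
  proof (rule sum_mono)
    fix v assume v: "v \<in> U"
    have "(\<Sum>w\<in>U. z v w) \<le> (\<Sum>w<n. z v w)"
      by (rule sum_mono2) (use pf U v in \<open>auto simp: preflow_def\<close>)
    then show "(\<Sum>w\<in>U. z v w) - cap v \<le> max 0 (excess n cap z v)" by (simp add: excess_def)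
  qed
  also have "\<dots> \<le> (\<Sum>v<n. max 0 (excess n cap z v))"
    by (rule sum_mono2) (use U in auto)
  finally show ?thesis .
qed

text \<open>The vertices above an empty level \<open>g\<close> attain the bound of
  \<open>preflow_upper_bound\<close>. A positive share held above the gap with a partner below it
  would violate the height condition, since the heights differ by at least 2. So \<open>U\<close>
  holds only weight from inside \<open>U\<close>; its vertices have nonnegative excess because their
  height is positive, and below the gap no vertex is active.\<close>

lemma preflow_gap_exact:
  assumes pf: "preflow n cap z0 z d" and na: "no_active n cap z d"
    and g: "g < n" "\<And>v. v < n \<Longrightarrow> d v \<noteq> g" and U_def: "U = {v. v < n \<and> g < d v}"
  shows "(\<Sum>v\<in>U. \<Sum>w\<in>U. z0 v w) - (\<Sum>v\<in>U. cap v) = (\<Sum>v<n. max 0 (excess n cap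
      z v))"
proof -
  have U: "U \<subseteq> {..<n}" by (auto simp: U_def)
  have "(\<Sum>v<n. max 0 (excess n cap z v)) = (\<Sum>v\<in>U. max 0 (excess n cap z v))"
  proof (rule sum.mono_neutral_right)
    show "\<forall>v\<in>{..<n} - U. max 0 (excess n cap z v) = 0"
      using na g by (force simp: U_def no_active_def max_def)
  qed (use U in auto)
  also have "\<dots> = (\<Sum>v\<in>U. (\<Sum>w\<in>U. z v w) - cap v)"
  proof (rule sum.cong)
    fix v assume v: "v \<in> U"
    have "(\<Sum>w<n. z v w) = (\<Sum>w\<in>U. z v w)"
    proof (rule sum.mono_neutral_right)
      show "\<forall>w\<in>{..<n} - U. z v w = 0"
      proof
        fix w assume w: "w \<in> {..<n} - U"
        then have "d w < g" using g(2)[of w] by (force simp: U_def)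
        then have "\<not> d v \<le> Suc (d w)" using v by (auto simp: U_def)
        then show "z v w = 0" using pf v w U unfolding preflow_def by force
      qed
    qed (use U in auto)
    moreover have "0 \<le> excess n cap z v" using pf v by (auto simp: preflow_def U_def)
    ultimately show "max 0 (excess n cap z v) = (\<Sum>w\<in>U. z v w) - cap v"
      by (simp add: excess_def)
  qed simp
  also have "\<dots> = (\<Sum>v\<in>U. \<Sum>w\<in>U. z0 v w) - (\<Sum>v\<in>U. cap v)"
    using preflow_sum[OF pf U] by (simp add: sum_subtractf)
  finally show ?thesis by simp
qed

text \<open>Pigeonhole: when positive excess remains, some vertex has height \<open>n\<close>; if
  all levels below \<open>n\<close> were occupied too, \<open>n\<close> vertices would occupy
  \<open>n + 1\<close> levels.\<close>

lemma ex_gap: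
  assumes pf: "preflow n cap z0 z d" and na: "no_active n cap z d"
    and pos: "0 < (\<Sum>v<n. max 0 (excess n cap z v))"
  shows "\<exists>g<n. \<forall>v<n. d v \<noteq> g"
proof (rule ccontr)
  assume no: "\<not> ?thesis"
  obtain v where v: "v < n" "0 < excess n cap z v"
  proof -
    have "\<exists>v<n. 0 < excess n cap z v"
    proof (rule ccontr)
      assume "\<not> ?thesis"
      then have "(\<Sum>v<n. max 0 (excess n cap z v)) = 0" by (intro sum.neutral) auto
      with pos show False by simp
    qed
    then show ?thesis using that by blast
  qed
  then have "n \<le> d v" "d v \<le> n" using na pf by (auto simp: no_active_def preflow_def)
  then have "d v = n" by simp
  then have "{..n} \<subseteq> d ` {..<n}" using no v(1) by (force simp: le_less)
  then have "card {..n} \<le> card {..<n}" by (rule surj_card_le[rotated]) simp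
  then show False by simp
qed

section \<open>Progress made by one pass of discharges\<close>

text \<open>Invariant of pass \<open>k\<close>: unless \<open>k + 1\<close> relabellings have already occurred, only vertices
  still waiting for their turn, described by \<open>X\<close>, can be active.\<close>

definition wave :: "nat \<Rightarrow> (nat \<Rightarrow> real) \<Rightarrow> nat \<Rightarrow> (nat
    \<Rightarrow> nat \<Rightarrow> bool) \<Rightarrow>
    (nat \<Rightarrow> nat \<Rightarrow> real) \<Rightarrow> (nat \<Rightarrow> nat) \<Rightarrow> bool" where
  "wave n cap k X z d \<longleftrightarrow> no_active n cap z d \<or> k < (\<Sum>v<n. d v) \<or>
     (k \<le> (\<Sum>v<n. d v) \<and> (\<forall>u<n. 0 < excess n cap z u \<and> d u < n \<longrightarrow>
         X u (d u)))"

text \<open>Interface between a single discharge and the analysis of a pass. The clause about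
  vertices at least as high as \<open>v\<close> holds because pushes go strictly downhill.\<close>

definition discharged :: "nat \<Rightarrow> (nat \<Rightarrow> real) \<Rightarrow> nat \<Rightarrow> (nat
    \<Rightarrow> nat \<Rightarrow> real) \<Rightarrow> (nat \<Rightarrow> nat) \<Rightarrow>
    (nat \<Rightarrow> nat \<Rightarrow> real) \<Rightarrow> (nat \<Rightarrow> nat) \<Rightarrow> bool" where
  "discharged n cap v z d z' d' \<longleftrightarrow>
     (\<forall>u<n. u \<noteq> v \<longrightarrow> d' u = d u) \<and>
     (d' v = Suc (d v) \<or> d' v = d v \<and> excess n cap z' v \<le> 0) \<and>
     (\<forall>u<n. u \<noteq> v \<and> d v \<le> d u \<longrightarrow> excess n cap z' u = excess n cap z
         u) \<and>
     (excess n cap z v \<le> 0 \<longrightarrow> d' v = d v \<and> (\<forall>u<n. excess n cap z' u =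
         excess n cap z u))"

text \<open>If \<open>v\<close> keeps its height, it is no longer active, and whatever its pushes
  activated lies strictly below level \<open>h\<close>, hence still waits. If an active
  \<open>v\<close> is lifted, the sum of heights grows by one and the pass has made its
  progress.\<close>

lemma wave_discharged:
  assumes w: "wave n cap k (\<lambda>u l. l < h \<or> l = h \<and> v \<le> u) z d"
    and dis: "discharged n cap v z d z' d'" and v: "v < n" "d v = h" "h < n"
  shows "wave n cap k (\<lambda>u l. l < h \<or> l = h \<and> Suc v \<le> u) z' d'"
proof (cases "d' v = d v")
  case True
  then have d: "d' u = d u" if "u < n" for u using dis that by (auto simp: discharged_def)
  then have sum: "(\<Sum>v<n. d' v) = (\<Sum>v<n. d v)" by simp
  show ?thesis
  proof (cases "no_active n cap z d")
    case True
    then have "excess n cap z v \<le> 0" using v by (force simp: no_active_def)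
    then have "no_active n cap z' d'" using True dis d by (auto simp: no_active_def discharged_def)
    then show ?thesis by (simp add: wave_def)
  next
    case False
    have ev: "excess n cap z' v \<le> 0" using dis True by (auto simp: discharged_def)
    have "X' u"
      if "\<forall>u<n. 0 < excess n cap z u \<and> d u < n \<longrightarrow> d u < h \<or> d u = h \<and>
          v \<le> u"
        "u < n" "0 < excess n cap z' u" "d u < n" "X' = (\<lambda>u. d u < h \<or> d u = h \<and> Suc v
            \<le> u)" for u X'
    proof (cases "d v \<le> d u")
      case le: True
      have "u \<noteq> v" using ev that by auto
      then have "0 < excess n cap z u" using dis le that by (auto simp: discharged_def)
      then show ?thesis using that \<open>u \<noteq> v\<close> by force
    qed (use that v in auto)
    then show ?thesis using w False d sum by (auto simp: wave_def)
  qed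
next
  case False
  then have d: "d' v = Suc (d v)" and ne: "\<not> excess n cap z v \<le> 0"
    using dis by (auto simp: discharged_def)
  have "(\<Sum>u<n. d' u) = (\<Sum>u<n. d u + (if u = v then 1 else 0))"
    by (rule sum.cong) (use dis d in \<open>auto simp: discharged_def\<close>)
  then have sum: "(\<Sum>u<n. d' u) = Suc (\<Sum>u<n. d u)" using v by (simp add: sum.distrib)
  have "\<not> no_active n cap z d" using ne v by (force simp: no_active_def)
  then show ?thesis using w sum by (auto simp: wave_def)
qed

text \<open>Invariant of the loop over the possible targets of \<open>v\<close>, of which the first
  \<open>k\<close> have been examined; \<open>z1\<close> is the state before the discharge. Surplus
  can remain only if every lower target seen so far has received the full share.\<close>

definition pushing :: "nat \<Rightarrow> (nat \<Rightarrow> real) \<Rightarrow> (nat \<Rightarrow> nat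
    \<Rightarrow> real) \<Rightarrow> (nat \<Rightarrow> nat \<Rightarrow> real) \<Rightarrow>
    (nat \<Rightarrow> nat) \<Rightarrow> nat \<Rightarrow> nat \<Rightarrow> (nat \<Rightarrow> nat
        \<Rightarrow> real) \<Rightarrow> bool" where
  "pushing n cap z0 z1 d v k z \<longleftrightarrow> preflow n cap z0 z d \<and>
     (\<forall>u<n. u \<noteq> v \<and> d v \<le> d u \<longrightarrow> excess n cap z u = excess n cap z1
         u) \<and>
     (0 < excess n cap z v \<longrightarrow> (\<forall>w<k. d w < d v \<longrightarrow> z v w = 0)) \<and>
     (excess n cap z1 v \<le> 0 \<longrightarrow> (\<forall>u<n. excess n cap z u = excess n cap z1 u))"

lemma pushing_push:
  assumes p: "pushing n cap z0 z1 d v w z" and vw: "v < n" "w < n"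
    and ex: "0 < excess n cap z v" "d w < d v"
    and r: "r = min (excess n cap z v) (z v w)"
  shows "pushing n cap z0 z1 d v (Suc w) (push v w r z)"
proof -
  have ne: "v \<noteq> w" using ex by auto
  have pf: "preflow n cap z0 z d" using p by (simp add: pushing_def)
  have r0: "0 \<le> r" "r \<le> z v w" "r \<le> excess n cap z v" using ex(1) r pf vw by (auto simp:
      preflow_def)
  note e = excess_push[OF ne vw]
  have "preflow n cap z0 (push v w r z) d"
    unfolding preflow_def
  proof (intro conjI allI impI)
    fix a b assume ab: "a < n" "b < n"
    show "0 \<le> push v w r z a b" using pf ab r0 by (auto simp: push_def preflow_def)
    show "push v w r z a b + push v w r z b a = z0 a b + z0 b a"
      using pf ab ne by (auto simp: push_def preflow_def)
    assume "0 < push v w r z a b"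
    \<comment> \<open>The only share that can newly become positive is \<open>z w v\<close>, and
      \<open>w\<close> lies below \<open>v\<close>.\<close>
    then show "d a \<le> Suc (d b)" using pf ab r0 ex(2) by (auto simp: push_def preflow_def split: if_splits)
  next
    fix a assume a: "a < n"
    show "d a \<le> n" using pf a by (simp add: preflow_def)
    assume "0 < d a"
    then show "0 \<le> excess n cap (push v w r z) a" using pf a r0 by (auto simp: e preflow_def)
  qed
  moreover have "excess n cap (push v w r z) u = excess n cap z1 u"
    if "u < n" "u \<noteq> v" "d v \<le> d u" for u
    using that p ex(2) by (auto simp: e pushing_def)
  moreover have "push v w r z v x = 0"
    if "0 < excess n cap (push v w r z) v" "x < Suc w" "d x < d v" for x
  proof (cases "x = w")
    case True
    \<comment> \<open>Surplus left after the push means that the minimum defining \<open>r\<close>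
      was the share and not the excess.\<close>
    have "r = z v w" using that(1) ne r by (auto simp: e min_def)
    then show ?thesis using True by (simp add: push_def)
  next
    case False
    then show ?thesis using that p ex(1) ne by (auto simp: push_def pushing_def)
  qed
  moreover have "\<not> excess n cap z1 v \<le> 0" using p ex(1) vw by (auto simp: pushing_def)
  ultimately show ?thesis by (auto simp: pushing_def)
qed

lemma pushing_skip:
  assumes "pushing n cap z0 z1 d v w z" "\<not> (0 < excess n cap z v \<and> d w < d v)"
  shows "pushing n cap z0 z1 d v (Suc w) z"
  using assms by (auto simp: pushing_def less_Suc_eq)

lemma pushing_done:
  assumes p: "pushing n cap z0 z1 d v n z" and v: "v < n" and le: "excess n cap z v \<le> 0"
  shows "preflow n cap z0 z d" "discharged n cap v z1 d z d"
  using assms by (auto simp: pushing_def discharged_def)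

text \<open>With surplus left after all targets, \<open>v\<close> holds no positive share against a
  lower vertex; so lifting it by one puts it at most one level above its partners.\<close>

lemma pushing_relabel:
  assumes p: "pushing n cap z0 z1 d v n z" and v: "v < n" "d v < n" and pos: "0 < excess n cap z v"
    and d': "\<And>u. u < n \<Longrightarrow> d' u = (if u = v then Suc (d v) else d u)"
  shows "preflow n cap z0 z d'" "discharged n cap v z1 d z d'"
proof -
  have pf: "preflow n cap z0 z d" using p by (simp add: pushing_def)
  have "d v \<le> d w" if "0 < z v w" "w < n" for w
    using p pos that by (fastforce simp: pushing_def not_le[symmetric])
  then show "preflow n cap z0 z d'"
    using pf v pos by (auto simp: preflow_def d' intro: le_SucI)
  show "discharged n cap v z1 d z d'"
    using p pos v by (auto simp: pushing_def discharged_def d')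
qed

section \<open>Tight sets and greedy raising\<close>

locale capacitated_graph =
  fixes n m :: nat and tail head :: "nat \<Rightarrow> nat" and w :: "nat \<Rightarrow> real"
  assumes ends: "j < m \<Longrightarrow> tail j < n" "j < m \<Longrightarrow> head j < n" "j < m
      \<Longrightarrow> tail j \<noteq> head j"
    and w_nonneg: "j < m \<Longrightarrow> 0 \<le> w j"
begin

definition inside :: "nat set \<Rightarrow> nat set" where
  "inside U = {j. j < m \<and> tail j \<in> U \<and> head j \<in> U}"

text \<open>The forest polytope cut off by the upper bounds \<open>w\<close>.\<close>

definition independent :: "(nat \<Rightarrow> real) \<Rightarrow> bool" where
  "independent y \<longleftrightarrow> (\<forall>j<m. 0 \<le> y j \<and> y j \<le> w j) \<and>
     (\<forall>U. U \<subseteq> {..<n} \<and> U \<noteq> {} \<longrightarrow> sum y (inside U) \<le> real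
         (card U) - 1)"

definition tight :: "(nat \<Rightarrow> real) \<Rightarrow> nat set \<Rightarrow> bool" where
  "tight y U \<longleftrightarrow> U \<subseteq> {..<n} \<and> U \<noteq> {} \<and> sum y (inside U) = real
      (card U) - 1"

text \<open>Capacities for Hakimi's condition with root \<open>tail j\<close>: their total over
  \<open>U\<close> is the forest bound \<open>|U| - 1\<close> if the root lies in \<open>U\<close>,
  and the weaker \<open>|U|\<close> otherwise.\<close>

definition root_cap :: "nat \<Rightarrow> nat \<Rightarrow> real" where
  "root_cap j v = (if v = tail j then 0 else 1)"

text \<open>The initial split: every edge gives its whole value to its tail, and parallel edges with
  the same orientation are added up.\<close>

definition pair_weight :: "(nat \<Rightarrow> real) \<Rightarrow> nat \<Rightarrow> nat \<Rightarrow> real"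
    where
  "pair_weight y v u = (\<Sum>f<m. if tail f = v \<and> head f = u then y f else 0)"

lemma independentD:
  "independent y \<Longrightarrow> U \<subseteq> {..<n} \<Longrightarrow> U \<noteq> {} \<Longrightarrow>
      sum y (inside U) \<le> real (card U) - 1"
  by (simp add: independent_def)

lemma finite_inside [simp]: "finite (inside U)"
  by (simp add: inside_def)

lemma sum_pair_weight:
  assumes "finite U"
  shows "(\<Sum>v\<in>U. \<Sum>u\<in>U. pair_weight y v u) = sum y (inside U)"
proof -
  have "(\<Sum>v\<in>U. \<Sum>u\<in>U. pair_weight y v u) =
      (\<Sum>v\<in>U. \<Sum>f<m. \<Sum>u\<in>U. if tail f = v \<and> head f = u then y f else 0)"
    unfolding pair_weight_def by (intro sum.cong refl sum.swap)
  also have "\<dots> = (\<Sum>f<m. \<Sum>v\<in>U. \<Sum>u\<in>U. if tail f = v \<and> head f = u then y f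
      else 0)"
    by (rule sum.swap)
  also have "\<dots> = (\<Sum>f<m. if f \<in> inside U then y f else 0)"
  proof (rule sum.cong)
    fix f assume f: "f \<in> {..<m}"
    have "(\<Sum>v\<in>U. \<Sum>u\<in>U. if tail f = v \<and> head f = u then y f else 0) =
        (\<Sum>v\<in>U. if tail f = v then (if head f \<in> U then y f else 0) else 0)"
      by (intro sum.cong refl) (use assms in auto)
    then show "(\<Sum>v\<in>U. \<Sum>u\<in>U. if tail f = v \<and> head f = u then y f else 0) =
        (if f \<in> inside U then y f else 0)"
      using assms f by (auto simp: inside_def)
  qed simp
  also have "\<dots> = sum y ({..<m} \<inter> inside U)" by (simp add: sum.inter_restrict)
  also have "{..<m} \<inter> inside U = inside U" by (auto simp: inside_def)
  finally show ?thesis .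
qed

lemma sum_root_cap:
  assumes "finite U"
  shows "(\<Sum>v\<in>U. root_cap j v) = real (card U) - (if tail j \<in> U then 1 else 0)"
proof -
  have "(\<Sum>v\<in>U. root_cap j v) = (\<Sum>v\<in>U. 1 - (if tail j = v then 1 else 0))"
    by (rule sum.cong) (auto simp: root_cap_def)
  then show ?thesis using assms by (simp add: sum_subtractf)
qed

text \<open>Uncrossing: \<open>y(E(A)) + y(E(B))\<close> is at most
  \<open>y(E(A \<union> B)) + y(E(A \<inter> B))\<close>. The forest bounds of the union and of the
  nonempty intersection add up to \<open>|A| + |B| - 2\<close>, so both must be attained.\<close>

lemma tight_Un:
  assumes ind: "independent y" and t: "tight y A" "tight y B" and ne: "A \<inter> B \<noteq> {}"
  shows "tight y (A \<union> B)"
proof -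
  have fin: "finite A" "finite B" using t finite_subset unfolding tight_def by blast+
  have "inside A \<inter> inside B = inside (A \<inter> B)" by (auto simp: inside_def)
  then have "sum y (inside A) + sum y (inside B) =
      sum y (inside A \<union> inside B) + sum y (inside (A \<inter> B))"
    using sum.union_inter[OF finite_inside finite_inside, of y A B] by simp
  moreover have "sum y (inside A \<union> inside B) \<le> sum y (inside (A \<union> B))"
    by (rule sum_mono2) (use ind in \<open>auto simp: inside_def independent_def\<close>)
  moreover have "sum y (inside (A \<inter> B)) \<le> real (card (A \<inter> B)) - 1"
    and "sum y (inside (A \<union> B)) \<le> real (card (A \<union> B)) - 1"
    using t ne by (intro independentD[OF ind]; auto simp: tight_def)+
  moreover have "real (card A) + real (card B) = real (card (A \<union> B)) + real (card (A \<inter> B))"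
    using card_Un_Int[OF fin] by linarith
  ultimately show ?thesis using t by (auto simp: tight_def)
qed

lemma tight_UN:
  assumes ind: "independent y" and "finite I" and U: "tight y U"
    and B: "\<And>i. i \<in> I \<Longrightarrow> tight y (B i) \<and> U \<inter> B i \<noteq> {}"
  shows "tight y (U \<union> (\<Union>i\<in>I. B i))"
  using assms(2) B
proof (induction I rule: finite_induct)
  case empty
  then show ?case using U by simp
next
  case (insert i I)
  have "tight y ((U \<union> (\<Union>i\<in>I. B i)) \<union> B i)"
    by (rule tight_Un[OF ind]) (use insert in auto)
  then show ?case by (simp add: Un_ac)
qed

text \<open>A tight set already has the largest weight that independence allows, so a larger
  independent vector cannot add to it.\<close>

lemma tight_mono:
  assumes "tight y U" "independent y'" "\<And>j. j < m \<Longrightarrow> y j \<le> y' j"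
  shows "tight y' U"
proof -
  have "sum y (inside U) \<le> sum y' (inside U)"
    by (rule sum_mono) (use assms in \<open>auto simp: inside_def\<close>)
  then show ?thesis using assms(1) independentD[OF assms(2), of U] by (auto simp: tight_def)
qed

text \<open>If \<open>X\<close> split \<open>B\<close> into two nonempty parts with no weight
  across, the forest bounds of the parts would leave at most \<open>|B| - 2\<close> inside
  \<open>B\<close>.\<close>

lemma tight_subset:
  assumes ind: "independent y" and t: "tight y B" and meet: "B \<inter> X \<noteq> {}"
    and sep: "\<And>j. j < m \<Longrightarrow> 0 < y j \<Longrightarrow> tail j \<in> X
        \<longleftrightarrow> head j \<in> X"
  shows "B \<subseteq> X"
proof (rule ccontr)
  assume "\<not> B \<subseteq> X"
  then have ne: "B - X \<noteq> {}" by blast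
  have fin: "finite B" using t finite_subset unfolding tight_def by blast
  have "sum y (inside B) = sum y (inside (B \<inter> X) \<union> inside (B - X))"
  proof (rule sum.mono_neutral_right)
    show "\<forall>j\<in>inside B - (inside (B \<inter> X) \<union> inside (B - X)). y j = 0"
    proof
      fix j assume j: "j \<in> inside B - (inside (B \<inter> X) \<union> inside (B - X))"
      then have "\<not> 0 < y j" using sep[of j] by (auto simp: inside_def)
      then show "y j = 0" using ind j by (force simp: independent_def inside_def)
    qed
  qed (auto simp: inside_def)
  also have "\<dots> = sum y (inside (B \<inter> X)) + sum y (inside (B - X))"
    by (rule sum.union_disjoint) (auto simp: inside_def)
  also have "\<dots> \<le> (real (card (B \<inter> X)) - 1) + (real (card (B - X)) - 1)"
    using t meet ne by (intro add_mono independentD[OF ind]) (auto simp: tight_def)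
  also have "\<dots> = real (card B) - 2"
    using card_Int_Diff[OF fin, of X] by simp
  finally show False using t by (simp add: tight_def)
qed

section \<open>The largest admissible value of an edge\<close>

text \<open>Subtracting the largest violation \<open>\<kappa>\<close> among all vertex sets from the full capacity of \<open>j\<close>
  gives the largest admissible value; a set attaining it becomes tight.\<close>

lemma raise_edge:
  fixes \<kappa> :: real and y :: "nat \<Rightarrow> real" and j :: nat
  defines "y1 \<equiv> y(j := w j)" and "y2 \<equiv> y(j := w j - \<kappa>)"
  assumes ind: "independent y" and j: "j < m" and \<kappa>: "0 \<le> \<kappa>"
    and bound: "\<And>U. U \<subseteq> {..<n} \<Longrightarrow> sum y1 (inside U) - (\<Sum>v\<in>U.
        root_cap j v) \<le> \<kappa>"
    and exact: "0 < \<kappa> \<Longrightarrow> U0 \<subseteq> {..<n} \<and> sum y1 (inside U0) -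
        (\<Sum>v\<in>U0. root_cap j v) = \<kappa>"
  shows "independent y2" and "y j \<le> w j - \<kappa>"
    and "0 < \<kappa> \<Longrightarrow> tight y2 U0 \<and> tail j \<in> U0 \<and> head j \<in> U0"
proof -
  have y2: "sum y2 (inside U) = sum y1 (inside U) - (if j \<in> inside U then \<kappa> else 0)"
    and y1: "sum y1 (inside U) = sum y (inside U) + (if j \<in> inside U then w j - y j else 0)" for U
  proof -
    have "sum y2 (inside U) = (\<Sum>f\<in>inside U. y1 f - (if f = j then \<kappa> else 0))"
      by (rule sum.cong) (auto simp: y1_def y2_def)
    then show "sum y2 (inside U) = sum y1 (inside U) - (if j \<in> inside U then \<kappa> else 0)"
      by (simp add: sum_subtractf)
    have "sum y1 (inside U) = (\<Sum>f\<in>inside U. y f + (if f = j then w j - y j else 0))"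
      by (rule sum.cong) (auto simp: y1_def)
    then show "sum y1 (inside U) = sum y (inside U) + (if j \<in> inside U then w j - y j else 0)"
      by (simp add: sum.distrib)
  qed
  have U0: "U0 \<subseteq> {..<n} \<and> U0 \<noteq> {} \<and> j \<in> inside U0" if "0 < \<kappa>"
  proof -
    note ex = exact[OF that]
    have fin: "finite U0" using ex finite_subset by blast
    have ne: "U0 \<noteq> {}" using ex that by (auto simp: inside_def)
    have "sum y (inside U0) \<le> real (card U0) - 1" using independentD[OF ind] ex ne by blast
    \<comment> \<open>If \<open>j\<close> were not inside \<open>U0\<close>, the vectors
      \<open>y1\<close> and \<open>y\<close> would agree there, and the forest bound
      \<open>|U0| - 1\<close> is at most the capacity of \<open>U0\<close>, so there would be no
      violation.\<close>
    then have "j \<in> inside U0" using ex that y1[of U0] sum_root_cap[OF fin, of j] by (auto split: if_splits)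
    with ex ne show ?thesis by simp
  qed
  show t: "tight y2 U0 \<and> tail j \<in> U0 \<and> head j \<in> U0" if "0 < \<kappa>"
  proof -
    have fin: "finite U0" using U0[OF that] finite_subset by blast
    show ?thesis using U0[OF that] exact[OF that] y2[of U0] sum_root_cap[OF fin, of j]
      by (auto simp: tight_def inside_def)
  qed
  show le: "y j \<le> w j - \<kappa>"
  proof (cases "0 < \<kappa>")
    case True
    \<comment> \<open>\<open>y2\<close> fills \<open>U0\<close> up to the forest bound while
      \<open>y\<close> stays within it, and the two differ only in \<open>j\<close>.\<close>
    have "sum y (inside U0) \<le> real (card U0) - 1" using independentD[OF ind] U0[OF True] by blast
    then show ?thesis using t[OF True] y1[of U0] y2[of U0] U0[OF True] by (auto simp: tight_def)
  next
    case False
    then show ?thesis using \<kappa> ind j by (auto simp: independent_def)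
  qed
  show "independent y2"
    unfolding independent_def
  proof (intro conjI allI impI)
    fix f assume "f < m"
    then show "0 \<le> y2 f" "y2 f \<le> w f"
      using ind le \<kappa> by (force simp: y2_def independent_def)+
  next
    fix U assume U: "U \<subseteq> {..<n} \<and> U \<noteq> {}"
    then have fin: "finite U" using finite_subset by blast
    show "sum y2 (inside U) \<le> real (card U) - 1"
    proof (cases "j \<in> inside U")
      case True
      \<comment> \<open>The capacity of \<open>U\<close> is now \<open>|U| - 1\<close>, so the bound
        on violations is the forest inequality for \<open>y2\<close>.\<close>
      then have "tail j \<in> U" by (simp add: inside_def)
      then show ?thesis using True y2[of U] bound[of U] U sum_root_cap[OF fin, of j] by simp
    next
      case False
      then show ?thesis using y2[of U] y1[of U] independentD[OF ind, of U] U by simp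
    qed
  qed
qed

section \<open>Vertex classes and the output family\<close>

definition cls :: "(nat \<Rightarrow> nat) \<Rightarrow> nat \<Rightarrow> nat set" where
  "cls lab v = {u. u < n \<and> lab u = lab v}"

text \<open>The class that absorbs \<open>U\<close> is \<open>U\<close> together with all old
  classes meeting it, so it is tight by uncrossing; every other class is unchanged.\<close>

lemma tight_cls_merge:
  assumes ind: "independent y" and cls: "\<And>v. v < n \<Longrightarrow> tight y (cls lab v)"
    and U: "tight y U" and t: "t \<in> U"
    and lab': "\<And>u. u < n \<Longrightarrow> lab' u = (if \<exists>v\<in>U. lab v = lab u then lab t
        else lab u)"
    and v: "v < n"
  shows "tight y (cls lab' v)"
proof -
  have Un: "U \<subseteq> {..<n}" using U by (simp add: tight_def)
  then have fin: "finite U" using finite_subset by blast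
  show ?thesis
  proof (cases "\<exists>u\<in>U. lab u = lab v")
    case True
    have "cls lab' v = U \<union> (\<Union>u\<in>U. cls lab u)"
    proof (intro equalityI subsetI)
      fix a assume "a \<in> cls lab' v"
      then have a: "a < n" "lab' a = lab t" using True v by (auto simp: cls_def lab')
      then have "\<exists>u\<in>U. lab u = lab a" using t by (auto simp: lab' split: if_splits)
      then obtain u where "u \<in> U" "lab u = lab a" by blast
      then show "a \<in> U \<union> (\<Union>u\<in>U. cls lab u)" using a by (force simp: cls_def)
    next
      fix a assume "a \<in> U \<union> (\<Union>u\<in>U. cls lab u)"
      then have "a < n \<and> (\<exists>u\<in>U. lab u = lab a)" using Un by (force simp: cls_def)
      then show "a \<in> cls lab' v" using True v by (auto simp: cls_def lab')
    qed
    moreover have "tight y (U \<union> (\<Union>u\<in>U. cls lab u))"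
      by (rule tight_UN[OF ind fin U]) (use cls Un in \<open>auto simp: cls_def\<close>)
    ultimately show ?thesis by simp
  next
    case False
    \<comment> \<open>The merged class takes over the label of \<open>t\<close>, which lies in
      \<open>U\<close>; a class disjoint from \<open>U\<close> has another label and gains no
      vertices.\<close>
    then have "lab v \<noteq> lab t" using t by metis
    then have "cls lab' v = cls lab v" using False v by (auto simp: cls_def lab' split: if_splits)
    then show ?thesis using cls v by simp
  qed
qed

definition raised ::
  "nat \<Rightarrow> (nat \<Rightarrow> real) \<Rightarrow> (nat \<Rightarrow> nat) \<Rightarrow> (nat
      \<Rightarrow> real) \<Rightarrow> (nat \<Rightarrow> nat) \<Rightarrow> bool" where
  "raised j y lab y' lab' \<longleftrightarrow> (\<forall>f<m. f \<noteq> j \<longrightarrow> y' f = y f)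
      \<and> y j \<le> y' j \<and> independent y' \<and>
     (\<forall>v<n. tight y' (cls lab' v)) \<and> (\<forall>u<n. \<forall>v<n. lab u = lab v
         \<longrightarrow> lab' u = lab' v) \<and>
     (y' j = w j \<or> lab' (tail j) = lab' (head j))"

text \<open>\<open>F\<close> is the part of the new family found so far. That each member lies in a
  single current class survives coarsening, and it is what keeps the family laminar when the current
  classes are added.\<close>

definition family_inv :: "(nat \<Rightarrow> real) \<Rightarrow> (nat \<Rightarrow> nat) \<Rightarrow> nat
    set set \<Rightarrow> bool" where
  "family_inv y lab F \<longleftrightarrow> independent y \<and> (\<forall>v<n. tight y (cls lab v)) \<and>
     (\<forall>A\<in>F. tight y A \<and> (\<exists>v<n. A \<subseteq> cls lab v)) \<and> laminar F"

text \<open>The data that the cut estimate for \<open>X\<close> needs. The blocks are taken from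
  \<open>F\<close> instead of the current classes, because later merges may join classes across the
  boundary of \<open>X\<close>.\<close>

definition settled :: "(nat \<Rightarrow> real) \<Rightarrow> nat set set \<Rightarrow> nat set
    \<Rightarrow> bool" where
  "settled y F X \<longleftrightarrow> (\<exists>P\<subseteq>F. \<Union>P = X \<and> (\<forall>A\<in>P.
      \<forall>B\<in>P. A \<noteq> B \<longrightarrow> A \<inter> B = {}) \<and>
     (\<forall>j\<in>inside X. (\<exists>A\<in>P. j \<in> inside A) \<or> y j = w j))"

lemma raised_mono: "raised j y lab y' lab' \<Longrightarrow> f < m \<Longrightarrow> y f \<le> y' f"
  unfolding raised_def by (metis order_refl)

lemma family_inv_raised:
  assumes F: "family_inv y lab F" and r: "raised j y lab y' lab'"
  shows "family_inv y' lab' F"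
proof -
  have ind: "independent y'" using r unfolding raised_def by blast
  have "\<forall>u<n. \<forall>v<n. lab u = lab v \<longrightarrow> lab' u = lab' v" using r unfolding
      raised_def by blast
  then have "cls lab v \<subseteq> cls lab' v" if "v < n" for v
    using that unfolding cls_def by blast
  then have "\<exists>v<n. A \<subseteq> cls lab' v" if "A \<in> F" for A
    using F that unfolding family_inv_def by (meson order_trans)
  moreover have "tight y' A" if "A \<in> F" for A
    using F that tight_mono[OF _ ind raised_mono[OF r]] by (simp add: family_inv_def)
  moreover have "\<forall>v<n. tight y' (cls lab' v)" using r unfolding raised_def by blast
  ultimately show ?thesis using F ind by (simp add: family_inv_def)
qed

text \<open>The current classes are pairwise disjoint and each old member lies inside one of them,
  so a class is disjoint from or nested with every set of the enlarged family.\<close>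

lemma family_inv_add:
  assumes F: "family_inv y lab F"
  shows "family_inv y lab (F \<union> cls lab ` {..<n})"
proof -
  have cc: "A \<inter> cls lab v \<in> {{}, A, cls lab v}" if "u < n" "A \<subseteq> cls lab u" for A u v
    using that by (cases "lab u = lab v") (auto simp: cls_def)
  have "laminar (F \<union> cls lab ` {..<n})"
    unfolding laminar_def
  proof (intro ballI)
    fix A B assume A: "A \<in> F \<union> cls lab ` {..<n}" and B: "B \<in> F \<union> cls lab ` {..<n}"
    have sub: "\<exists>u<n. C \<subseteq> cls lab u" if "C \<in> F \<union> cls lab ` {..<n}" for C
      using F that by (auto simp: family_inv_def)
    consider "A \<in> F" "B \<in> F" | v where "B = cls lab v" | v where "A = cls lab v" using A B by auto
    then show "A \<inter> B \<in> {{}, A, B}"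
    proof cases
      case 1
      then show ?thesis using F by (simp add: family_inv_def laminar_def)
    next
      case 2
      then show ?thesis using cc sub[OF A] by blast
    next
      case 3
      then show ?thesis using cc sub[OF B] by blast
    qed
  qed
  then show ?thesis using F by (auto simp: family_inv_def)
qed

text \<open>A saturated edge cannot rise above \<open>w\<close>, so it stays saturated; the blocks
  do not change.\<close>

lemma settled_mono:
  assumes "settled y F X" "F \<subseteq> F'" "\<And>j. j < m \<Longrightarrow> y j \<le> y' j" "independent y'"
  shows "settled y' F' X"
proof -
  obtain P where P: "P \<subseteq> F" "\<Union>P = X" "\<forall>A\<in>P. \<forall>B\<in>P. A \<noteq> B
      \<longrightarrow> A \<inter> B = {}"
    "\<forall>j\<in>inside X. (\<exists>A\<in>P. j \<in> inside A) \<or> y j = w j" using assms(1)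
        unfolding settled_def by blast
  have "y' j = w j" if "j \<in> inside X" "y j = w j" for j
    using assms(3)[of j] assms(4) that by (force simp: inside_def independent_def)
  with P show ?thesis unfolding settled_def using assms(2)
    by (intro exI[of _ P]) blast
qed

text \<open>No weight crosses the boundary of \<open>X\<close>, so by \<open>tight_subset\<close> a
  class that meets \<open>X\<close> lies in it; these classes are the blocks.\<close>

lemma settled_classes:
  assumes F: "family_inv y lab F" and X: "X \<subseteq> {..<n}"
    and sep: "\<And>j. j < m \<Longrightarrow> 0 < y j \<Longrightarrow> tail j \<in> X
        \<longleftrightarrow> head j \<in> X"
    and sat: "\<And>j. j \<in> inside X \<Longrightarrow> y j = w j \<or> lab (tail j) = lab (head j)"
  shows "settled y (F \<union> cls lab ` {..<n}) X"
proof -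
  have sub: "cls lab v \<subseteq> X" if "v \<in> X" for v
    using F X that sep by (intro tight_subset[of y]) (auto simp: family_inv_def cls_def)
  have "\<Union>(cls lab ` X) = X" using sub X by (auto simp: cls_def)
  moreover have "(\<exists>A\<in>cls lab ` X. j \<in> inside A) \<or> y j = w j" if "j \<in> inside X" for j
    using sat[OF that] that X by (auto simp: inside_def cls_def)
  ultimately show ?thesis unfolding settled_def
    by (intro exI[of _ "cls lab ` X"]) (use X in \<open>auto simp: cls_def\<close>)
qed

end

section \<open>Partitions into tight sets\<close>

lemma ends_Int_card:
  assumes G: "undirected_graph G" and e: "e \<in> edges G"
  shows "real (card (ends G e \<inter> A)) =
    (if e \<in> cut_edges G A then 1 else 0) + 2 * (if e \<in> inner_edges G A then 1 else 0)"
proof -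
  have c: "card (ends G e) = 2" using G e by (simp add: undirected_graph_def)
  then have fin: "finite (ends G e)" by (metis card.infinite zero_neq_numeral)
  have le: "card (ends G e \<inter> A) \<le> 2" using c fin by (metis card_mono inf_le1)
  have "card (ends G e \<inter> A) = 2 \<longleftrightarrow> ends G e \<subseteq> A"
    using c fin by (metis card_subset_eq inf.absorb_iff1 inf_le1)
  moreover have "card (ends G e \<inter> A) = 0 \<or> card (ends G e \<inter> A) = 1 \<or> card (ends G e
      \<inter> A) = 2"
    using le by linarith
  ultimately show ?thesis using e by (auto simp: cut_edges_def inner_edges_def)
qed

text \<open>Handshake identity: a cut edge has one end in \<open>A\<close>, an inner edge
  two.\<close>

lemma weighted_degree:
  fixes x :: "'e \<Rightarrow> real"
  assumes G: "undirected_graph G"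
  shows "(\<Sum>e\<in>edges G. x e * real (card (ends G e \<inter> A))) =
    sum x (cut_edges G A) + 2 * sum x (inner_edges G A)"
proof -
  have fin: "finite (edges G)" using G by (simp add: undirected_graph_def)
  have "(\<Sum>e\<in>edges G. x e * real (card (ends G e \<inter> A))) =
    (\<Sum>e\<in>edges G. (if e \<in> cut_edges G A then x e else 0) + 2 * (if e \<in> inner_edges G A then
        x e else 0))"
    by (rule sum.cong) (auto simp: ends_Int_card[OF G])
  also have "\<dots> = sum x (edges G \<inter> cut_edges G A) + 2 * sum x (edges G \<inter> inner_edges G A)"
    using fin by (simp add: sum.distrib sum_distrib_left[symmetric] sum.inter_restrict)
  also have "edges G \<inter> cut_edges G A = cut_edges G A" by (auto simp: cut_edges_def)
  also have "edges G \<inter> inner_edges G A = inner_edges G A" by (auto simp: inner_edges_def)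
  finally show ?thesis .
qed

lemma finite_cut_inner [simp]:
  "undirected_graph G \<Longrightarrow> finite (cut_edges G A)" "undirected_graph G \<Longrightarrow>
      finite (inner_edges G A)"
  by (auto simp: undirected_graph_def cut_edges_def inner_edges_def)

lemma ends_nonempty: "undirected_graph G \<Longrightarrow> e \<in> edges G \<Longrightarrow> ends G e
    \<noteq> {}"
  by (force simp: undirected_graph_def)

lemma inner_verts: "undirected_graph G \<Longrightarrow> inner_edges G (verts G) = edges G"
  by (auto simp: undirected_graph_def inner_edges_def)

text \<open>Of the total \<open>|V| - 1\<close>, at most \<open>|A| - 1\<close> lies inside
  \<open>A\<close> and at most \<open>|V - A| - 1\<close> inside the complement, which leaves at
  least 1 for the cut.\<close>

lemma polytope_cut_ge_1:
  assumes G: "undirected_graph G" and x: "x \<in> spanning_tree_polytope G"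
    and A: "A \<subseteq> verts G" "A \<noteq> {}" "A \<noteq> verts G"
  shows "1 \<le> sum x (cut_edges G A)"
proof -
  let ?B = "verts G - A"
  have fin: "finite (verts G)" "finite (edges G)" using G by (auto simp: undirected_graph_def)
  have fA: "finite A" using A fin finite_subset by blast
  have "edges G = cut_edges G A \<union> (inner_edges G A \<union> inner_edges G ?B)"
  proof (intro equalityI subsetI)
    fix e assume e: "e \<in> edges G"
    then have sub: "ends G e \<subseteq> verts G" "finite (ends G e)"
      using G fin(1) finite_subset by (auto simp: undirected_graph_def)
    show "e \<in> cut_edges G A \<union> (inner_edges G A \<union> inner_edges G ?B)"
    proof (rule ccontr)
      assume no: "\<not> ?thesis"
      then have "real (card (ends G e \<inter> A)) = 0" using ends_Int_card[OF G e, of A] by simp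
      then have "ends G e \<inter> A = {}" using sub by simp
      then show False using no sub e by (auto simp: inner_edges_def)
    qed
  qed (auto simp: cut_edges_def inner_edges_def)
  then have "sum x (edges G) = sum x (cut_edges G A \<union> (inner_edges G A \<union> inner_edges G ?B))"
      by simp
  also have "\<dots> = sum x (cut_edges G A) + (sum x (inner_edges G A) + sum x (inner_edges G ?B))"
  proof -
    have "cut_edges G A \<inter> (inner_edges G A \<union> inner_edges G ?B) = {}"
    proof (rule ccontr)
      assume "\<not> ?thesis"
      then obtain e where e: "e \<in> edges G" "card (ends G e \<inter> A) = 1" "ends G e \<subseteq> A
          \<or> ends G e \<subseteq> ?B"
        by (auto simp: cut_edges_def inner_edges_def)
      then have "ends G e \<inter> A = ends G e \<or> ends G e \<inter> A = {}" by blast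
      then show False using e G by (auto simp: undirected_graph_def)
    qed
    moreover have "inner_edges G A \<inter> inner_edges G ?B = {}"
      using ends_nonempty[OF G] by (fastforce simp: inner_edges_def)
    ultimately show ?thesis using G by (simp add: sum.union_disjoint)
  qed
  finally have eq: "sum x (edges G) = \<dots>" .
  have ub: "sum x (inner_edges G A) \<le> real (card A) - 1" "sum x (inner_edges G ?B) \<le> real (card ?B) - 1"
    "sum x (edges G) = real (card (verts G)) - 1"
    using x A by (auto simp: spanning_tree_polytope_def)
  have "card ?B = card (verts G) - card A" "card A \<le> card (verts G)"
    using fA A fin(1) by (auto simp: card_Diff_subset card_mono)
  then show ?thesis using eq ub by (simp add: of_nat_diff)
qed

section \<open>Estimates over a partition of a set into tight blocks\<close>

locale tight_partition =
  fixes G :: "('v, 'e) ugraph" and S :: "'v set" and P :: "'v set set"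
    and x y :: "'e \<Rightarrow> real" and \<eta> :: real
  assumes G: "undirected_graph G" and x: "x \<in> spanning_tree_polytope G" and \<eta>: "2 < \<eta>"
    and S: "S \<subseteq> verts G" and P: "\<Union>P = S" "\<And>A. A \<in> P \<Longrightarrow> A \<noteq> {}"
    and disj: "\<And>A B. A \<in> P \<Longrightarrow> B \<in> P \<Longrightarrow> A \<noteq> B
        \<Longrightarrow> A \<inter> B = {}"
    and tight: "\<And>A. A \<in> P \<Longrightarrow> sum y (inner_edges G A) = real (card A) - 1"
    and y_S: "S \<noteq> {} \<Longrightarrow> sum y (inner_edges G S) \<le> real (card S) - 1"
    and dom: "\<And>e. e \<in> edges G \<Longrightarrow> y e \<le> \<eta> * x e"
    and sat: "\<And>e. e \<in> inner_edges G S \<Longrightarrow> (\<exists>A\<in>P. e \<in> inner_edges G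
        A) \<or> y e = \<eta> * x e"
begin

text \<open>The edges that run between different blocks; by \<open>sat\<close> all of them are
  saturated.\<close>

definition D where "D = inner_edges G S - (\<Union>A\<in>P. inner_edges G A)"

lemma finite_S: "finite S"
  using G S finite_subset by (auto simp: undirected_graph_def)

lemma finite_P: "finite P"
  by (rule finite_UnionD) (simp add: P(1) finite_S)

lemma finite_block: "A \<in> P \<Longrightarrow> finite A"
  using P(1) finite_S by (metis Union_upper finite_subset)

lemma card_S: "card S = (\<Sum>A\<in>P. card A)"
  unfolding P(1)[symmetric]
  by (rule card_Union_disjoint) (use disj finite_block in \<open>auto simp: pairwise_def disjnt_def\<close>)

lemma sum_inner_S:
  fixes f :: "'e \<Rightarrow> real"
  shows "sum f (inner_edges G S) = (\<Sum>A\<in>P. sum f (inner_edges G A)) + sum f D"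
proof -
  have sub: "(\<Union>A\<in>P. inner_edges G A) \<subseteq> inner_edges G S" using P(1) by (auto simp:
      inner_edges_def)
  have "sum f (inner_edges G S) = sum f (\<Union>A\<in>P. inner_edges G A) + sum f D"
    unfolding D_def using sum.subset_diff[OF sub, of f] G by (simp add: add.commute)
  also have "sum f (\<Union>A\<in>P. inner_edges G A) = (\<Sum>A\<in>P. sum f (inner_edges G A))"
  proof (rule sum.UNION_disjoint)
    show "\<forall>A\<in>P. \<forall>B\<in>P. A \<noteq> B \<longrightarrow> inner_edges G A \<inter>
        inner_edges G B = {}"
    proof (intro ballI impI)
      fix A B assume "A \<in> P" "B \<in> P" "A \<noteq> B"
      then show "inner_edges G A \<inter> inner_edges G B = {}"
        using disj[of A B] ends_nonempty[OF G] by (fastforce simp: inner_edges_def)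
    qed
  qed (use finite_P G in auto)
  finally show ?thesis .
qed

lemma sum_tight: "(\<Sum>A\<in>P. sum y (inner_edges G A)) = real (card S) - real (card P)"
  by (simp add: tight card_S sum_subtractf)

lemma sum_D: "sum y D = \<eta> * sum x D"
  unfolding sum_distrib_left by (rule sum.cong) (use sat in \<open>auto simp: D_def\<close>)

text \<open>The tight blocks use up \<open>|S| - |P|\<close> of the at most \<open>|S| - 1\<close>
  units of \<open>y\<close> inside \<open>S\<close>. The edges of \<open>D\<close> share what is
  left, and there \<open>y\<close> is \<eta> times \<open>x\<close>.\<close>

lemma sum_x_D: "S \<noteq> {} \<Longrightarrow> \<eta> * sum x D \<le> real (card P) - 1"
  using sum_inner_S[of y] y_S sum_tight sum_D by simp

text \<open>The ends in \<open>S\<close> are counted block by block: an edge of \<open>D\<close> is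
  cut by two blocks, an edge leaving \<open>S\<close> by one.\<close>

lemma sum_cut_blocks: "(\<Sum>A\<in>P. sum x (cut_edges G A)) = sum x (cut_edges G S) + 2 * sum x D"
proof -
  have "card (ends G e \<inter> S) = (\<Sum>A\<in>P. card (ends G e \<inter> A))" for e
  proof -
    have "ends G e \<inter> S = (\<Union>A\<in>P. ends G e \<inter> A)" using P(1) by blast
    moreover have "card (\<Union>A\<in>P. ends G e \<inter> A) = (\<Sum>A\<in>P. card (ends G e \<inter> A))"
    proof (rule card_UN_disjoint)
      show "\<forall>A\<in>P. \<forall>B\<in>P. A \<noteq> B \<longrightarrow> ends G e \<inter> A \<inter>
          (ends G e \<inter> B) = {}"
        using disj by blast
    qed (use finite_P finite_block in auto)
    ultimately show ?thesis by simp
  qed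
  then have "(\<Sum>e\<in>edges G. x e * real (card (ends G e \<inter> S))) =
      (\<Sum>A\<in>P. \<Sum>e\<in>edges G. x e * real (card (ends G e \<inter> A)))"
    by (subst sum.swap) (simp add: sum_distrib_left)
  then have "sum x (cut_edges G S) + 2 * sum x (inner_edges G S) =
      (\<Sum>A\<in>P. sum x (cut_edges G A)) + 2 * (\<Sum>A\<in>P. sum x (inner_edges G A))"
    by (simp add: weighted_degree[OF G] sum.distrib sum_distrib_left)
  then show ?thesis using sum_inner_S[of x] by simp
qed

text \<open>The blocks hold at most \<open>|S| - |P|\<close> of the \<open>x\<close>-weight
  \<open>|S| - 1\<close>, so \<open>D\<close> has \<open>x\<close>-weight at least
  \<open>|P| - 1\<close>. On \<open>D\<close> the vector \<open>y\<close> totals \<eta> times as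
  much, which together with the tight blocks reaches the maximum \<open>|S| - 1\<close>.\<close>

lemma tight_verts:
  assumes "S = verts G" "S \<noteq> {}"
  shows "sum y (edges G) = real (card (verts G)) - 1"
proof -
  have "sum x (inner_edges G A) \<le> real (card A) - 1" if "A \<in> P" for A
  proof -
    have "A \<subseteq> verts G" using that P(1) S by blast
    then show ?thesis using x P(2)[OF that] by (simp add: spanning_tree_polytope_def)
  qed
  then have "(\<Sum>A\<in>P. sum x (inner_edges G A)) \<le> (\<Sum>A\<in>P. real (card A) - 1)" by (rule
      sum_mono)
  also have "\<dots> = real (card S) - real (card P)" by (simp add: card_S sum_subtractf)
  finally have "(\<Sum>A\<in>P. sum x (inner_edges G A)) \<le> real (card S) - real (card P)" .
  moreover have "sum x (inner_edges G S) = real (card S) - 1"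
    using x assms inner_verts[OF G] by (simp add: spanning_tree_polytope_def)
  ultimately have xD: "real (card P) - 1 \<le> sum x D" using sum_inner_S[of x] by simp
  have "P \<noteq> {}" using assms P(1) by auto
  then have "1 \<le> card P" using finite_P by (simp add: Suc_le_eq card_gt_0_iff)
  then have "0 \<le> sum x D" using xD by simp
  then have "1 * sum x D \<le> \<eta> * sum x D" using \<eta> by (intro mult_right_mono) auto
  then have "real (card S) - 1 \<le> sum y (inner_edges G S)"
    using xD sum_inner_S[of y] sum_tight sum_D by simp
  then show ?thesis using y_S assms inner_verts[OF G] by simp
qed

text \<open>Write \<open>c = x(\<delta>(S))\<close> and \<open>p = |P|\<close>. Summing the
  hypothesis over the blocks yields the bound
  \<open>\<eta> \<alpha> (c + 2 x(D)) + \<beta> p\<close>, and both \<open>c + 2 x(D)\<close> and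
  \<open>p\<close> are at most \<open>c / (1 - 2 / \<eta>)\<close>.\<close>

lemma thin_cut:
  assumes ne: "S \<noteq> verts G" and T: "T \<subseteq> edges G" and nonneg: "0 \<le> \<alpha>" "0 \<le>
      \<beta>"
    and thin: "\<And>A. A \<in> P \<Longrightarrow> real (card (T \<inter> cut_edges G A)) \<le> \<alpha> *
        sum y (cut_edges G A) + \<beta>"
  shows "real (card (T \<inter> cut_edges G S)) \<le> 1 / (1 - 2 / \<eta>) * (\<eta> * \<alpha> + \<beta>)
      * sum x (cut_edges G S)"
proof (cases "S = {}")
  case True
  then show ?thesis by (simp add: cut_edges_def)
next
  case False
  let ?p = "real (card P)" and ?c = "sum x (cut_edges G S)"
  \<comment> \<open>An edge leaving \<open>S\<close> also leaves the block that contains its end in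
    \<open>S\<close>.\<close>
  have "T \<inter> cut_edges G S \<subseteq> (\<Union>A\<in>P. T \<inter> cut_edges G A)"
  proof
    fix e assume e: "e \<in> T \<inter> cut_edges G S"
    then obtain v where v: "ends G e \<inter> S = {v}" by (auto simp: cut_edges_def card_1_singleton_iff)
    then obtain A where A: "A \<in> P" "v \<in> A" using P(1) by blast
    then have "ends G e \<inter> A = {v}" using v P(1) by blast
    then have "card (ends G e \<inter> A) = 1" by simp
    then have "e \<in> T \<inter> cut_edges G A" using e by (simp add: cut_edges_def)
    then show "e \<in> (\<Union>A\<in>P. T \<inter> cut_edges G A)" using A(1) by blast
  qed
  then have "card (T \<inter> cut_edges G S) \<le> card (\<Union>A\<in>P. T \<inter> cut_edges G A)"
    using finite_P G by (intro card_mono) auto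
  also have "\<dots> \<le> (\<Sum>A\<in>P. card (T \<inter> cut_edges G A))" by (rule card_UN_le[OF finite_P])
  finally have "real (card (T \<inter> cut_edges G S)) \<le> (\<Sum>A\<in>P. real (card (T \<inter>
      cut_edges G A)))"
    by (metis of_nat_le_iff of_nat_sum)
  also have "\<dots> \<le> (\<Sum>A\<in>P. \<alpha> * (\<eta> * sum x (cut_edges G A)) + \<beta>)"
  proof (rule sum_mono)
    fix A assume A: "A \<in> P"
    have "sum y (cut_edges G A) \<le> \<eta> * sum x (cut_edges G A)"
      unfolding sum_distrib_left by (rule sum_mono) (simp add: dom cut_edges_def)
    then have "\<alpha> * sum y (cut_edges G A) \<le> \<alpha> * (\<eta> * sum x (cut_edges G A))"
      using nonneg(1) by (rule mult_left_mono)
    then show "real (card (T \<inter> cut_edges G A)) \<le> \<alpha> * (\<eta> * sum x (cut_edges G A)) +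
        \<beta>"
      using thin[OF A] by simp
  qed
  also have "\<dots> = \<eta> * \<alpha> * (?c + 2 * sum x D) + \<beta> * ?p"
    by (simp add: sum.distrib sum_distrib_left[symmetric] sum_cut_blocks)
  finally have 1: "real (card (T \<inter> cut_edges G S)) \<le> \<eta> * \<alpha> * (?c + 2 * sum x D) +
      \<beta> * ?p" .
  have xD: "sum x D \<le> (?p - 1) / \<eta>" using sum_x_D[OF False] \<eta> by (simp add: field_simps)
  \<comment> \<open>Since \<open>S\<close> is not the whole vertex set, every block is a nonempty
    proper subset, and its cut has \<open>x\<close>-weight at least 1.\<close>
  have "(\<Sum>A\<in>P. 1) \<le> (\<Sum>A\<in>P. sum x (cut_edges G A))"
  proof (rule sum_mono)
    fix A assume A: "A \<in> P"
    then have "A \<subseteq> S" using P(1) by blast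
    then show "1 \<le> sum x (cut_edges G A)"
      using polytope_cut_ge_1[OF G x] P(2)[OF A] S ne by blast
  qed
  then have p: "?p \<le> ?c + 2 * sum x D" by (simp add: sum_cut_blocks)
  define q where "q = 1 - 2 / \<eta>"
  have q: "0 < q" using \<eta> by (simp add: q_def)
  \<comment> \<open>Feeding \<open>x(D) \<le> p / \<eta>\<close> back into the bound on
    \<open>p\<close> gives \<open>p (1 - 2 / \<eta>) \<le> c\<close>; the factor is positive because
    \<eta> exceeds 2.\<close>
  have "sum x D \<le> ?p / \<eta>" using xD \<eta> by (simp add: field_simps)
  then have "?p \<le> ?c + 2 * (?p / \<eta>)" using p by linarith
  then have "?p * q \<le> ?c" by (simp add: q_def algebra_simps)
  then have pq: "?p \<le> ?c / q" using q by (simp add: field_simps)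
  have "2 * sum x D \<le> 2 / \<eta> * ?p" using xD \<eta> by (simp add: field_simps)
  also have "\<dots> \<le> 2 / \<eta> * (?c / q)" using pq \<eta> by (intro mult_left_mono) auto
  also have "\<dots> = (1 - q) * (?c / q)" by (simp add: q_def)
  also have "\<dots> = ?c / q - ?c" using q by (simp add: field_simps)
  finally have "?c + 2 * sum x D \<le> ?c / q" by simp
  then have "\<eta> * \<alpha> * (?c + 2 * sum x D) + \<beta> * ?p \<le> \<eta> * \<alpha> * (?c / q) +
      \<beta> * (?c / q)"
    using pq nonneg \<eta> by (intro add_mono mult_left_mono) auto
  also have "\<dots> = 1 / q * (\<eta> * \<alpha> + \<beta>) * ?c" by (simp add: add_divide_distrib
      algebra_simps)
  finally show ?thesis using 1 by (simp add: q_def)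
qed

end

section \<open>Raising one edge\<close>

declare sem.simps(6) [simp del]

abbreviation Var :: "string \<Rightarrow> nexp" where "Var a \<equiv> NRead a []"
abbreviation RVar :: "string \<Rightarrow> rexp" where "RVar a \<equiv> RRead a []"
abbreviation RConst :: "nat \<Rightarrow> rexp" where "RConst c \<equiv> RNat (NConst c)"
abbreviation When :: "bexp \<Rightarrow> loop_com \<Rightarrow> loop_com" where "When b C \<equiv> IfElse b
    C Skip"

text \<open>The language compares naturals only by \<open><\<close>, so equality is expressed by two
  failed comparisons.\<close>

definition NEq :: "nexp \<Rightarrow> nexp \<Rightarrow> bexp" where
  "NEq e f = Conj (Neg (NLess e f)) (Neg (NLess f e))"

lemma bval_NEq [simp]: "bval inp N R (NEq e f) \<longleftrightarrow> nval N e = nval N f"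
  by (auto simp: NEq_def)

text \<open>The sum starts at minus the capacity of \<open>v\<close>; constants are natural numbers,
  so -1 is written as a difference.\<close>

definition excess_prog :: loop_com where
  "excess_prog =
     IfElse (NEq (Var ''v'') (NRead ''tail'' [Var ''j'']))
       (AssignR ''ex'' [] (RConst 0)) (AssignR ''ex'' [] (RSub (RConst 0) (RConst 1))) ;;
     For ''u'' ''n'' 0
       (AssignR ''ex'' [] (RAdd (RVar ''ex'') (RRead ''z'' [Var ''v'', Var ''u''])))"

text \<open>The cell \<open>ex\<close> is updated along with the pushes, so the excess is summed up
  only once per call. At most one lift takes place, and only if surplus is left after the last
  target.\<close>

definition discharge_prog :: loop_com where
  "discharge_prog =
     excess_prog ;;
     For ''u'' ''n'' 0
       (When (Conj (RLess (RConst 0) (RVar ''ex'')) (NLess (NRead ''d'' [Var ''u'']) (NRead ''d'' [Var ''v''])))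
         (IfElse (RLess (RVar ''ex'') (RRead ''z'' [Var ''v'', Var ''u'']))
            (AssignR ''r'' [] (RVar ''ex'')) (AssignR ''r'' [] (RRead ''z'' [Var ''v'', Var ''u''])) ;;
          AssignR ''z'' [Var ''v'', Var ''u''] (RSub (RRead ''z'' [Var ''v'', Var ''u'']) (RVar ''r'')) ;;
          AssignR ''z'' [Var ''u'', Var ''v''] (RAdd (RRead ''z'' [Var ''u'', Var ''v'']) (RVar ''r'')) ;;
          AssignR ''ex'' [] (RSub (RVar ''ex'') (RVar ''r'')))) ;;
     When (RLess (RConst 0) (RVar ''ex''))
       (AssignN ''d'' [Var ''v''] (NAdd (NRead ''d'' [Var ''v'']) (NConst 1)))"

text \<open>The test picks the vertices of height \<open>n - 1 - l\<close>, so that levels are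
  treated from the top down while \<open>l\<close> counts up.\<close>

definition level_prog :: loop_com where
  "level_prog =
     For ''v'' ''n'' 0
       (When (NEq (NAdd (NRead ''d'' [Var ''v'']) (NAdd (Var ''l'') (NConst 1))) (Var ''n''))
         discharge_prog)"

text \<open>The loops over \<open>p\<close> and \<open>q\<close> make
  \<open>(n + 1) * (n + 1)\<close> passes. Each pass leaves no active vertex or raises the
  guaranteed sum of heights by one, and this sum never exceeds \<open>n * n\<close>.\<close>

definition flow_prog :: loop_com where
  "flow_prog = For ''p'' ''n'' 1 (For ''q'' ''n'' 1 (For ''l'' ''n'' 0 level_prog))"

definition init_prog :: loop_com where
  "init_prog =
     AssignR ''out_x'' [Var ''j''] (RScale ''eta'' [] (RInput ''x'' [Var ''j''])) ;;
     For ''v'' ''n'' 0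
       (AssignN ''d'' [Var ''v''] (NConst 0) ;;
        For ''u'' ''n'' 0 (AssignR ''z'' [Var ''v'', Var ''u''] (RConst 0))) ;;
     For ''f'' ''m'' 0
       (AssignR ''z'' [NRead ''tail'' [Var ''f''], NRead ''head'' [Var ''f'']]
         (RAdd (RRead ''z'' [NRead ''tail'' [Var ''f''], NRead ''head'' [Var ''f'']])
               (RRead ''out_x'' [Var ''f''])))"

definition total_prog :: loop_com where
  "total_prog =
     AssignR ''kappa'' [] (RConst 0) ;;
     For ''v'' ''n'' 0
       (excess_prog ;;
        When (RLess (RConst 0) (RVar ''ex'')) (AssignR ''kappa'' [] (RAdd (RVar ''kappa'') (RVar ''ex''))))"

text \<open>Level \<open>l\<close> is a gap if the flag \<open>c\<close> is still 0 after all
  vertices have been inspected. Later gaps overwrite earlier ones; any gap will do.\<close>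

definition gap_prog :: loop_com where
  "gap_prog =
     For ''l'' ''n'' 0
       (AssignN ''c'' [] (NConst 0) ;;
        For ''v'' ''n'' 0
          (When (NEq (NRead ''d'' [Var ''v'']) (Var ''l'')) (AssignN ''c'' [] (NConst 1))) ;;
        When (NLess (Var ''c'') (NConst 1)) (AssignN ''g'' [] (Var ''l'')))"

text \<open>The tight set consists of the vertices above the gap \<open>g\<close>. The old label of
  \<open>v\<close> is saved in \<open>o\<close> because the inner loop overwrites it on reaching
  \<open>v\<close> itself.\<close>

definition merge_prog :: loop_com where
  "merge_prog =
     AssignN ''c'' [] (NRead ''lab'' [NRead ''tail'' [Var ''j'']]) ;;
     For ''v'' ''n'' 0
       (When (NLess (Var ''g'') (NRead ''d'' [Var ''v'']))
         (AssignN ''o'' [] (NRead ''lab'' [Var ''v'']) ;;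
          For ''u'' ''n'' 0
            (When (NEq (NRead ''lab'' [Var ''u'']) (Var ''o''))
              (AssignN ''lab'' [Var ''u''] (Var ''c'')))))"

definition raise_prog :: loop_com where
  "raise_prog =
     init_prog ;; flow_prog ;; total_prog ;;
     When (RLess (RConst 0) (RVar ''kappa''))
       (AssignR ''out_x'' [Var ''j''] (RSub (RRead ''out_x'' [Var ''j'']) (RVar ''kappa'')) ;;
        gap_prog ;; merge_prog)"

lemma writes_excess_prog: "nat_writes excess_prog = {''u''}" "real_writes excess_prog = {''ex''}"
  by (auto simp: excess_prog_def)

lemma writes_discharge_prog:
  "nat_writes discharge_prog = {''u'', ''d''}" "real_writes discharge_prog = {''ex'', ''r'', ''z''}"
  by (auto simp: discharge_prog_def writes_excess_prog)

lemma writes_level_prog: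
  "nat_writes level_prog = {''v'', ''u'', ''d''}" "real_writes level_prog = {''ex'', ''r'', ''z''}"
  by (auto simp: level_prog_def writes_discharge_prog)

lemma writes_flow_prog:
  "nat_writes flow_prog = {''p'', ''q'', ''l'', ''v'', ''u'', ''d''}"
  "real_writes flow_prog = {''ex'', ''r'', ''z''}"
  by (auto simp: flow_prog_def writes_level_prog)

lemma writes_init_prog:
  "nat_writes init_prog = {''v'', ''d'', ''u'', ''f''}" "real_writes init_prog = {''out_x'', ''z''}"
  by (auto simp: init_prog_def)

lemma writes_total_prog:
  "nat_writes total_prog = {''v'', ''u''}" "real_writes total_prog = {''kappa'', ''ex''}"
  by (auto simp: total_prog_def writes_excess_prog)

lemma writes_gap_prog:
  "nat_writes gap_prog = {''l'', ''c'', ''v'', ''g''}" "real_writes gap_prog = {}"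
  by (auto simp: gap_prog_def)

lemma writes_merge_prog:
  "nat_writes merge_prog = {''c'', ''v'', ''o'', ''u'', ''lab''}" "real_writes merge_prog = {}"
  by (auto simp: merge_prog_def)

lemma writes_raise_prog:
  "nat_writes raise_prog = {''p'', ''q'', ''l'', ''v'', ''u'', ''d'', ''f'', ''c'', ''g'', ''o'', ''lab''}"
  "real_writes raise_prog = {''ex'', ''r'', ''z'', ''out_x'', ''kappa''}"
  by (auto simp: raise_prog_def writes_init_prog writes_flow_prog writes_total_prog
      writes_gap_prog writes_merge_prog)

lemmas writes = writes_excess_prog writes_discharge_prog writes_level_prog writes_flow_prog
  writes_init_prog writes_total_prog writes_gap_prog writes_merge_prog writes_raise_prog

lemmas store_simps = upd_cell_apply fst_set_counter

section \<open>Correctness of raising one edge\<close>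

definition pair_flow :: "state \<Rightarrow> nat \<Rightarrow> nat \<Rightarrow> real" where "pair_flow s v
    u = snd s ''z'' [v, u]"
definition height :: "state \<Rightarrow> nat \<Rightarrow> nat" where "height s v = fst s ''d'' [v]"
definition edge_value :: "state \<Rightarrow> nat \<Rightarrow> real" where "edge_value s j = snd s
    ''out_x'' [j]"
definition label :: "state \<Rightarrow> nat \<Rightarrow> nat" where "label s v = fst s ''lab'' [v]"

lemma pair_flow_cong: "snd s ''z'' = snd s' ''z'' \<Longrightarrow> pair_flow s = pair_flow s'"
  and height_cong: "fst s ''d'' = fst s' ''d'' \<Longrightarrow> height s = height s'"
  and edge_value_cong: "snd s ''out_x'' = snd s' ''out_x'' \<Longrightarrow> edge_value s = edge_value s'"
  and label_cong: "fst s ''lab'' = fst s' ''lab'' \<Longrightarrow> label s = label s'"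
  by (simp_all add: pair_flow_def height_def edge_value_def label_def fun_eq_iff)

abbreviation input_arrays :: "string set" where
  "input_arrays \<equiv> {''n'', ''m'', ''k'', ''tail'', ''head'', ''member''}"

locale program_input = capacitated_graph n m tail head w
  for n m :: nat and tail head :: "nat \<Rightarrow> nat" and w :: "nat \<Rightarrow> real" +
  fixes k :: nat and S :: "nat \<Rightarrow> nat set" and inp :: "real store" and N0 :: "nat store"
  assumes N0: "N0 ''n'' [] = n" "N0 ''m'' [] = m" "N0 ''k'' [] = k"
      "\<And>j. j < m \<Longrightarrow> N0 ''tail'' [j] = tail j" "\<And>j. j < m \<Longrightarrow> N0
          ''head'' [j] = head j"
      "\<And>i v. i < k \<Longrightarrow> v < n \<Longrightarrow> N0 ''member'' [i, v] = (if v \<in> S i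
          then 1 else 0)"
    and inp: "\<And>j. j < m \<Longrightarrow> inp ''eta'' [] * inp ''x'' [j] = w j"
    and S: "\<And>i. i < k \<Longrightarrow> S i \<subseteq> {..<n}"
    and S_laminar: "\<And>i i'. i < k \<Longrightarrow> i' < k \<Longrightarrow> S i \<inter> S i' \<in>
        {{}, S i, S i'}"
begin

text \<open>Whole arrays are compared with the initial store \<open>N0\<close>, which suits the
  frame rules, since these work by array name.\<close>

definition kept :: "state \<Rightarrow> bool" where
  "kept s \<longleftrightarrow> (\<forall>a\<in>input_arrays. fst s a = N0 a)"

lemma keptD:
  assumes "kept s"
  shows "fst s ''n'' [] = n" "fst s ''m'' [] = m" "fst s ''k'' [] = k"
    "\<And>j. j < m \<Longrightarrow> fst s ''tail'' [j] = tail j" "\<And>j. j < m \<Longrightarrow> fst s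
        ''head'' [j] = head j"
    "\<And>i v. i < k \<Longrightarrow> v < n \<Longrightarrow> fst s ''member'' [i, v] = (if v \<in> S i
        then 1 else 0)"
  using assms N0 by (simp_all add: kept_def)

lemma kept_sem: "kept s \<Longrightarrow> nat_writes C \<inter> input_arrays = {} \<Longrightarrow> kept
    (sem inp C s)"
  unfolding kept_def by (metis IntI empty_iff sem_frame_nat)

lemma kept_frame:
  "kept s \<Longrightarrow> (\<And>a. a \<in> input_arrays \<Longrightarrow> fst s' a = fst s a)
      \<Longrightarrow> kept s'"
  unfolding kept_def by simp

lemma kept_set_counter: "kept s \<Longrightarrow> v \<notin> input_arrays \<Longrightarrow> kept
    (set_counter v i s)"
  by (auto simp: kept_def fst_set_counter upd_cell_other)

lemma excess_prog:
  assumes s: "kept s" "fst s ''v'' [] = v" "fst s ''j'' [] = j" "j < m"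
  shows "snd (sem inp excess_prog s) ''ex'' [] = excess n (root_cap j) (pair_flow s) v"
proof -
  define s1 where "s1 = sem inp (IfElse (NEq (Var ''v'') (NRead ''tail'' [Var ''j'']))
       (AssignR ''ex'' [] (RConst 0)) (AssignR ''ex'' [] (RSub (RConst 0) (RConst 1)))) s"
  have f: "fst s1 = fst s" and z: "snd s1 ''z'' = snd s ''z''"
    by (simp_all add: s1_def upd_cell_other)
  have ex: "snd s1 ''ex'' [] = - root_cap j v"
    using s keptD[OF s(1)] by (auto simp: s1_def root_cap_def store_simps)
  have "snd (sem inp (For ''u'' ''n'' 0
       (AssignR ''ex'' [] (RAdd (RVar ''ex'') (RRead ''z'' [Var ''v'', Var ''u''])))) s1) ''ex'' [] =
    excess n (root_cap j) (pair_flow s) v"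
  proof (rule sem_For_invariant[where k = n and
        I = "\<lambda>i s'. snd s' ''ex'' [] = (\<Sum>u<i. pair_flow s v u) - root_cap j v"], goal_cases)
    case 1
    then show ?case using f keptD[OF s(1)] by simp
  next
    case 2
    then show ?case using ex by simp
  next
    case (3 i s')
    have "fst s' ''v'' = fst s ''v''" "snd s' ''z'' = snd s ''z''" using 3(3)[of "''v''"] 3(4)[of "''z''"]
        f z by simp_all
    then show ?case using 3(2) s(2) by (simp add: store_simps pair_flow_def)
  next
    case (4 s')
    then show ?case by (simp add: excess_def)
  qed
  then show ?thesis by (simp only: excess_prog_def sem.simps(4) s1_def)
qed

text \<open>Each round of the loop is an instance of \<open>pushing_push\<close> or
  \<open>pushing_skip\<close>, and the final test decides between \<open>pushing_relabel\<close> and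
  \<open>pushing_done\<close>.\<close>

lemma discharge_prog:
  assumes s: "kept s" "fst s ''v'' [] = v" "fst s ''j'' [] = j" "j < m" "v < n"
    and pf: "preflow n (root_cap j) z0 (pair_flow s) (height s)" and dv: "height s v < n"
  defines "s' \<equiv> sem inp discharge_prog s"
  shows "preflow n (root_cap j) z0 (pair_flow s') (height s')"
    and "discharged n (root_cap j) v (pair_flow s) (height s) (pair_flow s') (height s')"
proof -
  let ?cap = "root_cap j"
  define s1 where "s1 = sem inp excess_prog s"
  have ex: "snd s1 ''ex'' [] = excess n ?cap (pair_flow s) v" using excess_prog[OF s(1-4)] by (simp add: s1_def)
  have f1: "fst s1 a = fst s a" if "a \<noteq> ''u''" for a
    using that by (simp add: s1_def sem_frame_nat writes)
  have z1: "pair_flow s1 = pair_flow s" and d1: "height s1 = height s"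
    by (rule pair_flow_cong height_cong; simp add: s1_def sem_frame_nat sem_frame_real writes)+
  define B where "B = When (Conj (RLess (RConst 0) (RVar ''ex'')) (NLess (NRead ''d'' [Var ''u'']) (NRead
      ''d'' [Var ''v''])))
         (IfElse (RLess (RVar ''ex'') (RRead ''z'' [Var ''v'', Var ''u'']))
            (AssignR ''r'' [] (RVar ''ex'')) (AssignR ''r'' [] (RRead ''z'' [Var ''v'', Var ''u''])) ;;
          AssignR ''z'' [Var ''v'', Var ''u''] (RSub (RRead ''z'' [Var ''v'', Var ''u'']) (RVar ''r'')) ;;
          AssignR ''z'' [Var ''u'', Var ''v''] (RAdd (RRead ''z'' [Var ''u'', Var ''v'']) (RVar ''r'')) ;;
          AssignR ''ex'' [] (RSub (RVar ''ex'') (RVar ''r'')))"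
  have wB: "nat_writes B = {}" "real_writes B = {''r'', ''z'', ''ex''}" by (auto simp: B_def)
  define s2 where "s2 = sem inp (For ''u'' ''n'' 0 B) s1"
  have f2: "fst s2 a = fst s a" if "a \<noteq> ''u''" for a
    using that f1 by (simp add: s2_def sem_frame_nat wB)
  have "pushing n ?cap z0 (pair_flow s) (height s) v n (pair_flow s2) \<and> snd s2 ''ex'' [] = excess n
      ?cap (pair_flow s2) v"
    unfolding s2_def
  proof (rule sem_For_invariant[where k = n and
        I = "\<lambda>i s'. pushing n ?cap z0 (pair_flow s) (height s) v i (pair_flow s') \<and> snd s'
            ''ex'' [] = excess n ?cap (pair_flow s') v"],
      goal_cases)
    case 1
    then show ?case using f1 keptD[OF s(1)] by simp
  next
    case 2
    then show ?case using pf ex z1 by (simp add: pushing_def)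
  next
    case (3 i s')
    have fr: "fst s' ''v'' [] = v" "fst s' ''d'' = fst s ''d''"
      using 3(3)[of "''v''"] 3(3)[of "''d''"] f1 s(2) by (simp_all add: wB)
    let ?e = "excess n ?cap (pair_flow s') v"
    let ?s = "sem inp B (set_counter ''u'' i s')"
    show ?case
    proof (cases "0 < ?e \<and> height s i < height s v")
      case True
      define e where "e = ?e"
      define r where "r = min e (snd s' ''z'' [v, i])"
      have ne: "v \<noteq> i" using True by auto
      have e: "snd s' ''ex'' [] = e" "0 < e" "fst s' ''d'' [i] < fst s' ''d'' [v]"
        using 3(2) True fr by (simp_all add: e_def height_def)
      have r: "r = (if e < snd s' ''z'' [v, i] then e else snd s' ''z'' [v, i])"
        by (simp add: r_def min_def)
      have "pair_flow ?s a b = push v i r (pair_flow s') a b" for a b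
        using e fr(1) ne unfolding r by (simp add: B_def store_simps pair_flow_def push_def)
      then have "pair_flow ?s = push v i r (pair_flow s')" by blast
      moreover have "snd ?s ''ex'' [] = ?e - r"
        using e fr(1) ne unfolding r e_def[symmetric] by (simp add: B_def store_simps)
      moreover have "excess n ?cap (push v i r (pair_flow s')) v = ?e - r"
        using excess_push[OF ne s(5) 3(1)] ne by simp
      ultimately show ?thesis
        using pushing_push[of n ?cap z0 "pair_flow s" "height s" v i "pair_flow s'" r] 3(1,2) s(5) True
        by (simp add: r_def e_def pair_flow_def)
    next
      case False
      then have "\<not> (0 < snd s' ''ex'' [] \<and> fst s' ''d'' [i] < fst s' ''d'' [v])"
        using 3(2) fr by (simp add: height_def)
      then have "?s = set_counter ''u'' i s'"
        using fr(1) unfolding B_def sem.simps(5) by (subst if_not_P) (simp_all add: store_simps)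
      moreover have "pair_flow (set_counter ''u'' i s') = pair_flow s'" by (rule pair_flow_cong) simp
      ultimately show ?thesis using pushing_skip[OF _ False] 3(2) by simp
    qed
  next
    case (4 s')
    moreover have "pair_flow (set_counter ''u'' n s') = pair_flow s'" by (rule pair_flow_cong) simp
    ultimately show ?case by simp
  qed
  then have push: "pushing n ?cap z0 (pair_flow s) (height s) v n (pair_flow s2)" and ex2: "snd s2 ''ex''
      [] = excess n ?cap (pair_flow s2) v"
    by auto
  have s': "s' = (if 0 < excess n ?cap (pair_flow s2) v
      then (upd_cell (fst s2) ''d'' [v] (Suc (height s v)), snd s2) else s2)"
    using ex2 f2 s(2) by (simp add: s'_def discharge_prog_def B_def[symmetric] s1_def[symmetric]
        s2_def[symmetric] height_def)
  have d2: "height s2 = height s" by (rule height_cong) (simp add: f2)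
  show "preflow n (root_cap j) z0 (pair_flow s') (height s')"
    and "discharged n (root_cap j) v (pair_flow s) (height s) (pair_flow s') (height s')"
  proof -
    have "preflow n (root_cap j) z0 (pair_flow s') (height s') \<and> discharged n (root_cap j) v
        (pair_flow s) (height s) (pair_flow s') (height s')"
    proof (cases "0 < excess n ?cap (pair_flow s2) v")
      case True
      have "pair_flow s' = pair_flow s2" by (rule pair_flow_cong) (simp add: s' True)
      moreover have "height s' u = (if u = v then Suc (height s v) else height s u)" for u
        using True f2 by (simp add: s' height_def store_simps)
      ultimately show ?thesis using pushing_relabel[OF push s(5) dv True] by simp
    next
      case False
      then show ?thesis using pushing_done[OF push s(5)] d2 by (simp add: s')
    qed
    then show "preflow n (root_cap j) z0 (pair_flow s') (height s')"
      and "discharged n (root_cap j) v (pair_flow s) (height s) (pair_flow s') (height s')" by auto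
  qed
qed

lemma pair_flow_set_counter [simp]: "pair_flow (set_counter v i s) = pair_flow s"
  by (rule pair_flow_cong) simp

lemma height_set_counter: "v \<noteq> ''d'' \<Longrightarrow> height (set_counter v i s) = height s"
  by (rule height_cong) (simp add: fst_set_counter upd_cell_other)

lemma level_prog:
  assumes s: "kept s" "fst s ''l'' [] = l" "fst s ''j'' [] = j" "j < m" "l < n"
    and pf: "preflow n (root_cap j) z0 (pair_flow s) (height s)"
    and wv: "wave n (root_cap j) c (\<lambda>u h. h < n - l) (pair_flow s) (height s)"
  defines "s' \<equiv> sem inp level_prog s"
  shows "preflow n (root_cap j) z0 (pair_flow s') (height s') \<and>
    wave n (root_cap j) c (\<lambda>u h. h < n - Suc l) (pair_flow s') (height s')"
proof -
  let ?cap = "root_cap j"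
  define h where "h = n - Suc l"
  have h: "h < n" "n - l = Suc h" using s(5) by (auto simp: h_def)
  define I where "I i s' \<longleftrightarrow> preflow n ?cap z0 (pair_flow s') (height s') \<and>
      wave n ?cap c (\<lambda>u l. l < h \<or> l = h \<and> i \<le> u) (pair_flow s') (height s')" for i s'
  show ?thesis
    unfolding s'_def level_prog_def
  proof (rule sem_For_invariant[where k = n and I = I], goal_cases)
    case 1
    then show ?case using keptD[OF s(1)] by simp
  next
    case 2
    \<comment> \<open>Before the first vertex is inspected, all vertices of height at most
      \<open>h\<close>, that is below \<open>n - l\<close>, are waiting.\<close>
    have "(\<lambda>(u::nat) l'. l' < h \<or> l' = h \<and> 0 \<le> u) = (\<lambda>u l'. l' < n - l)" using
        h by (auto simp: fun_eq_iff)
    then show ?case using pf wv by (simp add: I_def)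
  next
    case (3 i s')
    have kept: "kept s'" by (rule kept_frame[OF s(1)], rule 3(3)) (auto simp: writes)
    have fr: "fst s' ''l'' [] = l" "fst s' ''j'' [] = j"
      using 3(3)[of "''l''"] 3(3)[of "''j''"] s by (simp_all add: writes)
    let ?s = "set_counter ''v'' i s'"
    have kept2: "kept ?s" using kept_set_counter[OF kept] by simp
    have dz: "height ?s = height s'" by (simp add: height_set_counter)
    have cond: "bval inp (fst ?s) (snd ?s) (NEq (NAdd (NRead ''d'' [Var ''v'']) (NAdd (Var ''l'') (NConst
        1))) (Var ''n''))
        \<longleftrightarrow> height s' i = h"
      using s(5) fr keptD[OF kept] by (auto simp: store_simps height_def h_def)
    show ?case
    proof (cases "height s' i = h")
      case True
      have "I (Suc i) (sem inp discharge_prog ?s)"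
      proof -
        have pre: "fst ?s ''v'' [] = i" "fst ?s ''j'' [] = j" "preflow n ?cap z0 (pair_flow ?s) (height
            ?s)" "height ?s i < n"
          using fr 3(2) True h by (simp_all add: store_simps dz I_def)
        show ?thesis
          using discharge_prog[OF kept2 pre(1,2) s(4) 3(1) pre(3,4)]
            wave_discharged[of n ?cap c h i "pair_flow ?s" "height ?s"] 3(1,2) True h
          by (simp add: I_def dz)
      qed
      then show ?thesis using True cond by simp
    next
      case False
      \<comment> \<open>If vertex \<open>i\<close> is waiting, its height is below \<open>h\<close>,
        so it still waits after its turn on this level has passed.\<close>
      have "wave n ?cap c (\<lambda>u l. l < h \<or> l = h \<and> Suc i \<le> u) (pair_flow s') (height s')"
        using 3(2) False unfolding I_def wave_def by (metis Suc_leI le_neq_implies_less)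
      then show ?thesis using False cond 3(2) by (simp add: I_def dz)
    qed
  next
    case (4 s')
    have "(\<forall>u<n. P u \<longrightarrow> height s' u < h \<or> height s' u = h \<and> n \<le> u)
        \<longleftrightarrow> (\<forall>u<n. P u \<longrightarrow> height s' u < h)" for P
      by auto
    then show ?case using 4 by (simp add: I_def wave_def h_def height_set_counter)
  qed
qed

text \<open>At the start all heights below \<open>n\<close> wait, so \<open>wave\<close> holds. At
  the end only heights below 0 would wait, so no vertex is active or the sum of heights exceeds
  \<open>c\<close>.\<close>

lemma pass_prog:
  assumes s: "kept s" "fst s ''j'' [] = j" "j < m"
    and pf: "preflow n (root_cap j) z0 (pair_flow s) (height s)"
    and na: "no_active n (root_cap j) (pair_flow s) (height s) \<or> c \<le> (\<Sum>v<n. height s v)"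
  defines "s' \<equiv> sem inp (For ''l'' ''n'' 0 level_prog) s"
  shows "preflow n (root_cap j) z0 (pair_flow s') (height s') \<and>
    (no_active n (root_cap j) (pair_flow s') (height s') \<or> Suc c \<le> (\<Sum>v<n. height s' v))"
  unfolding s'_def
proof (rule sem_For_invariant[where k = n and I = "\<lambda>l s'. preflow n (root_cap j) z0 (pair_flow s')
    (height s') \<and>
    wave n (root_cap j) c (\<lambda>u h. h < n - l) (pair_flow s') (height s')"], goal_cases)
  case 1
  then show ?case using keptD[OF s(1)] by simp
next
  case 2
  then show ?case using pf na by (auto simp: wave_def)
next
  case (3 l s')
  have kept: "kept s'" by (rule kept_frame[OF s(1)], rule 3(3)) (auto simp: writes)
  have "fst s' ''j'' [] = j" using 3(3)[of "''j''"] s by (simp add: writes)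
  then show ?case
    using level_prog[of "set_counter ''l'' l s'" l j z0 c] kept_set_counter[OF kept] 3(1,2) s(3)
    by (simp add: store_simps height_set_counter)
next
  case (4 s')
  then show ?case by (auto simp: wave_def no_active_def height_set_counter not_le)
qed

lemma flow_prog:
  assumes s: "kept s" "fst s ''j'' [] = j" "j < m"
    and pf: "preflow n (root_cap j) z0 (pair_flow s) (height s)"
  defines "s' \<equiv> sem inp flow_prog s"
  shows "preflow n (root_cap j) z0 (pair_flow s') (height s') \<and> no_active n (root_cap j) (pair_flow
      s') (height s')"
proof -
  let ?cap = "root_cap j"
  define I where "I c s' \<longleftrightarrow> preflow n ?cap z0 (pair_flow s') (height s') \<and>
    (no_active n ?cap (pair_flow s') (height s') \<or> c \<le> (\<Sum>v<n. height s' v))" for c s'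
  have I_set: "I c (set_counter v i s') = I c s'" if "v \<noteq> ''d''" for c v i s'
    using that by (simp add: I_def height_set_counter)
  \<comment> \<open>The two nested counters are read as the single pass number
    \<open>p * Suc n + q\<close>.\<close>
  have "I (Suc n * Suc n) s'"
    unfolding s'_def flow_prog_def
  proof (rule sem_For_invariant[where k = "Suc n" and I = "\<lambda>p. I (p * Suc n)"], goal_cases)
    case 1
    then show ?case using keptD[OF s(1)] by simp
  next
    case 2
    then show ?case using pf by (simp add: I_def)
  next
    case (3 p s1)
    have kept: "kept s1" by (rule kept_frame[OF s(1)], rule 3(3)) (auto simp: writes)
    have j: "fst s1 ''j'' [] = j" using 3(3)[of "''j''"] s by (simp add: writes)
    have kept': "kept (set_counter ''p'' p s1)" using kept_set_counter[OF kept] by simp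
    show ?case
    proof (rule sem_For_invariant[where k = "Suc n" and I = "\<lambda>q. I (p * Suc n + q)"], goal_cases)
      case 1
      then show ?case using keptD[OF kept'] by simp
    next
      case 2
      then show ?case using 3(2) by (simp add: I_set)
    next
      case q: (3 q s2)
      have kept2: "kept s2" by (rule kept_frame[OF kept'], rule q(3)) (auto simp: writes)
      have j2: "fst s2 ''j'' [] = j" using q(3)[of "''j''"] j by (simp add: writes store_simps)
      show ?case
        using pass_prog[of "set_counter ''q'' q s2" j z0 "p * Suc n + q"] kept_set_counter[OF kept2]
          j2 s(3) q(2) by (simp add: I_def store_simps height_set_counter)
    next
      case (4 s2)
      then show ?case by (simp add: I_set add_ac)
    qed
  next
    case (4 s1)
    then show ?case by (simp add: I_set)
  qed
  then have I: "I (Suc n * Suc n) s'" .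
  \<comment> \<open>Heights never exceed \<open>n\<close>, so the sum stays below the number of
    passes and only the alternative without active vertices remains.\<close>
  have "(\<Sum>v<n. height s' v) \<le> (\<Sum>v<n. n)"
    by (rule sum_mono) (use I in \<open>auto simp: I_def preflow_def\<close>)
  then have "(\<Sum>v<n. height s' v) < Suc n * Suc n" by simp
  then show ?thesis using I by (simp add: I_def)
qed

lemma init_prog:
  assumes s: "kept s" "fst s ''j'' [] = j" "j < m"
  defines "s' \<equiv> sem inp init_prog s"
  shows "edge_value s' = (edge_value s)(j := w j)"
    and "v < n \<Longrightarrow> u < n \<Longrightarrow> pair_flow s' v u = pair_weight ((edge_value s)(j
        := w j)) v u"
    and "v < n \<Longrightarrow> height s' v = 0"
proof -
  define y1 where "y1 = (edge_value s)(j := w j)"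
  define s1 where "s1 = sem inp (AssignR ''out_x'' [Var ''j''] (RScale ''eta'' [] (RInput ''x'' [Var
      ''j'']))) s"
  have f1: "fst s1 = fst s" by (simp add: s1_def)
  have y_1: "edge_value s1 = y1" using s inp[OF s(3)] by (auto simp: s1_def y1_def edge_value_def
      store_simps fun_eq_iff)
  have kept1: "kept s1" using s(1) by (simp add: kept_def f1)
  let ?Z = "For ''u'' ''n'' 0 (AssignR ''z'' [Var ''v'', Var ''u''] (RConst 0))"
  define s2 where "s2 = sem inp (For ''v'' ''n'' 0 (AssignN ''d'' [Var ''v''] (NConst 0) ;; ?Z)) s1"
  have kept2: "kept s2" unfolding s2_def by (rule kept_sem[OF kept1]) simp
  have y_2: "edge_value s2 = y1" using y_1 edge_value_cong[of s2 s1] by (simp add: s2_def sem_frame_real)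
  have zero: "\<forall>v<n. height s2 v = 0 \<and> (\<forall>u<n. pair_flow s2 v u = 0)"
    unfolding s2_def
  proof (rule sem_For_invariant[where k = n and I = "\<lambda>i s'. \<forall>v<i. height s' v = 0 \<and>
      (\<forall>u<n. pair_flow s' v u = 0)"], goal_cases)
    case 1
    then show ?case using keptD[OF kept1] by simp
  next
    case (3 i s3)
    have kept3: "kept s3" by (rule kept_frame[OF kept1], rule 3(3)) auto
    define s4 where "s4 = sem inp (AssignN ''d'' [Var ''v''] (NConst 0)) (set_counter ''v'' i s3)"
    have s4: "fst s4 ''v'' [] = i" "fst s4 ''n'' [] = n" "pair_flow s4 = pair_flow s3" "height s4 = (height
        s3)(i := 0)"
      using keptD[OF kept3] by (auto simp: s4_def store_simps pair_flow_def height_def fun_eq_iff)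
    have "height (sem inp ?Z s4) = height s4" by (rule height_cong) (simp add: sem_frame_nat)
    moreover have "(\<forall>v<i. \<forall>u<n. pair_flow (sem inp ?Z s4) v u = 0) \<and> (\<forall>u<n.
        pair_flow (sem inp ?Z s4) i u = 0)"
    proof (rule sem_For_invariant[where k = n and
          I = "\<lambda>l s'. (\<forall>v<i. \<forall>u<n. pair_flow s' v u = 0) \<and> (\<forall>u<l.
              pair_flow s' i u = 0)"], goal_cases)
      case 1
      then show ?case using s4 by simp
    next
      case 2
      then show ?case using 3(2) s4 by simp
    next
      case l: (3 l s')
      have "fst s' ''v'' [] = i" using l(3)[of "''v''"] s4 by simp
      then show ?case using l(2) by (auto simp: pair_flow_def store_simps less_Suc_eq)
    qed simp
    ultimately show ?case unfolding sem.simps(4) s4_def[symmetric]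
      using 3(2) s4(4) by (simp add: less_Suc_eq)
  qed (simp_all add: height_set_counter)
  define s3 where "s3 = sem inp (For ''f'' ''m'' 0
       (AssignR ''z'' [NRead ''tail'' [Var ''f''], NRead ''head'' [Var ''f'']]
         (RAdd (RRead ''z'' [NRead ''tail'' [Var ''f''], NRead ''head'' [Var ''f'']])
               (RRead ''out_x'' [Var ''f''])))) s2"
  have s': "s' = s3" by (simp add: s'_def init_prog_def s1_def s2_def s3_def)
  have "edge_value s3 = edge_value s2" by (rule edge_value_cong) (simp add: s3_def sem_frame_real)
  then show "edge_value s' = (edge_value s)(j := w j)" using y_2 s' by (simp add: y1_def)
  have "height s3 = height s2" by (rule height_cong) (simp add: s3_def sem_frame_nat)
  then show "v < n \<Longrightarrow> height s' v = 0" using zero s' by simp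
  have "\<forall>v<n. \<forall>u<n. pair_flow s3 v u = pair_weight y1 v u"
    unfolding s3_def
  proof (rule sem_For_invariant[where k = m and
        I = "\<lambda>i s'. \<forall>v<n. \<forall>u<n. pair_flow s' v u = (\<Sum>f<i. if tail f = v \<and>
            head f = u then y1 f else 0)"], goal_cases)
    case 1
    then show ?case using keptD[OF kept2] by simp
  next
    case 2
    then show ?case using zero by simp
  next
    case (3 i s')
    have kept3: "kept s'" by (rule kept_frame[OF kept2], rule 3(3)) auto
    have "edge_value s' = y1" using 3(4)[of "''out_x''"] y_2 edge_value_cong[of s' s2] by simp
    then have yi: "snd s' ''out_x'' [i] = y1 i" by (metis edge_value_def)
    have ti: "fst s' ''tail'' [i] = tail i" "fst s' ''head'' [i] = head i"
      using keptD[OF kept3] 3(1) by auto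
    show ?case using 3(2) yi ti by (auto simp: store_simps pair_flow_def)
  next
    case (4 s')
    then show ?case by (simp add: pair_weight_def)
  qed
  then show "v < n \<Longrightarrow> u < n \<Longrightarrow> pair_flow s' v u = pair_weight ((edge_value
      s)(j := w j)) v u"
    using s' by (simp add: y1_def)
qed

lemma total_prog:
  assumes s: "kept s" "fst s ''j'' [] = j" "j < m"
  shows "snd (sem inp total_prog s) ''kappa'' [] = (\<Sum>v<n. max 0 (excess n (root_cap j) (pair_flow s) v))"
proof -
  define s1 where "s1 = sem inp (AssignR ''kappa'' [] (RConst 0)) s"
  have s1: "fst s1 = fst s" "snd s1 ''z'' = snd s ''z''" "snd s1 ''kappa'' [] = 0"
    by (simp_all add: s1_def store_simps upd_cell_other)
  have kept1: "kept s1" using s(1) by (simp add: kept_def s1(1))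
  have "snd (sem inp (For ''v'' ''n'' 0
       (excess_prog ;;
        When (RLess (RConst 0) (RVar ''ex'')) (AssignR ''kappa'' [] (RAdd (RVar ''kappa'') (RVar
            ''ex''))))) s1) ''kappa'' [] =
    (\<Sum>v<n. max 0 (excess n (root_cap j) (pair_flow s) v))"
  proof (rule sem_For_invariant[where k = n and
        I = "\<lambda>i s'. snd s' ''kappa'' [] = (\<Sum>v<i. max 0 (excess n (root_cap j) (pair_flow s)
            v))"], goal_cases)
    case 1
    then show ?case using keptD[OF s(1)] s1 by simp
  next
    case 2
    then show ?case using s1 by simp
  next
    case (3 i s')
    have kept: "kept s'" by (rule kept_frame[OF kept1], rule 3(3)) (auto simp: writes)
    have fr: "fst s' ''j'' [] = j" "pair_flow s' = pair_flow s"
      using 3(3)[of "''j''"] s s1 3(4)[of "''z''"] pair_flow_cong[of s' s] by (simp_all add: writes)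
    have "snd (sem inp excess_prog (set_counter ''v'' i s')) ''ex'' [] = excess n (root_cap j) (pair_flow s) i"
      using excess_prog[of "set_counter ''v'' i s'" i j] kept_set_counter[OF kept] fr s(3)
      by (simp add: store_simps)
    moreover have "snd (sem inp excess_prog (set_counter ''v'' i s')) ''kappa'' = snd s' ''kappa''"
      by (simp add: sem_frame_real writes)
    ultimately show ?case using 3(2) by (simp add: store_simps)
  qed simp
  then show ?thesis by (simp add: total_prog_def s1_def)
qed

lemma gap_prog:
  assumes s: "kept s" and ex: "\<exists>g<n. \<forall>v<n. height s v \<noteq> g"
  defines "g \<equiv> fst (sem inp gap_prog s) ''g'' []"
  shows "g < n" "v < n \<Longrightarrow> height s v \<noteq> g"
proof -
  define gap where "gap g \<longleftrightarrow> g < n \<and> (\<forall>v<n. height s v \<noteq> g)" for g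
  let ?F = "For ''v'' ''n'' 0
          (When (NEq (NRead ''d'' [Var ''v'']) (Var ''l'')) (AssignN ''c'' [] (NConst 1)))"
  \<comment> \<open>The cell \<open>g\<close> holds an arbitrary value until a gap is found, hence
    the invariant is an implication.\<close>
  have "(\<exists>g<n. gap g) \<longrightarrow> gap g"
    unfolding g_def gap_prog_def
  proof (rule sem_For_invariant[where k = n and I = "\<lambda>i s'. (\<exists>g<i. gap g) \<longrightarrow>
      gap (fst s' ''g'' [])"], goal_cases)
    case 1
    then show ?case using keptD[OF s(1)] by simp
  next
    case (3 i s1)
    have kept: "kept s1" by (rule kept_frame[OF s(1)], rule 3(3)) auto
    have d1: "fst s1 ''d'' = fst s ''d''" using 3(3)[of "''d''"] by simp
    define s2 where "s2 = sem inp (AssignN ''c'' [] (NConst 0)) (set_counter ''l'' i s1)"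
    have s2: "fst s2 ''l'' [] = i" "fst s2 ''n'' [] = n" "fst s2 ''d'' = fst s ''d''" "fst s2 ''c'' [] = 0"
      "fst s2 ''g'' = fst s1 ''g''"
      using keptD[OF kept] d1 by (simp_all add: s2_def store_simps upd_cell_other)
    have c: "fst (sem inp ?F s2) ''c'' [] = (if \<exists>v<n. height s v = i then 1 else 0)"
    proof (rule sem_For_invariant[where k = n and I = "\<lambda>l s'. fst s' ''c'' [] = (if \<exists>v<l.
        height s v = i then 1 else 0)"], goal_cases)
      case 1
      then show ?case using s2 by simp
    next
      case 2
      then show ?case using s2 by simp
    next
      case (3 v s')
      have "fst s' ''d'' = fst s ''d''" "fst s' ''l'' [] = i"
        using 3(3)[of "''d''"] 3(3)[of "''l''"] s2 by simp_all
      then show ?case using 3(2) by (auto simp: store_simps height_def less_Suc_eq)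
    qed (simp add: store_simps)
    have g: "fst (sem inp ?F s2) ''g'' = fst s1 ''g''" "fst (sem inp ?F s2) ''l'' [] = i"
      using s2 by (simp_all add: sem_frame_nat)
    have gapi: "gap i \<longleftrightarrow> \<not> (\<exists>v<n. height s v = i)" using 3(1) by (auto
        simp: gap_def)
    show ?case unfolding sem.simps(4) s2_def[symmetric]
      using 3(2) c g gapi by (auto simp: store_simps less_Suc_eq)
  qed (simp_all add: store_simps)
  then show "g < n" "v < n \<Longrightarrow> height s v \<noteq> g" using ex by (auto simp: gap_def)
qed

text \<open>After the first \<open>i\<close> vertices, the labels are as if the original classes of
  those among them that lie in \<open>U\<close> had received the label of
  \<open>tail j\<close>.\<close>

lemma merge_prog:
  assumes s: "kept s" "fst s ''j'' [] = j" "j < m" "fst s ''g'' [] = g"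
    and U: "U = {v. v < n \<and> g < height s v}"
    and u: "u < n"
  shows "label (sem inp merge_prog s) u = (if \<exists>v\<in>U. label s v = label s u then label s (tail j)
      else label s u)"
proof -
  let ?c = "label s (tail j)"
  let ?F = "For ''u'' ''n'' 0
            (When (NEq (NRead ''lab'' [Var ''u'']) (Var ''o''))
              (AssignN ''lab'' [Var ''u''] (Var ''c'')))"
  define s1 where "s1 = sem inp (AssignN ''c'' [] (NRead ''lab'' [NRead ''tail'' [Var ''j'']])) s"
  have s1: "fst s1 ''c'' [] = ?c" "\<And>a. a \<noteq> ''c'' \<Longrightarrow> fst s1 a = fst s a"
    using s keptD[OF s(1)] by (simp_all add: s1_def store_simps upd_cell_other label_def)
  have kept1: "kept s1" unfolding s1_def by (rule kept_sem[OF s(1)]) simp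
  have "\<forall>u<n. label (sem inp (For ''v'' ''n'' 0
       (When (NLess (Var ''g'') (NRead ''d'' [Var ''v'']))
         (AssignN ''o'' [] (NRead ''lab'' [Var ''v'']) ;; ?F))) s1) u =
    (if \<exists>v<n. v \<in> U \<and> label s v = label s u then ?c else label s u)"
  proof (rule sem_For_invariant[where k = n and
        I = "\<lambda>i s'. \<forall>u<n. label s' u = (if \<exists>v<i. v \<in> U \<and> label s v = label
            s u then ?c else label s u)"], goal_cases)
    case 1
    then show ?case using keptD[OF kept1] by simp
  next
    case 2
    then show ?case using label_cong[of s1 s] s1(2) by simp
  next
    case (3 i s2)
    have kept2: "kept s2" by (rule kept_frame[OF kept1], rule 3(3)) auto
    have fr: "fst s2 ''g'' [] = g" "fst s2 ''d'' = fst s ''d''" "fst s2 ''c'' [] = ?c"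
      using 3(3)[of "''g''"] 3(3)[of "''d''"] 3(3)[of "''c''"] s1 s(4) by simp_all
    show ?case
    proof (cases "i \<in> U")
      case True
      define s3 where "s3 = sem inp (AssignN ''o'' [] (NRead ''lab'' [Var ''v''])) (set_counter ''v'' i s2)"
      have s3: "fst s3 ''o'' [] = label s2 i" "fst s3 ''c'' [] = ?c" "fst s3 ''lab'' = fst s2 ''lab''" "fst
          s3 ''n'' [] = n"
        using fr keptD[OF kept2] by (simp_all add: s3_def store_simps upd_cell_other label_def)
      have F: "\<forall>u<n. label (sem inp ?F s3) u = (if label s2 u = label s2 i then ?c else label s2 u)"
      proof (rule sem_For_invariant[where k = n and
            I = "\<lambda>l s'. \<forall>u<n. label s' u = (if u < l \<and> label s2 u = label s2 i then ?c
                else label s2 u)"], goal_cases)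
        case 1
        then show ?case using s3 by simp
      next
        case 2
        then show ?case using s3 label_cong[of s3 s2] by simp
      next
        case (3 l s')
        have fr: "fst s' ''o'' [] = label s2 i" "fst s' ''c'' [] = ?c"
          using 3(3)[of "''o''"] 3(3)[of "''c''"] s3 by simp_all
        have l: "label s' l = label s2 l" using 3(1,2) by simp
        show ?case
        proof (cases "label s2 l = label s2 i")
          case True
          then have "label (sem inp (When (NEq (NRead ''lab'' [Var ''u'']) (Var ''o''))
              (AssignN ''lab'' [Var ''u''] (Var ''c''))) (set_counter ''u'' l s')) = (label s')(l := ?c)"
            using fr l by (auto simp: store_simps label_def fun_eq_iff)
          then show ?thesis using 3(2) True by (auto simp: less_Suc_eq)
        next
          case False
          then have "label (sem inp (When (NEq (NRead ''lab'' [Var ''u'']) (Var ''o''))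
              (AssignN ''lab'' [Var ''u''] (Var ''c''))) (set_counter ''u'' l s')) = label s'"
            using fr l by (auto simp: store_simps label_def fun_eq_iff)
          then show ?thesis using 3(2) False by (auto simp: less_Suc_eq)
        qed
      next
        case (4 s')
        moreover have "label (set_counter ''u'' n s') = label s'"
          by (rule label_cong) (simp add: fst_set_counter upd_cell_other)
        ultimately show ?case by simp
      qed
      have "sem inp (When (NLess (Var ''g'') (NRead ''d'' [Var ''v'']))
         (AssignN ''o'' [] (NRead ''lab'' [Var ''v'']) ;; ?F)) (set_counter ''v'' i s2) = sem inp ?F s3"
        using True fr U by (simp add: s3_def store_simps height_def)
      moreover have "label (sem inp ?F s3) u = (if \<exists>v<Suc i. v \<in> U \<and> label s v = label s u
          then ?c else label s u)"
        if "u < n" for u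
      proof -
        have Fu: "label (sem inp ?F s3) u = (if label s2 u = label s2 i then ?c else label s2 u)" using F
            that by blast
        have a: "label s2 u = (if \<exists>v<i. v \<in> U \<and> label s v = label s u then ?c else label s u)"
          and b: "label s2 i = (if \<exists>v<i. v \<in> U \<and> label s v = label s i then ?c else label s i)"
          using 3(1,2) that by blast+
        have ex: "(\<exists>v<Suc i. v \<in> U \<and> label s v = label s u) \<longleftrightarrow>
            (\<exists>v<i. v \<in> U \<and> label s v = label s u) \<or> label s i = label s u"
          using True by (auto simp: less_Suc_eq)
        show ?thesis
        proof (cases "label s i = label s u")
          case True
          have "label s2 u = label s2 i" unfolding a b True by (rule refl)
          then show ?thesis using Fu ex True by simp
        next
          case False
          \<comment> \<open>Vertices of different original classes can share a current label only if
            it is \<open>?c\<close>, and then rewriting it to \<open>?c\<close> changes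
            nothing.\<close>
          then show ?thesis using Fu a b ex by (auto split: if_splits)
        qed
      qed
      ultimately show ?thesis by simp
    next
      case False
      have "sem inp (When (NLess (Var ''g'') (NRead ''d'' [Var ''v'']))
         (AssignN ''o'' [] (NRead ''lab'' [Var ''v'']) ;; ?F)) (set_counter ''v'' i s2) = set_counter ''v''
             i s2"
        using False 3(1) fr U by (simp add: store_simps height_def)
      moreover have "label (set_counter ''v'' i s2) = label s2"
        by (rule label_cong) (simp add: fst_set_counter upd_cell_other)
      moreover have "(\<exists>v<Suc i. v \<in> U \<and> label s v = label s u) \<longleftrightarrow>
          (\<exists>v<i. v \<in> U \<and> label s v = label s u)" for u
        using False by (auto simp: less_Suc_eq)
      ultimately show ?thesis using 3(2) by simp
    qed
  next
    case (4 s')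
    moreover have "label (set_counter ''v'' n s') = label s'"
      by (rule label_cong) (simp add: fst_set_counter upd_cell_other)
    ultimately show ?case by simp
  qed
  then have "label (sem inp merge_prog s) u = (if \<exists>v<n. v \<in> U \<and> label s v = label s u then
      ?c else label s u)"
    using u by (simp add: merge_prog_def s1_def)
  moreover have "(\<exists>v<n. v \<in> U \<and> label s v = label s u) \<longleftrightarrow>
      (\<exists>v\<in>U. label s v = label s u)" using U by blast
  ultimately show ?thesis by simp
qed

text \<open>Let \<kappa> be the total positive excess left by the flow. It bounds every violation by
  \<open>preflow_upper_bound\<close>, and if it is positive, the set above a gap attains it. So
  \<open>raise_edge\<close> applies and yields the tight set to be merged.\<close>

lemma raise_prog:
  assumes s: "kept s" "fst s ''j'' [] = j" "j < m"
    and ind: "independent (edge_value s)" and cls: "\<And>v. v < n \<Longrightarrow> tight (edge_value s)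
        (cls (label s) v)"
  defines "s' \<equiv> sem inp raise_prog s"
  shows "raised j (edge_value s) (label s) (edge_value s') (label s')"
proof -
  let ?cap = "root_cap j"
  define y1 where "y1 = (edge_value s)(j := w j)"
  define s1 where "s1 = sem inp init_prog s"
  define s2 where "s2 = sem inp flow_prog s1"
  define s3 where "s3 = sem inp total_prog s2"
  define \<kappa> where "\<kappa> = (\<Sum>v<n. max 0 (excess n ?cap (pair_flow s2) v))"
  have kept1: "kept s1" unfolding s1_def by (rule kept_sem[OF s(1)]) (simp add: writes)
  have kept2: "kept s2" unfolding s2_def by (rule kept_sem[OF kept1]) (simp add: writes)
  have kept3: "kept s3" unfolding s3_def by (rule kept_sem[OF kept2]) (simp add: writes)
  have j1: "fst s1 ''j'' [] = j" using s(2) by (simp add: s1_def sem_frame_nat writes)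
  have j2: "fst s2 ''j'' [] = j" using j1 by (simp add: s2_def sem_frame_nat writes)
  have j3: "fst s3 ''j'' [] = j" using j2 by (simp add: s3_def sem_frame_nat writes)
  have y3: "edge_value s3 = y1"
  proof -
    have "edge_value s3 = edge_value s1" by (rule edge_value_cong) (simp add: s3_def s2_def sem_frame_real
        writes)
    then show ?thesis using init_prog(1)[OF s] by (simp add: s1_def y1_def)
  qed
  have lb3: "label s3 = label s" by (rule label_cong) (simp add: s3_def s2_def s1_def sem_frame_nat writes)
  have d3: "height s3 = height s2" by (rule height_cong) (simp add: s3_def sem_frame_nat writes)
  have y1_nonneg: "0 \<le> y1 f" if "f < m" for f
    using that ind w_nonneg by (auto simp: y1_def independent_def)
  have z1: "pair_flow s1 v u = pair_weight y1 v u" if "v < n" "u < n" for v u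
    using init_prog(2)[OF s] that by (simp add: s1_def y1_def)
  \<comment> \<open>All heights start at 0, so only the nonnegativity of the shares has to be
    checked.\<close>
  have "preflow n ?cap (pair_flow s1) (pair_flow s1) (height s1)"
    using init_prog(3)[OF s] y1_nonneg
    by (auto simp: preflow_def s1_def[symmetric] z1 pair_weight_def intro!: sum_nonneg)
  then have pf: "preflow n ?cap (pair_flow s1) (pair_flow s2) (height s2)" and na: "no_active n ?cap
      (pair_flow s2) (height s2)"
    using flow_prog[OF kept1 j1 s(3)] by (simp_all add: s2_def)
  have sum_z: "(\<Sum>v\<in>U. \<Sum>u\<in>U. pair_flow s1 v u) = sum y1 (inside U)" if "U \<subseteq>
      {..<n}" for U
  proof -
    have "(\<Sum>v\<in>U. \<Sum>u\<in>U. pair_flow s1 v u) = (\<Sum>v\<in>U. \<Sum>u\<in>U. pair_weight y1 v u)"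
      by (intro sum.cong refl) (use that z1 in auto)
    then show ?thesis using sum_pair_weight[of U y1] that finite_subset by auto
  qed
  have bound: "sum y1 (inside U) - (\<Sum>v\<in>U. ?cap v) \<le> \<kappa>" if "U \<subseteq> {..<n}" for U
    using preflow_upper_bound[OF pf that] sum_z[OF that] by (simp add: \<kappa>_def)
  have k3: "snd s3 ''kappa'' [] = \<kappa>" using total_prog[OF kept2 j2 s(3)] by (simp add: s3_def
      \<kappa>_def)
  have \<kappa>0: "0 \<le> \<kappa>" by (simp add: \<kappa>_def sum_nonneg)
  show ?thesis
  proof (cases "0 < \<kappa>")
    case False
    then have s': "s' = s3" using k3 by (simp add: s'_def raise_prog_def s1_def s2_def s3_def)
    have k0: "\<kappa> = 0" using False \<kappa>0 by simp
    \<comment> \<open>For \<kappa> = 0 no violated set has to be exhibited; the empty set takes the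
      place of \<open>U0\<close>.\<close>
    have ind': "independent y1" and le: "edge_value s j \<le> w j"
      using raise_edge(1,2)[OF ind s(3) \<kappa>0, of "{}"] bound by (simp_all add: k0 y1_def)
    have mono: "edge_value s f \<le> y1 f" if "f < m" for f using le by (simp add: y1_def)
    have "tight y1 (cls (label s) v)" if "v < n" for v
      by (rule tight_mono[OF cls[OF that] ind' mono])
    then show ?thesis using ind' le unfolding raised_def s' y3 lb3 by (simp add: y1_def)
  next
    case True
    define y2 where "y2 = (edge_value s)(j := w j - \<kappa>)"
    define s4 where "s4 = sem inp (AssignR ''out_x'' [Var ''j''] (RSub (RRead ''out_x'' [Var ''j'']) (RVar
        ''kappa''))) s3"
    define s5 where "s5 = sem inp gap_prog s4"
    have s': "s' = sem inp merge_prog s5"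
      using True k3 by (simp add: s'_def raise_prog_def s1_def s2_def s3_def s4_def s5_def)
    have f4: "fst s4 = fst s3" by (simp add: s4_def)
    have y4: "edge_value s4 = y2" using k3 y3 j3 by (auto simp: s4_def edge_value_def store_simps
        fun_eq_iff y1_def y2_def)
    have kept4: "kept s4" using kept3 f4 by (simp add: kept_def)
    have kept5: "kept s5" unfolding s5_def by (rule kept_sem[OF kept4]) (simp add: writes)
    have j5: "fst s5 ''j'' [] = j" using j3 f4 by (simp add: s5_def sem_frame_nat writes)
    have d4: "height s4 = height s2" using d3 f4 height_cong[of s4 s3] by simp
    have d5: "height s5 = height s2" using d4 height_cong[of s5 s4] by (simp add: s5_def sem_frame_nat writes)
    have lb5: "label s5 = label s" using lb3 f4 label_cong[of s5 s3] by (simp add: s5_def sem_frame_nat writes)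
    have y': "edge_value s' = y2" using y4 edge_value_cong[of s' s4] by (simp add: s' s5_def sem_frame_real
        writes)
    define g where "g = fst s5 ''g'' []"
    have gap: "g < n" "\<And>v. v < n \<Longrightarrow> height s2 v \<noteq> g"
      using gap_prog[OF kept4] ex_gap[OF pf na] True d4 by (simp_all add: g_def s5_def \<kappa>_def)
    define U where "U = {v. v < n \<and> g < height s2 v}"
    have Un: "U \<subseteq> {..<n}" by (auto simp: U_def)
    have exact: "sum y1 (inside U) - (\<Sum>v\<in>U. ?cap v) = \<kappa>"
      using preflow_gap_exact[OF pf na gap U_def] sum_z[OF Un] by (simp add: \<kappa>_def)
    have ind': "independent y2" and le: "edge_value s j \<le> w j - \<kappa>"
      and U: "tight y2 U" "tail j \<in> U" "head j \<in> U"
      using raise_edge[OF ind s(3) \<kappa>0, of U] bound exact Un True by (simp_all add: y1_def y2_def)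
    have mono: "edge_value s f \<le> y2 f" if "f < m" for f using le by (simp add: y2_def)
    have cls2: "tight y2 (cls (label s) v)" if "v < n" for v
      by (rule tight_mono[OF cls[OF that] ind' mono])
    have lab': "label s' u = (if \<exists>v\<in>U. label s v = label s u then label s (tail j) else label s
        u)" if "u < n" for u
      using merge_prog[OF kept5 j5 s(3) g_def[symmetric] _ that, of U] unfolding s' lb5 d5 U_def by blast
    have "tight y2 (cls (label s') v)" if "v < n" for v
      by (rule tight_cls_merge[OF ind' cls2 U(1,2) lab' that])
    \<comment> \<open>Both ends of \<open>j\<close> lie in \<open>U\<close>, so both receive the old
      label of \<open>tail j\<close>.\<close>
    moreover have "label s' (tail j) = label s' (head j)"
    proof -
      have "\<exists>v\<in>U. label s v = label s (tail j)" "\<exists>v\<in>U. label s v = label s (head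
          j)" using U by blast+
      then show ?thesis using lab'[OF ends(1)[OF s(3)]] lab'[OF ends(2)[OF s(3)]] by argo
    qed
    moreover have "\<forall>u<n. \<forall>v<n. label s u = label s v \<longrightarrow> label s' u = label
        s' v" using lab' by simp
    moreover have "\<forall>f<m. f \<noteq> j \<longrightarrow> y2 f = edge_value s f" "edge_value s j
        \<le> y2 j" using le by (auto simp: y2_def)
    ultimately show ?thesis unfolding raised_def y' using ind' by blast
  qed
qed

end

section \<open>The complete program\<close>

text \<open>Every vertex emits a row with its class, so a class is written once per member; the
  output is read as a set of sets, where repetitions vanish.\<close>

definition emit_prog :: loop_com where
  "emit_prog =
     For ''v'' ''n'' 0
       (For ''u'' ''n'' 0
          (IfElse (NEq (NRead ''lab'' [Var ''u'']) (NRead ''lab'' [Var ''v'']))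
            (AssignN ''out_member'' [Var ''out_k'', Var ''u''] (NConst 1))
            (AssignN ''out_member'' [Var ''out_k'', Var ''u''] (NConst 0))) ;;
        AssignN ''out_k'' [] (NAdd (Var ''out_k'') (NConst 1)))"

definition set_prog :: loop_com where
  "set_prog =
     For ''j'' ''m'' 0
       (When (Conj (NLess (NConst 0) (NRead ''member'' [Var ''i'', NRead ''tail'' [Var ''j'']]))
                   (NLess (NConst 0) (NRead ''member'' [Var ''i'', NRead ''head'' [Var ''j'']])))
          raise_prog) ;;
     emit_prog"

definition size_prog :: loop_com where
  "size_prog =
     AssignN ''size'' [] (NConst 0) ;;
     For ''v'' ''n'' 0
       (AssignN ''size'' [] (NAdd (Var ''size'') (NRead ''member'' [Var ''i'', Var ''v''])))"

text \<open>Running through all sets once for every size from 0 to \<open>n\<close> replaces sorting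
  them by size.\<close>

definition sweep_prog :: loop_com where
  "sweep_prog =
     For ''s'' ''n'' 1
       (For ''i'' ''k'' 0 (size_prog ;; When (NEq (Var ''size'') (Var ''s'')) set_prog))"

definition thin_prog :: loop_com where
  "thin_prog =
     For ''j'' ''m'' 0 (AssignR ''out_x'' [Var ''j''] (RConst 0)) ;;
     For ''v'' ''n'' 0 (AssignN ''lab'' [Var ''v''] (Var ''v'')) ;;
     AssignN ''out_k'' [] (NConst 0) ;;
     sweep_prog"

lemma writes_emit_prog:
  "nat_writes emit_prog = {''v'', ''u'', ''out_member'', ''out_k''}" "real_writes emit_prog = {}"
  by (auto simp: emit_prog_def)

lemma writes_size_prog: "nat_writes size_prog = {''v'', ''size''}" "real_writes size_prog = {}"
  by (auto simp: size_prog_def)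

lemma writes_set_prog:
  "nat_writes set_prog = {''j'', ''p'', ''q'', ''l'', ''v'', ''u'', ''d'', ''f'', ''c'', ''g'', ''o'', ''lab'',
     ''out_member'', ''out_k''}"
  "real_writes set_prog = {''ex'', ''r'', ''z'', ''out_x'', ''kappa''}"
  by (auto simp: set_prog_def writes_emit_prog writes)

lemmas writes' = writes_emit_prog writes_size_prog writes_set_prog writes

lemma well_formed_thin_prog: "well_formed thin_prog"
  by (simp add: thin_prog_def sweep_prog_def size_prog_def set_prog_def emit_prog_def raise_prog_def
      init_prog_def flow_prog_def level_prog_def discharge_prog_def excess_prog_def total_prog_def
      gap_prog_def merge_prog_def)

definition rows :: "nat \<Rightarrow> state \<Rightarrow> nat set set" where
  "rows n s = (\<lambda>i. {u. u < n \<and> fst s ''out_member'' [i, u] = 1}) ` {..<fst s ''out_k'' []}"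

lemma rows_cong:
  "fst s ''out_member'' = fst s' ''out_member'' \<Longrightarrow> fst s ''out_k'' = fst s' ''out_k''
      \<Longrightarrow>
    rows n s = rows n s'"
  by (simp add: rows_def)

lemma label_set_counter: "v \<noteq> ''lab'' \<Longrightarrow> label (set_counter v i s) = label s"
  by (rule label_cong) (simp add: fst_set_counter upd_cell_other)

lemma edge_value_set_counter [simp]: "edge_value (set_counter v i s) = edge_value s"
  by (rule edge_value_cong) simp

lemma rows_set_counter:
  "v \<noteq> ''out_member'' \<Longrightarrow> v \<noteq> ''out_k'' \<Longrightarrow> rows n (set_counter v
      i s) = rows n s"
  by (rule rows_cong) (simp_all add: fst_set_counter upd_cell_other)

section \<open>Correctness of the sweep through the laminar family\<close>

context program_input
begin

lemma emit_prog:
  assumes s: "kept s"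
  shows "rows n (sem inp emit_prog s) = rows n s \<union> cls (label s) ` {..<n}"
  unfolding emit_prog_def
proof (rule sem_For_invariant[where k = n and I = "\<lambda>i s'. rows n s' = rows n s \<union> cls (label
    s) ` {..<i}"], goal_cases)
  case 1
  then show ?case using keptD[OF s] by simp
next
  case (3 i s1)
  let ?F = "For ''u'' ''n'' 0
          (IfElse (NEq (NRead ''lab'' [Var ''u'']) (NRead ''lab'' [Var ''v'']))
            (AssignN ''out_member'' [Var ''out_k'', Var ''u''] (NConst 1))
            (AssignN ''out_member'' [Var ''out_k'', Var ''u''] (NConst 0)))"
  have kept: "kept s1" by (rule kept_frame[OF s], rule 3(3)) auto
  define r where "r = fst s1 ''out_k'' []"
  define s2 where "s2 = set_counter ''v'' i s1"
  have s2: "fst s2 ''n'' [] = n" "fst s2 ''v'' [] = i" "fst s2 ''lab'' = fst s ''lab''"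
    "fst s2 ''out_k'' [] = r" "fst s2 ''out_member'' = fst s1 ''out_member''"
    using keptD[OF kept] 3(3)[of "''lab''"] by (simp_all add: s2_def store_simps upd_cell_other r_def)
  have F: "(\<forall>u<n. fst (sem inp ?F s2) ''out_member'' [r, u] = (if label s u = label s i then 1 else
      0)) \<and>
    (\<forall>q<r. \<forall>u<n. fst (sem inp ?F s2) ''out_member'' [q, u] = fst s1 ''out_member'' [q, u])"
  proof (rule sem_For_invariant[where k = n and
        I = "\<lambda>l s'. (\<forall>u<l. fst s' ''out_member'' [r, u] = (if label s u = label s i then 1
            else 0)) \<and>
          (\<forall>q<r. \<forall>u<n. fst s' ''out_member'' [q, u] = fst s1 ''out_member'' [q, u])"],
              goal_cases)
    case 1
    then show ?case using s2 by simp
  next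
    case 2
    then show ?case using s2 by simp
  next
    case (3 l s')
    have "fst s' ''v'' [] = i" "fst s' ''lab'' = fst s ''lab''" "fst s' ''out_k'' [] = r"
      using 3(3)[of "''v''"] 3(3)[of "''lab''"] 3(3)[of "''out_k''"] s2 by simp_all
    then show ?case using 3(2) by (auto simp: store_simps label_def less_Suc_eq)
  qed (simp add: store_simps)
  have k: "fst (sem inp ?F s2) ''out_k'' [] = r" using s2 by (simp add: sem_frame_nat)
  define s3 where "s3 = sem inp (AssignN ''out_k'' [] (NAdd (Var ''out_k'') (NConst 1))) (sem inp ?F s2)"
  have s3: "fst s3 ''out_k'' [] = Suc r" "fst s3 ''out_member'' = fst (sem inp ?F s2) ''out_member''"
    using k by (simp_all add: s3_def store_simps upd_cell_other)
  have "rows n s3 = insert {u. u < n \<and> fst s3 ''out_member'' [r, u] = 1}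
      ((\<lambda>i. {u. u < n \<and> fst s3 ''out_member'' [i, u] = 1}) ` {..<r})"
    by (simp add: rows_def s3(1) lessThan_Suc)
  also have "{u. u < n \<and> fst s3 ''out_member'' [r, u] = 1} = cls (label s) i"
    using F s3(2) by (auto simp: cls_def split: if_splits)
  also have "(\<lambda>i. {u. u < n \<and> fst s3 ''out_member'' [i, u] = 1}) ` {..<r} = rows n s1"
    unfolding rows_def r_def[symmetric] by (rule image_cong) (use F s3(2) in auto)
  finally show ?case using 3(2) by (simp add: s3_def s2_def lessThan_Suc)
qed (simp_all add: rows_set_counter)

lemma size_prog:
  assumes s: "kept s" "fst s ''i'' [] = i" "i < k"
  shows "fst (sem inp size_prog s) ''size'' [] = card (S i)"
proof -
  define s1 where "s1 = sem inp (AssignN ''size'' [] (NConst 0)) s"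
  have s1: "fst s1 ''size'' [] = 0" "fst s1 ''i'' [] = i"
    using s by (simp_all add: s1_def store_simps)
  have kept1: "kept s1" unfolding s1_def by (rule kept_sem[OF s(1)]) simp
  have "fst (sem inp (For ''v'' ''n'' 0
       (AssignN ''size'' [] (NAdd (Var ''size'') (NRead ''member'' [Var ''i'', Var ''v''])))) s1) ''size''
           [] = card (S i)"
  proof (rule sem_For_invariant[where k = n and I = "\<lambda>l s'. fst s' ''size'' [] = card (S i \<inter>
      {..<l})"], goal_cases)
    case 1
    then show ?case using keptD[OF kept1] by simp
  next
    case 2
    then show ?case using s1 by simp
  next
    case (3 l s')
    have kept: "kept s'" by (rule kept_frame[OF kept1], rule 3(3)) auto
    have i: "fst s' ''i'' [] = i" using 3(3)[of "''i''"] s1 by simp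
    have "S i \<inter> {..<Suc l} = (if l \<in> S i then insert l (S i \<inter> {..<l}) else S i \<inter>
        {..<l})"
      by (auto simp: less_Suc_eq)
    then show ?case using 3(1,2) i keptD[OF kept] s(3) by (simp add: store_simps)
  next
    case (4 s')
    moreover have "S i \<inter> {..<n} = S i" using S[OF s(3)] by blast
    ultimately show ?case by (simp add: store_simps)
  qed
  then show ?thesis by (simp add: size_prog_def s1_def)
qed

text \<open>Only edges inside a set of fewer than \<open>c\<close> vertices carry weight. By laminarity no such edge
  crosses a set with at least \<open>c - 1\<close> vertices, which confines the classes meeting that set to
  it.\<close>

definition stage_inv :: "nat set \<Rightarrow> nat \<Rightarrow> state \<Rightarrow> bool" where
  "stage_inv D c s \<longleftrightarrow> family_inv (edge_value s) (label s) (rows n s) \<and>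
     (\<forall>j<m. 0 < edge_value s j \<longrightarrow> (\<exists>i<k. card (S i) < c \<and> j \<in>
         inside (S i))) \<and>
     (\<forall>i\<in>D. settled (edge_value s) (rows n s) (S i))"

lemma stage_inv_cong:
  "edge_value s = edge_value s' \<Longrightarrow> label s = label s' \<Longrightarrow> rows n s = rows n s'
      \<Longrightarrow> stage_inv D c s = stage_inv D c s'"
  by (simp add: stage_inv_def)

lemma stage_inv_set_counter:
  "v \<notin> {''lab'', ''out_member'', ''out_k''} \<Longrightarrow> stage_inv D c (set_counter v i s) =
      stage_inv D c s"
  by (rule stage_inv_cong) (simp_all add: label_set_counter rows_set_counter)

text \<open>Once all edges inside \<open>S i\<close> have been treated, each is saturated or lies
  within a class, and the classes meeting \<open>S i\<close> do not leave it; so the emitted classes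
  settle it. Edges treated earlier in the loop keep their status, since their values no longer
  change and classes only become coarser.\<close>

lemma set_prog:
  assumes s: "kept s" "fst s ''i'' [] = i" "i < k" and inv: "stage_inv D (Suc (card (S i))) s"
  shows "stage_inv (insert i D) (Suc (card (S i))) (sem inp set_prog s)"
proof -
  let ?c = "Suc (card (S i))"
  let ?B = "When (Conj (NLess (NConst 0) (NRead ''member'' [Var ''i'', NRead ''tail'' [Var ''j'']]))
                   (NLess (NConst 0) (NRead ''member'' [Var ''i'', NRead ''head'' [Var ''j'']])))
          raise_prog"
  define I where "I l s' \<longleftrightarrow> stage_inv D ?c s' \<and>
    (\<forall>j<l. j \<in> inside (S i) \<longrightarrow> edge_value s' j = w j \<or> label s' (tail j) =
        label s' (head j))" for l s'
  define s1 where "s1 = sem inp (For ''j'' ''m'' 0 ?B) s"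
  have kept1: "kept s1" unfolding s1_def by (rule kept_sem[OF s(1)]) (simp add: writes)
  have "I m s1"
    unfolding s1_def
  proof (rule sem_For_invariant[where k = m and I = I], goal_cases)
    case 1
    then show ?case using keptD[OF s(1)] by simp
  next
    case 2
    then show ?case using inv by (simp add: I_def)
  next
    case (3 j s1)
    have kept: "kept s1" by (rule kept_frame[OF s(1)], rule 3(3)) (auto simp: writes)
    define s2 where "s2 = set_counter ''j'' j s1"
    have kept2: "kept s2" using kept_set_counter[OF kept] by (simp add: s2_def)
    have j: "fst s2 ''j'' [] = j" "fst s2 ''i'' [] = i"
      using 3(3)[of "''i''"] s(2) by (simp_all add: s2_def store_simps writes)
    have y2: "edge_value s2 = edge_value s1" "label s2 = label s1" "rows n s2 = rows n s1"
      by (simp_all add: s2_def label_set_counter rows_set_counter)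
    have cond: "bval inp (fst s2) (snd s2) (Conj (NLess (NConst 0) (NRead ''member'' [Var ''i'', NRead
        ''tail'' [Var ''j'']]))
                   (NLess (NConst 0) (NRead ''member'' [Var ''i'', NRead ''head'' [Var ''j'']])))
        \<longleftrightarrow> j \<in> inside (S i)"
      using j keptD[OF kept2] 3(1) s(3) ends by (simp add: inside_def)
    show ?case
    proof (cases "j \<in> inside (S i)")
      case False
      then have "sem inp ?B s2 = s2" unfolding sem.simps(5) cond by simp
      moreover have "I (Suc j) s2"
        using 3(2) False y2 stage_inv_cong[OF y2] by (auto simp: I_def less_Suc_eq)
      ultimately show ?thesis by (simp add: s2_def)
    next
      case True
      define s3 where "s3 = sem inp raise_prog s2"
      have fam: "family_inv (edge_value s1) (label s1) (rows n s1)" using 3(2) by (simp add: I_def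
          stage_inv_def)
      have r: "raised j (edge_value s1) (label s1) (edge_value s3) (label s3)"
        using raise_prog[OF kept2 j(1) 3(1)] fam y2 by (simp add: s3_def family_inv_def)
      have rows3: "rows n s3 = rows n s1"
        using y2(3) rows_cong[of s3 s2] by (simp add: s3_def sem_frame_nat writes)
      have fam3: "family_inv (edge_value s3) (label s3) (rows n s3)"
        using family_inv_raised[OF fam r] rows3 by simp
      have ind: "independent (edge_value s3)" using fam3 by (simp add: family_inv_def)
      have mono: "f < m \<Longrightarrow> edge_value s1 f \<le> edge_value s3 f" for f by (rule
          raised_mono[OF r])
      have other: "edge_value s3 f = edge_value s1 f" if "f < m" "f \<noteq> j" for f
        using r that unfolding raised_def by blast
      have "\<exists>i'<k. card (S i') < ?c \<and> f \<in> inside (S i')" if "f < m" "0 < edge_value s3 f" for f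
      proof (cases "f = j")
        case True
        then show ?thesis using \<open>j \<in> inside (S i)\<close> s(3) by blast
      next
        case False
        then show ?thesis using 3(2) other that by (simp add: I_def stage_inv_def)
      qed
      moreover have "settled (edge_value s3) (rows n s3) (S i')" if "i' \<in> D" for i'
        using settled_mono[OF _ _ mono ind, of "rows n s1"] 3(2) that rows3
        by (simp add: I_def stage_inv_def)
      moreover have "edge_value s3 f = w f \<or> label s3 (tail f) = label s3 (head f)" if f: "f < Suc j"
          "f \<in> inside (S i)" for f
      proof (cases "f = j")
        case True
        then show ?thesis using r unfolding raised_def by blast
      next
        case False
        then have "edge_value s1 f = w f \<or> label s1 (tail f) = label s1 (head f)"
          using 3(2) f by (simp add: I_def)
        moreover have fm: "f < m" using f by (simp add: inside_def)
        moreover have "label s1 (tail f) = label s1 (head f) \<Longrightarrow> label s3 (tail f) = label s3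
            (head f)"
          using r ends(1,2)[OF fm] unfolding raised_def by blast
        ultimately show ?thesis using other[OF fm False] by metis
      qed
      ultimately have "I (Suc j) s3" using fam3 by (simp add: I_def stage_inv_def)
      moreover have "sem inp ?B s2 = s3" unfolding sem.simps(5) cond using True by (simp add: s3_def)
      ultimately show ?thesis by (simp add: s2_def)
    qed
  next
    case (4 s')
    then show ?case by (simp add: I_def stage_inv_set_counter label_set_counter)
  qed
  then have I: "I m s1" .
  define s2 where "s2 = sem inp emit_prog s1"
  have s2: "edge_value s2 = edge_value s1" "label s2 = label s1"
    by (rule edge_value_cong label_cong; simp add: s2_def sem_frame_nat sem_frame_real writes')+
  have rows2: "rows n s2 = rows n s1 \<union> cls (label s1) ` {..<n}"
    using emit_prog[OF kept1] by (simp add: s2_def)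
  have fam: "family_inv (edge_value s1) (label s1) (rows n s1)" using I by (simp add: I_def stage_inv_def)
  have ind: "independent (edge_value s1)" using fam by (simp add: family_inv_def)
  \<comment> \<open>A weighted edge lies inside some \<open>S i'\<close> that is no larger than
    \<open>S i\<close>. By laminarity this set is disjoint from \<open>S i\<close>, contained in it
    or equal to it, so the edge does not cross the boundary of \<open>S i\<close>.\<close>
  have sep: "tail j \<in> S i \<longleftrightarrow> head j \<in> S i" if "j < m" "0 < edge_value s1 j" for j
  proof -
    obtain i' where i': "i' < k" "card (S i') < ?c" "j \<in> inside (S i')"
      using I \<open>j < m\<close> \<open>0 < edge_value s1 j\<close> unfolding I_def stage_inv_def by blast
    have fin: "finite (S i')" using S[OF i'(1)] finite_subset by blast
    consider "S i' \<inter> S i = {}" | "S i' \<subseteq> S i" | "S i \<subseteq> S i'" using S_laminar[OF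
        i'(1) s(3)] by blast
    then show ?thesis
    proof cases
      case 3
      then have "S i = S i'" using card_seteq[OF fin 3] i'(2) by simp
      then show ?thesis using i'(3) by (simp add: inside_def)
    qed (use i'(3) in \<open>auto simp: inside_def\<close>)
  qed
  have "settled (edge_value s1) (rows n s2) (S i)"
    unfolding rows2
  proof (rule settled_classes[OF fam S[OF s(3)] sep])
    fix j assume "j \<in> inside (S i)"
    then show "edge_value s1 j = w j \<or> label s1 (tail j) = label s1 (head j)"
      using I by (simp add: I_def inside_def)
  qed
  moreover have "settled (edge_value s1) (rows n s2) (S i')" if "i' \<in> D" for i'
    using settled_mono[of "edge_value s1" "rows n s1" "S i'" "rows n s2" "edge_value s1"] I that rows2 ind
    by (simp add: I_def stage_inv_def)
  moreover have "family_inv (edge_value s1) (label s1) (rows n s2)"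
    using family_inv_add[OF fam] rows2 by simp
  ultimately have "stage_inv (insert i D) ?c s2"
    using I s2 by (simp add: I_def stage_inv_def)
  then show ?thesis by (simp add: set_prog_def s1_def s2_def)
qed

text \<open>Within round \<open>c\<close>, the settled sets are those of size below \<open>c\<close>
  and, among those of size \<open>c\<close>, the ones already visited. No set has more than
  \<open>n\<close> elements, so the rounds 0 to \<open>n\<close> settle all of them.\<close>

lemma sweep_prog:
  assumes s: "kept s" and inv: "stage_inv {} 0 s"
  shows "stage_inv {..<k} (Suc n) (sem inp sweep_prog s)"
proof -
  have le: "card (S i) < Suc n" if "i < k" for i
    using card_mono[OF _ S[OF that]] by simp
  have "stage_inv {i. i < k \<and> card (S i) < Suc n} (Suc n) (sem inp sweep_prog s)"
    unfolding sweep_prog_def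
  proof (rule sem_For_invariant[where k = "Suc n" and I = "\<lambda>c. stage_inv {i. i < k \<and> card (S
      i) < c} c"], goal_cases)
    case 1
    then show ?case using keptD[OF s] by simp
  next
    case 2
    then show ?case using inv by simp
  next
    case (3 c s1)
    have kept: "kept s1" by (rule kept_frame[OF s], rule 3(3)) (auto simp: writes')
    define s2 where "s2 = set_counter ''s'' c s1"
    have kept2: "kept s2" using kept_set_counter[OF kept] by (simp add: s2_def)
    have c2: "fst s2 ''s'' [] = c" by (simp add: s2_def store_simps)
    let ?D = "\<lambda>l. {i. i < k \<and> card (S i) < c} \<union> {i. i < l \<and> card (S i) = c}"
    have "stage_inv (?D k) (Suc c) (sem inp (For ''i'' ''k'' 0 (size_prog ;; When (NEq (Var ''size'') (Var
        ''s'')) set_prog)) s2)"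
    proof (rule sem_For_invariant[where k = k and I = "\<lambda>l. stage_inv (?D l) (Suc c)"], goal_cases)
      case 1
      then show ?case using keptD[OF kept2] by simp
    next
      case 2
      have "stage_inv {i. i < k \<and> card (S i) < c} c s2" using 3(2) by (simp add: s2_def
          stage_inv_set_counter)
      \<comment> \<open>Passing from \<open>c\<close> to \<open>Suc c\<close> only weakens the
        condition on the weighted edges.\<close>
      then show ?case unfolding stage_inv_def by (auto, meson less_SucI)
    next
      case i: (3 l s3)
      have kept3: "kept s3" by (rule kept_frame[OF kept2], rule i(3)) (auto simp: writes')
      define s4 where "s4 = sem inp size_prog (set_counter ''i'' l s3)"
      have kept4: "kept (set_counter ''i'' l s3)" using kept_set_counter[OF kept3] by simp
      have size: "fst s4 ''size'' [] = card (S l)"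
        using size_prog[OF kept4 _ i(1)] by (simp add: s4_def store_simps)
      have kept5: "kept s4" unfolding s4_def by (rule kept_sem[OF kept4]) (simp add: writes')
      have s4: "fst s4 ''s'' [] = c" "fst s4 ''i'' [] = l"
        using i(3)[of "''s''"] c2 by (simp_all add: s4_def sem_frame_nat writes' store_simps)
      have inv4: "stage_inv (?D l) (Suc c) s4"
      proof -
        have "stage_inv (?D l) (Suc c) s4 = stage_inv (?D l) (Suc c) (set_counter ''i'' l s3)"
          by (rule stage_inv_cong; rule edge_value_cong label_cong rows_cong)
            (simp_all add: s4_def sem_frame_nat sem_frame_real writes')
        then show ?thesis using i(2) by (simp add: stage_inv_set_counter)
      qed
      show ?case
      proof (cases "card (S l) = c")
        case True
        have "?D (Suc l) = insert l (?D l)" using True by (auto simp: less_Suc_eq)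
        moreover have "stage_inv (insert l (?D l)) (Suc c) (sem inp set_prog s4)"
          using set_prog[OF kept5 s4(2) i(1)] inv4 True by blast
        moreover have "sem inp (size_prog ;; When (NEq (Var ''size'') (Var ''s'')) set_prog) (set_counter
            ''i'' l s3)
            = sem inp set_prog s4"
          using True size s4 by (simp add: s4_def[symmetric])
        ultimately show ?thesis by simp
      next
        case False
        have "?D (Suc l) = ?D l" using False by (auto simp: less_Suc_eq)
        moreover have "sem inp (size_prog ;; When (NEq (Var ''size'') (Var ''s'')) set_prog) (set_counter
            ''i'' l s3) = s4"
          using False size s4 by (simp add: s4_def[symmetric])
        ultimately show ?thesis using inv4 by simp
      qed
    next
      case (4 s')
      then show ?case by (simp add: stage_inv_set_counter)
    qed
    moreover have "?D k = {i. i < k \<and> card (S i) < Suc c}" by auto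
    ultimately show ?case by (simp add: s2_def)
  next
    case (4 s')
    then show ?case by (simp add: stage_inv_set_counter)
  qed
  moreover have "{i. i < k \<and> card (S i) < Suc n} = {..<k}" using le by auto
  ultimately show ?thesis by simp
qed

text \<open>At the start all values are 0 and the classes are singletons, which are tight since
  \<open>0 = 1 - 1\<close>; no edge carries weight and no set is claimed to be settled.\<close>

lemma thin_prog:
  assumes s: "kept s"
  shows "stage_inv {..<k} (Suc n) (sem inp thin_prog s)"
proof -
  define s1 where "s1 = sem inp (For ''j'' ''m'' 0 (AssignR ''out_x'' [Var ''j''] (RConst 0))) s"
  define s2 where "s2 = sem inp (For ''v'' ''n'' 0 (AssignN ''lab'' [Var ''v''] (Var ''v''))) s1"
  define s3 where "s3 = sem inp (AssignN ''out_k'' [] (NConst 0)) s2"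
  have kept1: "kept s1" unfolding s1_def by (rule kept_sem[OF s]) simp
  have kept2: "kept s2" unfolding s2_def by (rule kept_sem[OF kept1]) simp
  have kept3: "kept s3" unfolding s3_def by (rule kept_sem[OF kept2]) simp
  have y1: "\<forall>j<m. edge_value s1 j = 0"
    unfolding s1_def
    by (rule sem_For_invariant[where k = m and I = "\<lambda>l s'. \<forall>j<l. edge_value s' j = 0"])
      (use keptD[OF s] in \<open>auto simp: edge_value_def store_simps less_Suc_eq\<close>)
  have "edge_value s3 = edge_value s1" by (rule edge_value_cong) (simp add: s3_def s2_def sem_frame_real)
  then have y3: "edge_value s3 j = 0" if "j < m" for j using y1 that by simp
  have "\<forall>v<n. label s2 v = v"
    unfolding s2_def
    by (rule sem_For_invariant[where k = n and I = "\<lambda>l s'. \<forall>v<l. label s' v = v"])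
      (use keptD[OF kept1] in \<open>auto simp: label_def store_simps less_Suc_eq\<close>)
  moreover have "label s3 = label s2" by (rule label_cong) (simp add: s3_def upd_cell_other)
  ultimately have "cls (label s3) v = {v}" if "v < n" for v using that by (auto simp: cls_def)
  moreover have sum0: "sum (edge_value s3) (inside U) = 0" for U
    by (rule sum.neutral) (use y3 in \<open>auto simp: inside_def\<close>)
  moreover have "independent (edge_value s3)"
  proof -
    have "1 \<le> real (card U)" if "U \<subseteq> {..<n}" "U \<noteq> {}" for U
      using that finite_subset[OF that(1)] by (simp add: Suc_le_eq card_gt_0_iff)
    then show ?thesis using y3 w_nonneg sum0 by (auto simp: independent_def)
  qed
  moreover have "rows n s3 = {}" by (simp add: rows_def s3_def store_simps)
  ultimately have "stage_inv {} 0 s3"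
    using y3 by (auto simp: stage_inv_def family_inv_def tight_def laminar_def)
  then show ?thesis using sweep_prog[OF kept3] by (simp add: thin_prog_def s1_def s2_def s3_def)
qed

end

section \<open>Translation between positions and named vertices and edges\<close>

locale listed_graph =
  fixes G :: "('v, 'e) ugraph" and vs :: "'v list" and es :: "'e list" and tail head :: "nat \<Rightarrow> nat"
    and w :: "nat \<Rightarrow> real"
  assumes G: "undirected_graph G"
    and vs: "distinct vs" "set vs = verts G" and es: "distinct es" "set es = edges G"
    and ends_nth: "\<And>j. j < length es \<Longrightarrow> tail j < length vs \<and> head j < length vs \<and>
        ends G (es ! j) = {vs ! tail j, vs ! head j}"
    and w: "\<And>j. j < length es \<Longrightarrow> 0 \<le> w j"
begin

sublocale capacitated_graph "length vs" "length es" tail head w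
proof
  fix j assume j: "j < length es"
  then show "tail j < length vs" "head j < length vs" "0 \<le> w j" using ends_nth w by auto
  have "card (ends G (es ! j)) = 2" using G es j by (auto simp: undirected_graph_def)
  then show "tail j \<noteq> head j" using ends_nth[OF j] by (cases "tail j = head j") auto
qed

definition named :: "nat set \<Rightarrow> 'v set" where
  "named A = (!) vs ` A"

definition positions :: "'v set \<Rightarrow> nat set" where
  "positions W = {v. v < length vs \<and> vs ! v \<in> W}"

text \<open>On edges the description is unique because \<open>es\<close> is distinct.\<close>

definition by_name :: "(nat \<Rightarrow> real) \<Rightarrow> 'e \<Rightarrow> real" where
  "by_name y e = y (THE j. j < length es \<and> es ! j = e)"

lemma by_name_nth: "j < length es \<Longrightarrow> by_name y (es ! j) = y j"
proof -
  assume j: "j < length es"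
  then have "(THE i. i < length es \<and> es ! i = es ! j) = j"
    using es(1) by (intro the_equality) (auto simp: nth_eq_iff_index_eq)
  then show ?thesis by (simp add: by_name_def)
qed

lemma inj_nth: "inj_on ((!) vs) {..<length vs}"
  using vs(1) by (auto simp: inj_on_def nth_eq_iff_index_eq)

lemma named_positions: "W \<subseteq> verts G \<Longrightarrow> named (positions W) = W"
  using vs(2) by (force simp: named_def positions_def in_set_conv_nth)

lemma positions_named: "A \<subseteq> {..<length vs} \<Longrightarrow> positions (named A) = A"
  using vs(1) by (auto simp: named_def positions_def nth_eq_iff_index_eq subset_iff)

lemma positions_subset: "positions W \<subseteq> {..<length vs}"
  by (auto simp: positions_def)

lemma named_subset: "A \<subseteq> {..<length vs} \<Longrightarrow> named A \<subseteq> verts G"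
  using vs(2) nth_mem[of _ vs] by (auto simp: named_def)

lemma named_Int:
  "A \<subseteq> {..<length vs} \<Longrightarrow> B \<subseteq> {..<length vs} \<Longrightarrow> named (A
      \<inter> B) = named A \<inter> named B"
  unfolding named_def by (rule inj_on_image_Int[OF inj_nth])

lemma card_positions: "W \<subseteq> verts G \<Longrightarrow> card (positions W) = card W"
  using card_image[OF inj_on_subset[OF inj_nth positions_subset]] named_positions
  by (metis named_def)

lemma nth_in_inner: "j < length es \<Longrightarrow> es ! j \<in> inner_edges G W \<longleftrightarrow> j
    \<in> inside (positions W)"
  using ends_nth[of j] es(2) nth_mem[of j es] by (auto simp: inner_edges_def inside_def positions_def)

lemma inner_edges_eq: "inner_edges G W = (!) es ` inside (positions W)"
proof (intro equalityI subsetI)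
  fix e assume e: "e \<in> inner_edges G W"
  then have "e \<in> set es" using es(2) by (simp add: inner_edges_def)
  then obtain j where "j < length es" "e = es ! j" by (metis in_set_conv_nth)
  then show "e \<in> (!) es ` inside (positions W)" using e nth_in_inner by blast
next
  fix e assume "e \<in> (!) es ` inside (positions W)"
  then show "e \<in> inner_edges G W" using nth_in_inner by (auto simp: inside_def)
qed

lemma sum_by_name: "sum (by_name y) (inner_edges G W) = sum y (inside (positions W))"
proof -
  have "inj_on ((!) es) (inside (positions W))"
    using es(1) by (auto simp: inj_on_def inside_def nth_eq_iff_index_eq)
  then have "sum (by_name y) (inner_edges G W) = (\<Sum>j\<in>inside (positions W). by_name y (es ! j))"
    by (simp add: inner_edges_eq sum.reindex)
  also have "\<dots> = sum y (inside (positions W))"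
    by (rule sum.cong) (simp_all add: by_name_nth inside_def)
  finally show ?thesis .
qed

lemma sum_inner_le:
  assumes "independent y" "W \<subseteq> verts G" "W \<noteq> {}"
  shows "sum (by_name y) (inner_edges G W) \<le> real (card W) - 1"
proof -
  have "positions W \<noteq> {}" using assms named_positions[of W] by (auto simp: named_def)
  then show ?thesis
    using independentD[OF assms(1) positions_subset, of W] card_positions[OF assms(2)]
    by (simp add: sum_by_name)
qed

lemma sum_inner_tight:
  assumes "tight y A"
  shows "sum (by_name y) (inner_edges G (named A)) = real (card (named A)) - 1"
    and "named A \<subseteq> verts G" "named A \<noteq> {}"
proof -
  have A: "A \<subseteq> {..<length vs}" "A \<noteq> {}" using assms by (auto simp: tight_def)
  show sub: "named A \<subseteq> verts G" by (rule named_subset[OF A(1)])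
  show "sum (by_name y) (inner_edges G (named A)) = real (card (named A)) - 1"
    using assms card_positions[OF sub] by (simp add: sum_by_name positions_named[OF A(1)] tight_def)
  show "named A \<noteq> {}" using A(2) by (simp add: named_def)
qed

text \<open>The blocks that settle a set become, after renaming, the blocks of the cut estimate;
  \<open>wx\<close> turns saturation into \<open>y = \<eta> x\<close>.\<close>

lemma settled_tight_partition:
  assumes y: "independent y" and F: "\<And>A. A \<in> F \<Longrightarrow> tight y A"
    and W: "W \<subseteq> verts G" and settled: "settled y F (positions W)"
    and x: "x \<in> spanning_tree_polytope G" and \<eta>: "2 < \<eta>"
    and wx: "\<And>j. j < length es \<Longrightarrow> w j = \<eta> * x (es ! j)"
  shows "\<exists>P \<subseteq> named ` F. tight_partition G W P x (by_name y) \<eta>"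
proof -
  obtain P where P: "P \<subseteq> F" "\<Union>P = positions W" "\<forall>A\<in>P. \<forall>B\<in>P. A
      \<noteq> B \<longrightarrow> A \<inter> B = {}"
    "\<forall>j\<in>inside (positions W). (\<exists>A\<in>P. j \<in> inside A) \<or> y j = w j"
    using settled unfolding settled_def by (elim exE conjE) (rule that)
  have sub: "A \<subseteq> {..<length vs}" if "A \<in> P" for A
    using F[OF subsetD[OF P(1) that]] by (simp add: tight_def)
  have "tight_partition G W (named ` P) x (by_name y) \<eta>"
  proof
    have "named (\<Union>P) = \<Union>(named ` P)" by (auto simp: named_def)
    then show "\<Union>(named ` P) = W" using P(2) named_positions[OF W] by simp
    fix A assume "A \<in> named ` P"
    then obtain A0 where A0: "A0 \<in> P" "A = named A0" by blast
    have t: "tight y A0" using A0 P(1) F by blast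
    show "A \<noteq> {}" "sum (by_name y) (inner_edges G A) = real (card A) - 1"
      using sum_inner_tight[OF t] A0 by auto
    fix B assume "B \<in> named ` P" "A \<noteq> B"
    then obtain B0 where B0: "B0 \<in> P" "B = named B0" "A0 \<noteq> B0" using A0 by blast
    then have "A0 \<inter> B0 = {}" using P(3) A0 by blast
    then show "A \<inter> B = {}"
      using named_Int[OF sub[OF A0(1)] sub[OF B0(1)]] A0(2) B0(2) by (simp add: named_def)
  next
    show "sum (by_name y) (inner_edges G W) \<le> real (card W) - 1" if "W \<noteq> {}"
      by (rule sum_inner_le[OF y W that])
  next
    fix e assume "e \<in> edges G"
    then obtain j where j: "j < length es" "e = es ! j" using es(2) by (metis in_set_conv_nth)
    then show "by_name y e \<le> \<eta> * x e" using y wx by (simp add: by_name_nth independent_def)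
  next
    fix e assume "e \<in> inner_edges G W"
    then obtain j where j: "j \<in> inside (positions W)" "e = es ! j" by (auto simp: inner_edges_eq)
    then have jm: "j < length es" by (simp add: inside_def)
    consider A where "A \<in> P" "j \<in> inside A" | "y j = w j" using P(4) j(1) by blast
    then show "(\<exists>A\<in>named ` P. e \<in> inner_edges G A) \<or> by_name y e = \<eta> * x e"
    proof cases
      case 1
      then have "e \<in> inner_edges G (named A)"
        using nth_in_inner[OF jm] positions_named[OF sub[OF 1(1)]] j(2) by simp
      then show ?thesis using 1(1) by blast
    next
      case 2
      then show ?thesis using j(2) wx[OF jm] by (simp add: by_name_nth[OF jm])
    qed
  qed (fact G x \<eta> W)+
  moreover have "named ` P \<subseteq> named ` F" using P(1) by (rule image_mono)
  ultimately show ?thesis by (intro exI[of _ "named ` P"] conjI)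
qed

lemma laminar_named:
  assumes "laminar F" "\<And>A. A \<in> F \<Longrightarrow> A \<subseteq> {..<length vs}"
  shows "laminar (named ` F)"
  unfolding laminar_def
proof (intro ballI)
  fix X Y assume "X \<in> named ` F" "Y \<in> named ` F"
  then obtain A B where AB: "A \<in> F" "B \<in> F" "X = named A" "Y = named B" by blast
  have "A \<inter> B \<in> {{}, A, B}" using assms(1) AB unfolding laminar_def by blast
  then have "named (A \<inter> B) \<in> {{}, X, Y}" using AB by (auto simp: named_def)
  then show "X \<inter> Y \<in> {{}, X, Y}" using named_Int[OF assms(2)[OF AB(1)] assms(2)[OF AB(2)]] AB by simp
qed

end

section \<open>Properties of the output and the running time\<close>

lemma polytope_induced:
  assumes A: "A \<subseteq> verts G"
    and y: "\<And>e. e \<in> edges G \<Longrightarrow> 0 \<le> y e"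
    and ub: "\<And>U. U \<subseteq> verts G \<Longrightarrow> U \<noteq> {} \<Longrightarrow> sum y
        (inner_edges G U) \<le> real (card U) - 1"
    and tight: "sum y (inner_edges G A) = real (card A) - 1"
  shows "y \<in> spanning_tree_polytope (induced G A)"
proof -
  \<comment> \<open>Inside \<open>A\<close> the induced graph has the same inner edges as
    \<open>G\<close>, so the forest bounds carry over, and tightness of \<open>A\<close> supplies
    the equation.\<close>
  have "inner_edges (induced G A) U = inner_edges G U" if "U \<subseteq> A" for U
    using that by (auto simp: inner_edges_def induced_def)
  moreover have "e \<in> edges G" if "e \<in> inner_edges G A" for e using that by (simp add: inner_edges_def)
  moreover have "sum y (inner_edges G U) \<le> real (card U) - 1" if "U \<subseteq> A" "U \<noteq> {}" for U
    using ub[of U] A that by blast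
  ultimately show ?thesis
    using y tight by (simp add: spanning_tree_polytope_def induced_def)
qed

text \<open>The new family consists of the emitted rows with positions replaced by vertices. The
  partition of the whole vertex set puts the point into the polytope, tightness of the members gives
  alignment, and the partitions of the other sets give the cut bounds.\<close>

lemma thin_prog_correct:
  fixes G :: "('v, 'e) ugraph" and x :: "'e \<Rightarrow> real" and R :: "real store"
  assumes inst: "laminar_instance G c L b x" and \<eta>: "2 < \<eta>"
    and enc: "encodes_input G L x \<eta> vs es Ls inp N"
  defines "s' \<equiv> sem inp thin_prog (N, R)"
  shows "\<exists>L' x'. encodes_output vs es (fst s') (snd s') L' x' \<and>
          L' \<subseteq> Pow (verts G) \<and> laminar L' \<and>
          x' \<in> spanning_tree_polytope G \<and>
          aligned G L' x' \<and>
          (\<forall>e\<in>edges G. \<eta> * x e - x' e \<ge> 0) \<and>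
          (\<forall>T \<alpha> \<beta>. spanning_tree G T \<and> \<alpha> \<ge> 0 \<and> \<beta> \<ge> 0 \<and>
             (\<forall>S\<in>L'. real (card (T \<inter> cut_edges G S)) \<le> \<alpha> * sum x' (cut_edges
                 G S) + \<beta>) \<longrightarrow>
             (\<forall>S\<in>L. real (card (T \<inter> cut_edges G S))
                \<le> 1 / (1 - 2 / \<eta>) * (\<eta> * \<alpha> + \<beta>) * sum x (cut_edges G S)))"
proof -
  have G: "undirected_graph G" and x: "x \<in> spanning_tree_polytope G" and L: "L \<subseteq> Pow (verts G)"
    and lam: "laminar L" and V: "verts G \<in> L" and Vne: "verts G \<noteq> {}"
    using inst by (auto simp: laminar_instance_def connected_graph_def)
  have e_lists: "distinct vs" "set vs = verts G" "distinct es" "set es = edges G" "set Ls = L"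
    and e_sizes: "N ''n'' [] = length vs" "N ''m'' [] = length es" "N ''k'' [] = length Ls"
    and e_ends: "\<And>j. j < length es \<Longrightarrow> N ''tail'' [j] < length vs \<and> N ''head'' [j]
        < length vs \<and>
        ends G (es ! j) = {vs ! N ''tail'' [j], vs ! N ''head'' [j]}"
    and e_mem: "\<And>i v. i < length Ls \<Longrightarrow> v < length vs \<Longrightarrow> N ''member'' [i,
        v] = (if vs ! v \<in> Ls ! i then 1 else 0)"
    and e_inp: "\<And>j. j < length es \<Longrightarrow> inp ''x'' [j] = x (es ! j)" "inp ''eta'' [] = \<eta>"
    using enc by (simp_all add: encodes_input_def)
  define tail head w where "tail j = N ''tail'' [j]" and "head j = N ''head'' [j]"
    and "w j = \<eta> * x (es ! j)" for j
  have x_nonneg: "0 \<le> x e" if "e \<in> edges G" for e using x that by (simp add: spanning_tree_polytope_def)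
  have w_nonneg: "0 \<le> w j" if "j < length es" for j
    using x_nonneg[of "es ! j"] nth_mem[OF that] e_lists(4) \<eta> by (simp add: w_def)
  interpret listed_graph G vs es tail head w
    by unfold_locales (use G e_lists e_ends w_nonneg in \<open>auto simp: tail_def head_def\<close>)
  let ?S = "\<lambda>i. positions (Ls ! i)"
  interpret program_input "length vs" "length es" tail head w "length Ls" ?S inp N
  proof unfold_locales
    fix i i' assume i: "i < length Ls" "i' < length Ls"
    have "Ls ! i \<inter> Ls ! i' \<in> {{}, Ls ! i, Ls ! i'}"
      using lam i e_lists(5) nth_mem unfolding laminar_def by blast
    moreover have "?S i \<inter> ?S i' = positions (Ls ! i \<inter> Ls ! i')" by (auto simp: positions_def)
    ultimately show "?S i \<inter> ?S i' \<in> {{}, ?S i, ?S i'}" by (auto simp: positions_def)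
  qed (use e_sizes e_mem e_inp in \<open>auto simp: tail_def head_def w_def positions_def\<close>)
  have inv: "stage_inv {..<length Ls} (Suc (length vs)) s'"
    unfolding s'_def by (rule thin_prog) (simp add: kept_def)
  define F where "F = rows (length vs) s'"
  define y where "y = edge_value s'"
  define x' where "x' = by_name y"
  have fam: "family_inv y (label s') F" using inv by (simp add: stage_inv_def y_def F_def)
  then have ind: "independent y" and tight: "\<And>A. A \<in> F \<Longrightarrow> tight y A" and lamF:
      "laminar F"
    by (auto simp: family_inv_def)
  have part: "\<exists>P \<subseteq> named ` F. tight_partition G W P x x' \<eta>" if W: "W \<in> L" for W
  proof -
    obtain i where i: "i < length Ls" "W = Ls ! i" using W unfolding e_lists(5)[symmetric] in_set_conv_nth
        by blast
    then have "settled y F (positions W)" using inv by (simp add: stage_inv_def y_def F_def)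
    then show ?thesis unfolding x'_def
      using settled_tight_partition[OF ind tight _ _ x \<eta>, of F W] L W by (auto simp: w_def)
  qed
  have x'_bounds: "0 \<le> x' e \<and> x' e \<le> \<eta> * x e" if e: "e \<in> edges G" for e
  proof -
    obtain j where "j < length es" "e = es ! j" using e unfolding e_lists(4)[symmetric] in_set_conv_nth by blast
    then show ?thesis using ind by (simp add: x'_def by_name_nth independent_def w_def)
  qed
  have ub: "sum x' (inner_edges G U) \<le> real (card U) - 1" if "U \<subseteq> verts G" "U \<noteq> {}" for U
    unfolding x'_def by (rule sum_inner_le[OF ind that])
  \<comment> \<open>Here \<open>verts G \<in> L\<close> matters: the whole vertex set has been
    settled too, which forces full weight on \<open>x'\<close>.\<close>
  obtain PV where "tight_partition G (verts G) PV x x' \<eta>" using part[OF V] by blast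
  then have "sum x' (edges G) = real (card (verts G)) - 1"
    using tight_partition.tight_verts Vne by blast
  then have x'_poly: "x' \<in> spanning_tree_polytope G"
    using x'_bounds ub by (simp add: spanning_tree_polytope_def)
  have al: "aligned G (named ` F) x'"
    unfolding aligned_def
  proof
    fix A assume "A \<in> named ` F"
    then obtain A0 where A0: "A0 \<in> F" "A = named A0" by blast
    show "x' \<in> spanning_tree_polytope (induced G A)"
      using sum_inner_tight[OF tight[OF A0(1)]] x'_bounds ub A0(2)
      by (intro polytope_induced) (auto simp: x'_def)
  qed
  have sub: "named ` F \<subseteq> Pow (verts G)"
    using sum_inner_tight(2)[OF tight] by blast
  have lam': "laminar (named ` F)"
    by (rule laminar_named[OF lamF]) (use tight in \<open>auto simp: tight_def\<close>)
  have out: "encodes_output vs es (fst s') (snd s') (named ` F) x'"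
  proof -
    have "named {u. u < length vs \<and> fst s' ''out_member'' [i, u] = 1} =
        {vs ! v |v. v < length vs \<and> fst s' ''out_member'' [i, v] = 1}" for i
      by (auto simp: named_def)
    then have "named ` F = {{vs ! v |v. v < length vs \<and> fst s' ''out_member'' [i, v] = 1} |i. i < fst
        s' ''out_k'' []}"
      by (auto simp: F_def rows_def)
    then show ?thesis by (simp add: encodes_output_def x'_def y_def by_name_nth edge_value_def)
  qed
  have cut: "real (card (T \<inter> cut_edges G W)) \<le> 1 / (1 - 2 / \<eta>) * (\<eta> * \<alpha> +
      \<beta>) * sum x (cut_edges G W)"
    if T: "spanning_tree G T" and ab: "0 \<le> \<alpha>" "0 \<le> \<beta>" and W: "W \<in> L"
      and thin: "\<forall>S\<in>named ` F. real (card (T \<inter> cut_edges G S)) \<le> \<alpha> * sum x'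
          (cut_edges G S) + \<beta>"
    for T \<alpha> \<beta> W
  proof (cases "W = verts G")
    case True
    have "ends G e \<inter> verts G = ends G e" if "e \<in> edges G" for e
      using G that by (auto simp: undirected_graph_def)
    \<comment> \<open>No edge leaves the whole vertex set, so both sides of the bound
      vanish.\<close>
    then have "cut_edges G W = {}" using G True by (auto simp: cut_edges_def undirected_graph_def)
    then show ?thesis by simp
  next
    case False
    obtain P where P: "P \<subseteq> named ` F" "tight_partition G W P x x' \<eta>" using part[OF W] by blast
    have "T \<subseteq> edges G" using T by (simp add: spanning_tree_def)
    then show ?thesis
      by (rule tight_partition.thin_cut[OF P(2) False _ ab]) (rule bspec[OF thin subsetD[OF P(1)]])
  qed
  have dom: "\<eta> * x e - x' e \<ge> 0" if "e \<in> edges G" for e using x'_bounds[OF that] by simp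
  show ?thesis
    by (intro exI[of _ "named ` F"] exI[of _ x'] conjI allI ballI impI out sub lam' x'_poly al dom)
      (assumption, elim conjE, rule cut)
qed

theorem mainTheorem4:
  "\<exists>(prog :: com) (p :: nat poly).
     \<forall>(G :: ('v, 'e) ugraph) (c :: 'e \<Rightarrow> real) (L :: 'v set set) (b :: 'v set
         \<Rightarrow> nat)
       (x :: 'e \<Rightarrow> real) (\<eta> :: real)
       (vs :: 'v list) (es :: 'e list) (Ls :: 'v set list)
       (inp :: real store) (N :: nat store) (R :: real store).
       laminar_instance G c L b x \<and> \<eta> > 2 \<and> encodes_input G L x \<eta> vs es Ls inp N
           \<longrightarrow>
       (\<exists>t N' R' L' x'.
          exec inp prog (N, R) t (N', R') \<and>
          t \<le> poly p (card (verts G) + card (edges G) + card L) \<and>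
          encodes_output vs es N' R' L' x' \<and>
          L' \<subseteq> Pow (verts G) \<and> laminar L' \<and>
          x' \<in> spanning_tree_polytope G \<and>
          aligned G L' x' \<and>
          (\<forall>e\<in>edges G. \<eta> * x e - x' e \<ge> 0) \<and>
          (\<forall>T \<alpha> \<beta>. spanning_tree G T \<and> \<alpha> \<ge> 0 \<and> \<beta> \<ge> 0 \<and>
             (\<forall>S\<in>L'. real (card (T \<inter> cut_edges G S)) \<le> \<alpha> * sum x' (cut_edges
                 G S) + \<beta>) \<longrightarrow>
             (\<forall>S\<in>L. real (card (T \<inter> cut_edges G S))
                \<le> 1 / (1 - 2 / \<eta>) * (\<eta> * \<alpha> + \<beta>) * sum x (cut_edges G S))))"
proof (rule exI[of _ "compile thin_prog"], rule exI[of _ "cost thin_prog"], intro allI impI, elim conjE)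
  fix G :: "('v, 'e) ugraph" and c :: "'e \<Rightarrow> real" and L b x \<eta> vs es Ls
    and inp :: "real store" and N and R :: "real store"
  assume inst: "laminar_instance G c L b x" and \<eta>: "2 < \<eta>"
    and enc: "encodes_input G L x \<eta> vs es Ls inp N"
  \<comment> \<open>The sum of the three sizes bounds each of them, so it can serve as the argument
    of the cost polynomial.\<close>
  have "fst (N, R) a [] \<le> card (verts G) + card (edges G) + card L" if "a \<in> {''n'', ''m'', ''k''}" for a
    using enc that unfolding encodes_input_def
    by (metis (no_types, lifting) distinct_card empty_iff fst_conv insert_iff le_add1 le_add2 trans_le_add1)
  then obtain t where t: "exec inp (compile thin_prog) (N, R) t (sem inp thin_prog (N, R))"
    "t \<le> poly (cost thin_prog) (card (verts G) + card (edges G) + card L)"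
    using exec_compile[OF well_formed_thin_prog, of "(N, R)"] by blast
  then have "exec inp (compile thin_prog) (N, R) t
      (fst (sem inp thin_prog (N, R)), snd (sem inp thin_prog (N, R)))" by simp
  with t(2) show "\<exists>t N' R' L' x'.
          exec inp (compile thin_prog) (N, R) t (N', R') \<and>
          t \<le> poly (cost thin_prog) (card (verts G) + card (edges G) + card L) \<and>
          encodes_output vs es N' R' L' x' \<and>
          L' \<subseteq> Pow (verts G) \<and> laminar L' \<and>
          x' \<in> spanning_tree_polytope G \<and>
          aligned G L' x' \<and>
          (\<forall>e\<in>edges G. \<eta> * x e - x' e \<ge> 0) \<and>
          (\<forall>T \<alpha> \<beta>. spanning_tree G T \<and> \<alpha> \<ge> 0 \<and> \<beta> \<ge> 0 \<and>
             (\<forall>S\<in>L'. real (card (T \<inter> cut_edges G S)) \<le> \<alpha> * sum x' (cut_edges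
                 G S) + \<beta>) \<longrightarrow>
             (\<forall>S\<in>L. real (card (T \<inter> cut_edges G S))
                \<le> 1 / (1 - 2 / \<eta>) * (\<eta> * \<alpha> + \<beta>) * sum x (cut_edges G S)))"
    using thin_prog_correct[OF inst \<eta> enc, of R] by blast
qed

end
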